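(* Let $A,B\in\mathbf{P}_n$ and let $1<p\le 2$. (i) For every $C\in\mathbf{P}_n$, $$\frac{\delta_p(A,C)^2+\delta_p(B,C)^2}{2}\ \ge\ \delta_p(A\#B,C)^2+\frac{p-1}{4}\,\delta_p(A,B)^2 .$$ (ii) In the case $C=I$, $$\frac{\delta_p(A,I)^2+\delta_p(B,I)^2}{2}\ \ge\ \delta_p(A\#B,I)^2+\frac{p-1}{4}\,\delta_p(A,B)^2 .$$ (iii) In particular, if $A,B\in E_p$, then $$1-\delta_p(A\#B,I)\ \ge\ \frac{p-1}{8}\,\delta_p(A,B)^2 .$$ (iv) The constant $\frac{p-1}{4}$ in (ii) (and consequently the constant $\frac{p-1}{8}$ in (iii)) is best possible, i.e. it cannot be replaced by a larger constant for which the inequality holds for all matrix sizes $n$ and all admissible $A,B$; but equality holds only when $p=2$ and $[A,B]=0$. (v) In general, the inequality in (i) is strict unless $A,B,C$ $\Gamma$-commute, and the inequalities in (ii) and (iii) are strict unless $A$ and $B$ commute.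
   Context: $\mathbf{P}_n=\mathbf{P}_{n\times n}(\mathbb{C})$ denotes the set of $n\times n$ complex positive definite (Hermitian) matrices, $I$ the identity matrix, and $[A,B]=AB-BA$. For $1<p<\infty$, $\|X\|_p=(\operatorname{Tr}|X|^p)^{1/p}$ is the Schatten $p$-norm. The distance $\delta_p$ on $\mathbf{P}_n$ is $$\delta_p(A,B)=\left\|\log\left(A^{-1/2}BA^{-1/2}\right)\right\|_p ,$$ which is the geodesic distance, i.e. the infimum of $\int_0^1\|\gamma(t)^{-1/2}\gamma'(t)\gamma(t)^{-1/2}\|_p\,dt$ over smooth curves $\gamma:[0,1]\to\mathbf{P}_n$ with $\gamma(0)=A$, $\gamma(1)=B$. The matrix geometric mean (the geodesic midpoint) is $$A\#B=A^{1/2}\left(A^{-1/2}BA^{-1/2}\right)^{1/2}A^{1/2}.$$ The exponential unit sphere is $E_p=\{U\in\mathbf{P}_n:\ \delta_p(U,I)=1\}$. Matrices $A,B,C\in\mathbf{P}_n$ are said to $\Gamma$-commute if there exists an invertible $X\in M_{n\times n}(\mathbb{C})$ such that $XAX^*$, $XBX^*$, $XCX^*$ all commute with one another; equivalently, $AB^{-1}C=CB^{-1}A$; equivalently, $[A^{-1/2}BA^{-1/2},A^{-1/2}CA^{-1/2}]=0$.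
   Formalization: In (iv), the clause "equality holds only when p=2 and [A,B]=0" is proved for A ≠ B only, for equality in (ii) and in (iii), since for A = B equality holds for every p. *)

theory Defs
  imports "Jordan_Normal_Form.Schur_Decomposition"
begin

definition hermitian_mat :: "complex mat \<Rightarrow> bool" where
  "hermitian_mat A \<longleftrightarrow> mat_adjoint A = A"

definition unitary_mat :: "nat \<Rightarrow> complex mat \<Rightarrow> bool" where
  "unitary_mat n U \<longleftrightarrow> U \<in> carrier_mat n n \<and> mat_adjoint U * U = 1\<^sub>m n"

definition pos_def_mats :: "nat \<Rightarrow> complex mat set" where
  "pos_def_mats n = {A \<in> carrier_mat n n. hermitian_mat A \<and>
     (\<forall>v \<in> carrier_vec n. v \<noteq> 0\<^sub>v n \<longrightarrow> Re ((A *\<^sub>v v) \<bullet>c v) > 0)}"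

definition real_diag :: "nat \<Rightarrow> (nat \<Rightarrow> real) \<Rightarrow> complex mat" where
  "real_diag n d = mat_diag n (\<lambda>i. complex_of_real (d i))"

text \<open>Functional calculus for Hermitian matrices: if A is U diag(d) U* with U unitary and d real,
  then f(A) is U diag(f o d) U*. The result does not depend on the choice of the diagonalization
  (lemma \<open>herm_fun_eq\<close> below). The value is unspecified for matrices that are not Hermitian.\<close>

definition herm_fun :: "(real \<Rightarrow> real) \<Rightarrow> complex mat \<Rightarrow> complex mat" where
  "herm_fun f A = (THE B. \<exists>U d. unitary_mat (dim_row A) U \<and>
     A = U * real_diag (dim_row A) d * mat_adjoint U \<and>
     B = U * real_diag (dim_row A) (f \<circ> d) * mat_adjoint U)"

text \<open>Real powers of positive definite matrices, and of positive semidefinite ones for positive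
  exponents (where \<open>0 powr r = 0\<close> is the intended value).\<close>

definition mat_powr :: "complex mat \<Rightarrow> real \<Rightarrow> complex mat" where
  "mat_powr A r = herm_fun (\<lambda>t. t powr r) A"

definition mat_log :: "complex mat \<Rightarrow> complex mat" where
  "mat_log A = herm_fun ln A"

definition mat_abs :: "complex mat \<Rightarrow> complex mat" where
  "mat_abs X = mat_powr (mat_adjoint X * X) (1/2)"

definition mat_trace :: "complex mat \<Rightarrow> complex" where
  "mat_trace A = (\<Sum>i<dim_row A. A $$ (i, i))"

text \<open>The trace below is a nonnegative real number, so \<open>Re\<close> only changes its type.\<close>

definition schatten_norm :: "real \<Rightarrow> complex mat \<Rightarrow> real" where
  "schatten_norm p X = Re (mat_trace (mat_powr (mat_abs X) p)) powr (1/p)"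

definition delta :: "real \<Rightarrow> complex mat \<Rightarrow> complex mat \<Rightarrow> real" where
  "delta p A B =
     schatten_norm p (mat_log (mat_powr A (-1/2) * B * mat_powr A (-1/2)))"

definition geom_mean :: "complex mat \<Rightarrow> complex mat \<Rightarrow> complex mat" (infixl \<open>#\<^sub>m\<close> 70) where
  "A #\<^sub>m B = mat_powr A (1/2) *
     mat_powr (mat_powr A (-1/2) * B * mat_powr A (-1/2)) (1/2) * mat_powr A (1/2)"

definition exp_unit_sphere :: "real \<Rightarrow> nat \<Rightarrow> complex mat set" where
  "exp_unit_sphere p n = {U \<in> pos_def_mats n. delta p U (1\<^sub>m n) = 1}"

definition commutator :: "complex mat \<Rightarrow> complex mat \<Rightarrow> complex mat" where
  "commutator A B = A * B - B * A"

definition gamma_commute :: "nat \<Rightarrow> complex mat \<Rightarrow> complex mat \<Rightarrow> complex mat \<Rightarrow> bool" where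
  "gamma_commute n A B C \<longleftrightarrow> (\<exists>X \<in> carrier_mat n n. invertible_mat X \<and>
     (let A' = X * A * mat_adjoint X; B' = X * B * mat_adjoint X; C' = X * C * mat_adjoint X
      in A' * B' = B' * A' \<and> A' * C' = C' * A' \<and> B' * C' = C' * B'))"

lemma mat_adjoint_carrier: "A \<in> carrier_mat n m \<Longrightarrow> mat_adjoint A \<in> carrier_mat m n"
  unfolding mat_adjoint_def by (auto simp: mat_of_rows_def)

lemma real_diag_carrier: "real_diag n d \<in> carrier_mat n n"
  unfolding real_diag_def by (simp add: mat_diag_def)

lemma unitary_mat_right:
  assumes "unitary_mat n U"
  shows "U * mat_adjoint U = 1\<^sub>m n"
  using assms mat_mult_left_right_inverse[OF mat_adjoint_carrier]
  unfolding unitary_mat_def by blast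

lemma diagonalization_unique:
  assumes U: "unitary_mat n U" and V: "unitary_mat n V"
    and eq: "U * real_diag n d * mat_adjoint U = V * real_diag n e * mat_adjoint V"
  shows "U * real_diag n (f \<circ> d) * mat_adjoint U = V * real_diag n (f \<circ> e) * mat_adjoint V"
proof -
  note D = real_diag_carrier[of n]
  have Uc: "U \<in> carrier_mat n n" and Vc: "V \<in> carrier_mat n n"
    and UU: "mat_adjoint U * U = 1\<^sub>m n" and VV: "mat_adjoint V * V = 1\<^sub>m n"
    using U V unfolding unitary_mat_def by auto
  have U'c: "mat_adjoint U \<in> carrier_mat n n" and V'c: "mat_adjoint V \<in> carrier_mat n n"
    using mat_adjoint_carrier Uc Vc by auto
  define W where "W = mat_adjoint V * U"
  have Wc: "W \<in> carrier_mat n n" using V'c Uc unfolding W_def by auto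
  note asc = assoc_mult_mat[of _ n n _ n _ n]
  have VW: "V * W = U"
    using asc[OF Vc V'c Uc] unitary_mat_right[OF V] Uc unfolding W_def by simp
  have WU: "W * mat_adjoint U = mat_adjoint V"
    using asc[OF V'c Uc U'c] unitary_mat_right[OF U] V'c unfolding W_def by simp
  have V'V: "mat_adjoint V * (V * X) = X" if "X \<in> carrier_mat n n" for X
    using asc[OF V'c Vc that] VV that by simp
  have "V * (real_diag n e * W) = V * real_diag n e * mat_adjoint V * U"
    using Vc V'c Uc D[of e] unfolding W_def by (simp add: asc[OF _ _ mult_carrier_mat] asc)
  also have "\<dots> = U * real_diag n d * mat_adjoint U * U" using eq by simp
  also have "\<dots> = U * real_diag n d * (mat_adjoint U * U)"
    by (rule asc) (use Uc U'c D[of d] in auto)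
  also have "\<dots> = V * (W * real_diag n d)"
    unfolding UU using asc[OF Vc Wc D[of d]] VW Uc D[of d] by simp
  finally have "mat_adjoint V * (V * (real_diag n e * W)) = mat_adjoint V * (V * (W * real_diag n d))"
    by simp
  hence WD: "real_diag n e * W = W * real_diag n d"
    using V'V Wc D by (metis mult_carrier_mat)
  have entry: "W $$ (i, j) * complex_of_real (d j) = complex_of_real (e i) * W $$ (i, j)"
    if "i < n" "j < n" for i j
    using arg_cong[OF WD, of "\<lambda>M. M $$ (i, j)"] that Wc
    unfolding real_diag_def mat_diag_mult_left[OF Wc] mat_diag_mult_right[OF Wc] by auto
  have WF: "W * real_diag n (f \<circ> d) = real_diag n (f \<circ> e) * W"
  proof (rule eq_matI)
    fix i j assume "i < dim_row (real_diag n (f \<circ> e) * W)" "j < dim_col (real_diag n (f \<circ> e) * W)"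
    hence ij: "i < n" "j < n" using Wc D[of "f \<circ> e"] by auto
    have "W $$ (i, j) = 0 \<or> d j = e i" using entry[OF ij] by (simp add: mult.commute)
    thus "(W * real_diag n (f \<circ> d)) $$ (i, j) = (real_diag n (f \<circ> e) * W) $$ (i, j)"
      using ij unfolding real_diag_def mat_diag_mult_left[OF Wc] mat_diag_mult_right[OF Wc] by auto
  qed (use Wc D[of "f \<circ> d"] D[of "f \<circ> e"] in auto)
  have "U * real_diag n (f \<circ> d) * mat_adjoint U = V * (W * real_diag n (f \<circ> d)) * mat_adjoint U"
    using asc[OF Vc Wc D[of "f \<circ> d"]] VW by simp
  also have "\<dots> = V * real_diag n (f \<circ> e) * (W * mat_adjoint U)"
    unfolding WF using Vc Wc U'c D[of "f \<circ> e"] by (simp add: asc[OF Vc] asc)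
  finally show ?thesis unfolding WU .
qed

lemma herm_fun_eq:
  assumes U: "unitary_mat n U"
  shows "herm_fun f (U * real_diag n d * mat_adjoint U) = U * real_diag n (f \<circ> d) * mat_adjoint U"
proof -
  have n: "dim_row (U * real_diag n d * mat_adjoint U) = n"
    using U unfolding unitary_mat_def by auto
  show ?thesis
    unfolding herm_fun_def n
    by (rule the_equality) (use U diagonalization_unique[OF U] in metis)+
qed

end

theory Submission
  imports "HOL-Analysis.Equivalence_Lebesgue_Henstock_Integration" "HOL-Real_Asymp.Real_Asymp" Defs
begin

text \<open>
  The inequality is a parallelogram-type inequality for the Schatten norm, carried over to the curved
  space of positive definite matrices by comparison with its tangent space.

  Congruences are isometries (\<open>delta_congruence\<close>), and one of them takes \<open>A\<close> and \<open>B\<close> to \<open>exp (-H/2)\<close> and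
  \<open>exp (H/2)\<close>, their geometric mean to the identity and \<open>C\<close> to some \<open>exp Z\<close> (\<open>geodesic_normal_form\<close>). Then
  \<open>\<delta>(A, B) = \<parallel>H\<parallel>\<close> and \<open>\<delta>(A # B, C) = \<parallel>Z\<parallel>\<close>, and the exponential metric increasing property
  \<open>\<delta>(exp X, exp Y) \<ge> \<parallel>Y - X\<parallel>\<close> bounds \<open>\<delta>(A, C)\<close> and \<open>\<delta>(B, C)\<close> from below by \<open>\<parallel>Z + H/2\<parallel>\<close> and \<open>\<parallel>Z - H/2\<parallel>\<close>. What
  remains is the optimal 2-uniform convexity of the Schatten norm on Hermitian matrices,
  \<open>(\<parallel>Z + Y\<parallel>\<^sup>2 + \<parallel>Z - Y\<parallel>\<^sup>2) / 2 \<ge> \<parallel>Z\<parallel>\<^sup>2 + (p - 1) \<parallel>Y\<parallel>\<^sup>2\<close>, for \<open>Y = H/2\<close>.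

  Exponential metric increasing property (\<open>exponential_metric_increasing\<close>). Let \<open>H\<close> be the logarithm of
  \<open>exp (-X/2) exp Y exp (-X/2)\<close>. The logarithm is operator monotone and logarithms of determinants add up;
  from these two facts the eigenvalues of \<open>Y - X\<close> are majorized by those of \<open>H\<close> (\<open>hinge_log_difference\<close>),
  so every convex function, in particular \<open>\<bar>x\<bar>\<^sup>p\<close>, has the smaller trace on \<open>Y - X\<close>. Equality for a strictly
  convex function makes the two spectra equal, and then a comparison of \<open>tr (T\<^sup>2)\<close> with \<open>tr (T\<^sup>* T)\<close> for
  \<open>T = exp (Y/2) exp (-X/2)\<close> shows that \<open>X\<close> and \<open>Y\<close> commute (\<open>equal_spectra_imp_commute\<close>).

  Uniform convexity (\<open>schatten_two_uniform_convexity\<close>). For \<open>p < 2\<close> it is enough to bound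
  \<open>N(t) = tr \<bar>Z + t Y\<bar>\<^sup>p\<close> from below to second order around every \<open>t\<close>. Klein's identity reduces the
  second-order gap to scalar gaps between eigenvalues (\<open>abs_powr_gap\<close>). Their weights, with exponent \<open>p - 2\<close>,
  involve the absolute values of both matrices, one acting from the left and one from the right; they are
  handled by duality and operator concavity (\<open>mixed_powr_weight_le\<close>, \<open>mixed_powr_weight_ge\<close>). Strictness for \<open>p < 2\<close> follows
  from the inequality itself, applied to \<open>Z \<oplus> Z\<close> and \<open>Y \<oplus> -Y\<close> and to half the increment
  (\<open>schatten_two_uniform_convexity_strict\<close>).

  So equality needs equality in both ingredients: the first fails unless \<open>H\<close> and \<open>Z\<close> commute, which is
  \<open>\<Gamma>\<close>-commutation of \<open>A, B, C\<close>, and the second fails for \<open>p < 2\<close> unless \<open>A = B\<close>. The constants are optimal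
  already for diagonal two by two matrices close to a multiple of the identity
  (\<open>constant_optimal\<close>, \<open>sphere_constant_optimal\<close>).
\<close>

unbundle no vec_syntax

section \<open>Adjoints, traces and square matrices\<close>

lemma mat_adjoint_dim [simp]:
  "dim_row (mat_adjoint A) = dim_col A" "dim_col (mat_adjoint A) = dim_row A"
  by (simp_all add: mat_adjoint_def)

lemma mat_adjoint_index:
  "i < dim_col A \<Longrightarrow> j < dim_row A \<Longrightarrow> mat_adjoint A $$ (i, j) = conjugate (A $$ (j, i))"
  by (simp add: mat_adjoint_def mat_of_rows_index)

lemma mult_mat_index:
  assumes "A \<in> carrier_mat a n" "B \<in> carrier_mat n b" "i < a" "j < b"
  shows "(A * B) $$ (i, j) = (\<Sum>k<n. A $$ (i, k) * B $$ (k, j))"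
  using assms by (simp add: scalar_prod_def lessThan_atLeast0)

lemma mat_adjoint_mult:
  fixes A B :: "complex mat"
  assumes A: "A \<in> carrier_mat a n" and B: "B \<in> carrier_mat n b"
  shows "mat_adjoint (A * B) = mat_adjoint B * mat_adjoint A"
proof (rule eq_matI)
  fix i j assume "i < dim_row (mat_adjoint B * mat_adjoint A)" "j < dim_col (mat_adjoint B * mat_adjoint A)"
  hence ij: "i < b" "j < a" using A B by auto
  have "mat_adjoint (A * B) $$ (i, j) = cnj ((A * B) $$ (j, i))"
    using ij A B by (subst mat_adjoint_index) auto
  also have "\<dots> = (\<Sum>k<n. mat_adjoint B $$ (i, k) * mat_adjoint A $$ (k, j))"
    using ij A B
    by (subst mult_mat_index[OF A B])
       (auto simp: mat_adjoint_index mult.commute intro!: sum.cong)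
  also have "\<dots> = (mat_adjoint B * mat_adjoint A) $$ (i, j)"
    using ij mult_mat_index[OF mat_adjoint_carrier[OF B] mat_adjoint_carrier[OF A]] by simp
  finally show "mat_adjoint (A * B) $$ (i, j) = (mat_adjoint B * mat_adjoint A) $$ (i, j)" .
qed (use A B in auto)

lemma mat_adjoint_adjoint [simp]: "mat_adjoint (mat_adjoint A) = (A :: complex mat)"
  by (rule eq_matI) (auto simp: mat_adjoint_index)

lemma mat_adjoint_one [simp]: "mat_adjoint (1\<^sub>m n :: complex mat) = 1\<^sub>m n"
  by (rule eq_matI) (auto simp: mat_adjoint_index)

lemma mat_adjoint_real_diag [simp]: "mat_adjoint (real_diag n d) = real_diag n d"
  unfolding real_diag_def by (rule eq_matI) (auto simp: mat_adjoint_index mat_diag_def)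

lemma mat_adjoint_add:
  fixes A :: "complex mat"
  assumes "A \<in> carrier_mat a b" "B \<in> carrier_mat a b"
  shows "mat_adjoint (A + B) = mat_adjoint A + mat_adjoint B"
  by (rule eq_matI) (use assms in \<open>auto simp: mat_adjoint_index\<close>)

lemma mat_adjoint_minus:
  fixes A :: "complex mat"
  assumes "A \<in> carrier_mat a b" "B \<in> carrier_mat a b"
  shows "mat_adjoint (A - B) = mat_adjoint A - mat_adjoint B"
  by (rule eq_matI) (use assms in \<open>auto simp: mat_adjoint_index\<close>)

lemma mat_adjoint_smult:
  "mat_adjoint (c \<cdot>\<^sub>m A) = cnj c \<cdot>\<^sub>m mat_adjoint (A :: complex mat)"
  by (rule eq_matI) (auto simp: mat_adjoint_index)

lemma mat_adjoint_carrier_square [simp]: "mat_adjoint A \<in> carrier_mat n n \<longleftrightarrow> A \<in> carrier_mat n n"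
  using mat_adjoint_dim[of A] unfolding carrier_mat_def by auto

lemma real_diag_carrier_square [simp]: "real_diag n d \<in> carrier_mat n n"
  by (rule real_diag_carrier)

lemma mult_carrier_square [simp]:
  "A \<in> carrier_mat n n \<Longrightarrow> B \<in> carrier_mat n n \<Longrightarrow> A * B \<in> carrier_mat n n"
  by (rule mult_carrier_mat)

lemma mult_assoc_square:
  fixes A :: "complex mat"
  assumes "A \<in> carrier_mat n n" "B \<in> carrier_mat n n" "C \<in> carrier_mat n n"
  shows "A * B * C = A * (B * C)"
  using assms by (rule assoc_mult_mat)

lemma real_diag_index:
  "i < n \<Longrightarrow> j < n \<Longrightarrow> real_diag n d $$ (i, j) = (if i = j then of_real (d i) else 0)"
  by (simp add: real_diag_def mat_diag_def)

lemma real_diag_mult: "real_diag n d * real_diag n e = real_diag n (\<lambda>i. d i * e i)"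
  by (simp add: real_diag_def mat_diag_diag)

lemma real_diag_add: "real_diag n d + real_diag n e = real_diag n (\<lambda>i. d i + e i)"
  by (rule eq_matI) (auto simp: real_diag_def mat_diag_def)

lemma real_diag_smult: "of_real c \<cdot>\<^sub>m real_diag n d = real_diag n (\<lambda>i. c * d i)"
  by (rule eq_matI) (auto simp: real_diag_def mat_diag_def)

lemma real_diag_one: "real_diag n (\<lambda>_. 1) = 1\<^sub>m n"
  by (rule eq_matI) (auto simp: real_diag_def mat_diag_def)

lemma real_diag_conj_index:
  assumes U: "U \<in> carrier_mat n n" and V: "V \<in> carrier_mat n n" and i: "i < n" and j: "j < n"
  shows "(U * real_diag n d * V) $$ (i, j) = (\<Sum>k<n. U $$ (i, k) * of_real (d k) * V $$ (k, j))"
proof -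
  have "U * real_diag n d = mat n n (\<lambda>(i, j). U $$ (i, j) * of_real (d j))"
    unfolding real_diag_def by (rule mat_diag_mult_right[OF U])
  then show ?thesis using V i j
    by (subst mult_mat_index[of _ n n _ n]) auto
qed

lemma real_diag_dim [simp]: "dim_row (real_diag n d) = n" "dim_col (real_diag n d) = n"
  by (simp_all add: real_diag_def mat_diag_def)

lemma mult_one_square [simp]:
  fixes A :: "complex mat"
  shows "A \<in> carrier_mat n n \<Longrightarrow> A * 1\<^sub>m n = A" "A \<in> carrier_mat n n \<Longrightarrow> 1\<^sub>m n * A = A"
  by simp_all

lemma real_diag_mult_index:
  assumes "M \<in> carrier_mat n n" "i < n" "j < n"
  shows "(real_diag n d * M) $$ (i, j) = of_real (d i) * M $$ (i, j)"
    and "(M * real_diag n d) $$ (i, j) = M $$ (i, j) * of_real (d j)"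
  using assms unfolding real_diag_def mat_diag_mult_left[OF assms(1)] mat_diag_mult_right[OF assms(1)]
  by auto

definition tr :: "complex mat \<Rightarrow> real" where "tr A = Re (mat_trace A)"

lemma tr_sum: "A \<in> carrier_mat n n \<Longrightarrow> tr A = (\<Sum>i<n. Re (A $$ (i, i)))"
  by (simp add: tr_def mat_trace_def)

lemma tr_add:
  "A \<in> carrier_mat n n \<Longrightarrow> B \<in> carrier_mat n n \<Longrightarrow> tr (A + B) = tr A + tr B"
  by (simp add: tr_sum[of _ n] sum.distrib)

lemma tr_minus:
  "A \<in> carrier_mat n n \<Longrightarrow> B \<in> carrier_mat n n \<Longrightarrow> tr (A - B) = tr A - tr B"
  by (simp add: tr_sum[of _ n] minus_mat_def sum_subtractf)

lemma tr_adjoint: "A \<in> carrier_mat n n \<Longrightarrow> tr (mat_adjoint A) = tr A"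
  by (simp add: tr_sum[of _ n] mat_adjoint_index)

lemma tr_comm:
  assumes "A \<in> carrier_mat n n" "B \<in> carrier_mat n n"
  shows "tr (A * B) = tr (B * A)"
proof -
  have "tr (A * B) = Re (\<Sum>i<n. \<Sum>k<n. A $$ (i, k) * B $$ (k, i))"
    using assms by (simp add: tr_sum[of _ n] mult_mat_index[of A n n B n] del: index_mult_mat)
  also have "\<dots> = Re (\<Sum>k<n. \<Sum>i<n. B $$ (k, i) * A $$ (i, k))"
    by (subst sum.swap) (simp add: mult.commute)
  also have "\<dots> = tr (B * A)"
    using assms by (simp add: tr_sum[of _ n] mult_mat_index[of B n n A n] del: index_mult_mat)
  finally show ?thesis .
qed

lemma tr_real_diag: "tr (real_diag n d) = (\<Sum>i<n. d i)"
  by (simp add: tr_sum[of _ n] real_diag_index)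

lemma tr_adjoint_mult:
  assumes "A \<in> carrier_mat n n"
  shows "tr (mat_adjoint A * A) = (\<Sum>i<n. \<Sum>j<n. (cmod (A $$ (j, i)))\<^sup>2)"
  using assms
  by (simp add: tr_sum[of _ n] mult_mat_index[of "mat_adjoint A" n n A n] mat_adjoint_index
      cmod_power2 sum.distrib power2_eq_square[of "Re _"] power2_eq_square[of "Im _"] del: index_mult_mat)

lemma adjoint_mult_eq_0:
  assumes A: "A \<in> carrier_mat n n" and "tr (mat_adjoint A * A) = 0"
  shows "A = 0\<^sub>m n n"
proof (rule eq_matI)
  have "\<forall>i<n. \<forall>j<n. A $$ (j, i) = 0"
    using assms(2) unfolding tr_adjoint_mult[OF A]
    by (auto simp: sum_nonneg_eq_0_iff sum_nonneg)
  then show "A $$ (i, j) = 0\<^sub>m n n $$ (i, j)" if "i < dim_row (0\<^sub>m n n)" "j < dim_col (0\<^sub>m n n)" for i j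
    using that by auto
qed (use A in auto)

section \<open>Unitary matrices and the spectral theorem\<close>

lemma unitary_carrier: "unitary_mat n U \<Longrightarrow> U \<in> carrier_mat n n"
  by (simp add: unitary_mat_def)

lemma unitary_left: "unitary_mat n U \<Longrightarrow> mat_adjoint U * U = 1\<^sub>m n"
  by (simp add: unitary_mat_def)

lemma unitary_adjoint: "unitary_mat n U \<Longrightarrow> unitary_mat n (mat_adjoint U)"
  using unitary_mat_right by (auto simp: unitary_mat_def)

lemma unitary_one: "unitary_mat n (1\<^sub>m n)"
  by (simp add: unitary_mat_def)

lemma unitary_left_cancel:
  assumes "unitary_mat n U" "X \<in> carrier_mat n n"
  shows "mat_adjoint U * (U * X) = X" "U * (mat_adjoint U * X) = X"
  using assms unitary_left[OF assms(1)] unitary_mat_right[OF assms(1)] unitary_carrier[OF assms(1)]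
  by (simp_all flip: mult_assoc_square[of _ n])

lemma unitary_mult:
  assumes U: "unitary_mat n U" and V: "unitary_mat n V"
  shows "unitary_mat n (U * V)"
  using unitary_carrier[OF U] unitary_carrier[OF V] unitary_left[OF V]
  by (simp add: unitary_mat_def mat_adjoint_mult[of U n n V n] mult_assoc_square[of _ n] unitary_left_cancel[OF U])

definition herm :: "nat \<Rightarrow> complex mat \<Rightarrow> bool" where
  "herm n A \<longleftrightarrow> A \<in> carrier_mat n n \<and> mat_adjoint A = A"

definition eigen_dec :: "nat \<Rightarrow> complex mat \<Rightarrow> (nat \<Rightarrow> real) \<Rightarrow> complex mat \<Rightarrow> bool" where
  "eigen_dec n U d A \<longleftrightarrow> unitary_mat n U \<and> A = U * real_diag n d * mat_adjoint U"

definition dsum :: "nat \<Rightarrow> nat \<Rightarrow> complex mat \<Rightarrow> complex mat \<Rightarrow> complex mat" where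
  "dsum m n A B = four_block_mat A (0\<^sub>m m n) (0\<^sub>m n m) B"

lemma dsum_carrier:
  "A \<in> carrier_mat m m \<Longrightarrow> B \<in> carrier_mat n n \<Longrightarrow> dsum m n A B \<in> carrier_mat (m + n) (m + n)"
  by (simp add: dsum_def)

lemma dsum_mult:
  assumes "A \<in> carrier_mat m m" "B \<in> carrier_mat n n" "A' \<in> carrier_mat m m" "B' \<in> carrier_mat n n"
  shows "dsum m n A B * dsum m n A' B' = dsum m n (A * A') (B * B')"
  unfolding dsum_def using assms by (subst mult_four_block_mat) auto

lemma dsum_add:
  assumes "A \<in> carrier_mat m m" "B \<in> carrier_mat n n" "A' \<in> carrier_mat m m" "B' \<in> carrier_mat n n"
  shows "dsum m n A B + dsum m n A' B' = dsum m n (A + A') (B + B')"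
  unfolding dsum_def by (rule eq_matI) (use assms in auto)

lemma dsum_adjoint:
  assumes "A \<in> carrier_mat m m" "B \<in> carrier_mat n n"
  shows "mat_adjoint (dsum m n A B) = dsum m n (mat_adjoint A) (mat_adjoint B)"
  unfolding dsum_def by (rule eq_matI) (use assms in \<open>auto simp: mat_adjoint_index\<close>)

lemma dsum_one: "dsum m n (1\<^sub>m m) (1\<^sub>m n) = 1\<^sub>m (m + n)"
  unfolding dsum_def by (rule eq_matI) auto

lemma dsum_real_diag:
  "dsum m n (real_diag m d) (real_diag n e) = real_diag (m + n) (\<lambda>i. if i < m then d i else e (i - m))"
  unfolding dsum_def
  by (rule eq_matI) (auto simp: real_diag_def mat_diag_def)

lemma eigen_dec_carrier: "eigen_dec n U d A \<Longrightarrow> A \<in> carrier_mat n n"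
  by (auto simp: eigen_dec_def unitary_carrier)

lemma eigen_dec_dsum:
  assumes A: "eigen_dec m U d A" and B: "eigen_dec n V e B"
  shows "eigen_dec (m + n) (dsum m n U V) (\<lambda>i. if i < m then d i else e (i - m)) (dsum m n A B)"
proof -
  have U: "unitary_mat m U" "U \<in> carrier_mat m m" "A = U * real_diag m d * mat_adjoint U"
    and V: "unitary_mat n V" "V \<in> carrier_mat n n" "B = V * real_diag n e * mat_adjoint V"
    using A B by (auto simp: eigen_dec_def unitary_carrier)
  show ?thesis
    unfolding eigen_dec_def unitary_mat_def
    using U(2) V(2) unitary_left[OF U(1)] unitary_left[OF V(1)]
    by (simp add: U(3) V(3) dsum_carrier dsum_adjoint dsum_mult dsum_one flip: dsum_real_diag)
qed

lemma eigen_dec_unitary_conj: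
  assumes W: "unitary_mat n W" and A: "eigen_dec n U d A"
  shows "eigen_dec n (W * U) d (W * A * mat_adjoint W)"
  using A unitary_carrier[OF W] unitary_carrier[of n U] unitary_mult[OF W]
  by (auto simp: eigen_dec_def mat_adjoint_mult[of W n n U n] mult_assoc_square[of _ n])

lemma eigen_dec_herm: "eigen_dec n U d A \<Longrightarrow> herm n A"
  unfolding eigen_dec_def herm_def
  by (auto simp: mat_adjoint_mult[of _ n n _ n] mult_assoc_square[of _ n] unitary_carrier)

lemma herm_conj:
  assumes "herm n A" "S \<in> carrier_mat n n"
  shows "herm n (S * A * mat_adjoint S)"
  using assms unfolding herm_def
  by (auto simp: mat_adjoint_mult[of _ n n _ n] mult_assoc_square[of _ n])

text \<open>The vector is completed to a basis, which is made orthogonal by the Gram-Schmidt process and then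
  normalized.\<close>

lemma unitary_first_column:
  assumes v: "v \<in> carrier_vec n" and v0: "v \<noteq> 0\<^sub>v n"
  obtains W c where "unitary_mat n W" "col W 0 = complex_of_real c \<cdot>\<^sub>v v"
proof -
  interpret cof_vec_space n "TYPE(complex)" .
  note bc = basis_completion[OF v v0]
  define ws where "ws = gram_schmidt n (basis_completion v)"
  note gs = gram_schmidt_result[OF bc(2) bc(4) bc(5) ws_def]
  have n0: "n > 0" using v v0 by (cases n) auto
  have len: "length ws = n" using gs(4) bc(6) by simp
  have hd: "ws ! 0 = v"
  proof -
    obtain bs where "basis_completion v = v # bs"
      using bc(6,7) n0 by (cases "basis_completion v") auto
    then have "hd ws = v" using v unfolding ws_def by (simp add: gram_schmidt_hd)
    then show ?thesis using len n0 by (cases ws) auto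
  qed
  have wsc: "ws ! i \<in> carrier_vec n" if "i < n" for i using gs(3) len that by (auto simp: set_conv_nth)
  define r where "r i = 1 / sqrt (Re (ws ! i \<bullet>c ws ! i))" for i
  define W where "W = mat n n (\<lambda>(j, i). complex_of_real (r i) * ws ! i $ j)"
  have W: "W \<in> carrier_mat n n" by (simp add: W_def)
  have dot: "ws ! j \<bullet>c ws ! i = (\<Sum>k<n. cnj (ws ! i $ k) * ws ! j $ k)" if "i < n" "j < n" for i j
    using wsc[OF that(1)] wsc[OF that(2)] by (simp add: scalar_prod_def lessThan_atLeast0 mult.commute)
  have sq: "ws ! i \<bullet>c ws ! i = of_real (\<Sum>k<n. (cmod (ws ! i $ k))\<^sup>2)" if "i < n" for i
    unfolding dot[OF that that] by (simp add: complex_norm_square[unfolded of_real_power] mult.commute)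
  have nz: "ws ! i \<bullet>c ws ! i \<noteq> 0" if "i < n" for i
    using corthogonalD[OF gs(2), of i i] that len by auto
  have "mat_adjoint W * W = 1\<^sub>m n"
  proof (rule eq_matI)
    fix i j assume "i < dim_row (1\<^sub>m n :: complex mat)" "j < dim_col (1\<^sub>m n :: complex mat)"
    hence ij: "i < n" "j < n" by auto
    have "(mat_adjoint W * W) $$ (i, j) = (\<Sum>k<n. of_real (r i) * cnj (ws ! i $ k) * (of_real (r j) * ws ! j $ k))"
      using ij by (subst mult_mat_index[OF mat_adjoint_carrier[OF W] W])
        (auto simp: mat_adjoint_index W_def)
    also have "\<dots> = of_real (r i * r j) * (ws ! j \<bullet>c ws ! i)"
      unfolding dot[OF ij] by (simp add: sum_distrib_left ac_simps)
    also have "\<dots> = (if i = j then 1 else 0)"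
    proof (cases "i = j")
      case True
      define s where "s = (\<Sum>k<n. (cmod (ws ! i $ k))\<^sup>2)"
      have ws: "ws ! i \<bullet>c ws ! i = of_real s" unfolding s_def by (rule sq[OF ij(1)])
      have s: "s \<ge> 0" by (auto simp: s_def sum_nonneg)
      have "s \<noteq> 0" using ws nz[OF ij(1)] by auto
      have ri: "r i * r i * s = 1" using s \<open>s \<noteq> 0\<close> by (simp add: r_def ws)
      have "of_real (r i * r i) * (ws ! i \<bullet>c ws ! i) = complex_of_real (r i * r i * s)"
        unfolding ws by simp
      then have "of_real (r i * r i) * (ws ! i \<bullet>c ws ! i) = 1" unfolding ri by simp
      then show ?thesis using True by (simp only: if_True refl)
    next
      case False
      then show ?thesis using corthogonalD[OF gs(2), of j i] ij len by auto
    qed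
    finally show "(mat_adjoint W * W) $$ (i, j) = 1\<^sub>m n $$ (i, j)" using ij by simp
  qed (use W in auto)
  then have "unitary_mat n W" using W by (simp add: unitary_mat_def)
  moreover have "col W 0 = complex_of_real (r 0) \<cdot>\<^sub>v v"
    by (rule eq_vecI) (use n0 v hd in \<open>auto simp: W_def\<close>)
  ultimately show ?thesis using that by blast
qed

lemma unitary_conj_cancel:
  assumes W: "unitary_mat n W" and A: "A \<in> carrier_mat n n"
  shows "W * (mat_adjoint W * A * W) * mat_adjoint W = A"
  using A unitary_carrier[OF W] unitary_mat_right[OF W]
  by (simp add: mult_assoc_square[of _ n] unitary_left_cancel[OF W])

text \<open>Conjugating by a unitary matrix whose first column is an eigenvector splits off a block of
  size one: the first column of the result is a multiple of the first unit vector, and so is the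
  first row because the result is Hermitian.\<close>

lemma spectral_theorem:
  assumes "herm n A"
  shows "\<exists>U d. eigen_dec n U d A"
  using assms
proof (induction n arbitrary: A)
  case 0
  then have "eigen_dec 0 (1\<^sub>m 0) (\<lambda>_. 0) A"
    unfolding herm_def eigen_dec_def by (auto simp: unitary_one intro!: eq_matI)
  then show ?case by blast
next
  case (Suc n A)
  have A: "A \<in> carrier_mat (Suc n) (Suc n)" and AA: "mat_adjoint A = A"
    using Suc.prems by (auto simp: herm_def)
  obtain as where as: "char_poly A = (\<Prod>a\<leftarrow>as. [:- a, 1:])" "length as = Suc n"
    using char_poly_factorized[OF A] by auto
  then have "poly (char_poly A) (as ! 0) = 0" by (cases as) auto
  then have "eigenvalue A (as ! 0)" by (simp add: eigenvalue_root_char_poly[OF A])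
  then obtain v e where v: "v \<in> carrier_vec (Suc n)" "v \<noteq> 0\<^sub>v (Suc n)" "A *\<^sub>v v = e \<cdot>\<^sub>v v"
    using A by (auto simp: eigenvalue_def eigenvector_def)
  obtain W c where W: "unitary_mat (Suc n) W" "col W 0 = complex_of_real c \<cdot>\<^sub>v v"
    using unitary_first_column[OF v(1,2)] by blast
  note Wc = unitary_carrier[OF W(1)]
  define B where "B = mat_adjoint W * A * W"
  have hB: "herm (Suc n) B"
    using herm_conj[OF Suc.prems, of "mat_adjoint W"] Wc unfolding B_def by simp
  then have B: "B \<in> carrier_mat (Suc n) (Suc n)" and BB: "mat_adjoint B = B" by (auto simp: herm_def)
  have "col B 0 = mat_adjoint W *\<^sub>v col (A * W) 0"
    unfolding B_def using A Wc
    by (subst mult_assoc_square[of _ "Suc n"]; simp; subst col_mult2[of _ "Suc n" "Suc n" _ "Suc n"]; simp)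
  also have "col (A * W) 0 = A *\<^sub>v col W 0" using A Wc by (intro col_mult2) auto
  also have "\<dots> = e \<cdot>\<^sub>v col W 0"
    unfolding W(2) using v A by (simp add: mult_mat_vec smult_smult_assoc mult.commute)
  also have "mat_adjoint W *\<^sub>v (e \<cdot>\<^sub>v col W 0) = e \<cdot>\<^sub>v (mat_adjoint W *\<^sub>v col W 0)"
    using Wc by (intro mult_mat_vec[of _ "Suc n" "Suc n"]) (auto intro!: carrier_vecI)
  also have "mat_adjoint W *\<^sub>v col W 0 = col (1\<^sub>m (Suc n)) 0"
    using Wc unitary_left[OF W(1)] col_mult2[of "mat_adjoint W" "Suc n" "Suc n" W "Suc n" 0] by simp
  finally have colB: "col B 0 = e \<cdot>\<^sub>v unit_vec (Suc n) 0" by simp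
  have B0: "B $$ (i, 0) = (if i = 0 then e else 0)" if "i < Suc n" for i
    using arg_cong[OF colB, of "\<lambda>w. w $ i"] that B by auto
  have B0': "B $$ (i, j) = cnj (B $$ (j, i))" if "i < Suc n" "j < Suc n" for i j
    using that B mat_adjoint_index[of i B j] unfolding BB by simp
  have e: "e = of_real (Re e)" using B0[of 0] B0'[of 0 0] by (auto simp: complex_eq_iff)
  define B1 where "B1 = mat n n (\<lambda>(i, j). B $$ (Suc i, Suc j))"
  have hB1: "herm n B1"
    unfolding herm_def B1_def by (auto simp: mat_adjoint_index intro!: eq_matI) (simp add: B0'[symmetric])
  obtain U d where U: "eigen_dec n U d B1" using Suc.IH[OF hB1] by blast
  have BD: "B = dsum 1 n (real_diag 1 (\<lambda>_. Re e)) B1"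
  proof (rule eq_matI)
    fix i j assume "i < dim_row (dsum 1 n (real_diag 1 (\<lambda>_. Re e)) B1)"
      "j < dim_col (dsum 1 n (real_diag 1 (\<lambda>_. Re e)) B1)"
    then have ij: "i < Suc n" "j < Suc n" by (auto simp: dsum_def B1_def real_diag_def mat_diag_def)
    show "B $$ (i, j) = dsum 1 n (real_diag 1 (\<lambda>_. Re e)) B1 $$ (i, j)"
      using ij B0[of i] B0[of j] B0'[of i j] e
      by (cases i; cases j) (auto simp: dsum_def B1_def real_diag_def mat_diag_def)
  qed (use B in \<open>auto simp: dsum_def B1_def real_diag_def mat_diag_def\<close>)
  have "eigen_dec 1 (1\<^sub>m 1) (\<lambda>_. Re e) (real_diag 1 (\<lambda>_. Re e))"
    by (simp add: eigen_dec_def unitary_one left_mult_one_mat[OF real_diag_carrier]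
        right_mult_one_mat[OF real_diag_carrier])
  from eigen_dec_dsum[OF this U] obtain V f where "eigen_dec (Suc n) V f B"
    unfolding BD[symmetric] by auto
  from eigen_dec_unitary_conj[OF W(1) this] show ?case
    unfolding B_def unitary_conj_cancel[OF W(1) A] by blast
qed

section \<open>Functional calculus\<close>

lemma eigen_dec_cong:
  assumes "\<And>i. i < n \<Longrightarrow> d i = e i"
  shows "eigen_dec n U d A \<longleftrightarrow> eigen_dec n U e A"
proof -
  have "real_diag n d = real_diag n e"
    by (rule eq_matI) (auto simp: real_diag_def mat_diag_def assms)
  then show ?thesis by (simp add: eigen_dec_def)
qed

lemma eigen_dec_unitary: "eigen_dec n U d A \<Longrightarrow> unitary_mat n U"
  by (simp add: eigen_dec_def)

lemma eigen_dec_unique: "eigen_dec n U d A \<Longrightarrow> eigen_dec n U d B \<Longrightarrow> A = B"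
  by (simp add: eigen_dec_def)

lemma eigen_dec_diagonalize:
  assumes "eigen_dec n U d A"
  shows "mat_adjoint U * A * U = real_diag n d"
proof -
  have U: "unitary_mat n U" and "A = U * real_diag n d * mat_adjoint U" using assms by (auto simp: eigen_dec_def)
  then show ?thesis
    using unitary_carrier[OF U] unitary_left[OF U] right_mult_one_mat[OF real_diag_carrier]
    by (simp add: mult_assoc_square[of _ n] unitary_left_cancel[OF U])
qed

lemma eigen_dec_herm_fun: "eigen_dec n U d A \<Longrightarrow> eigen_dec n U (\<lambda>i. f (d i)) (herm_fun f A)"
  using herm_fun_eq[of n U f d] by (simp add: eigen_dec_def o_def)

lemma eigen_dec_mult:
  assumes "eigen_dec n U d A" "eigen_dec n U e B"
  shows "eigen_dec n U (\<lambda>i. d i * e i) (A * B)"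
proof -
  have U: "unitary_mat n U" "A = U * real_diag n d * mat_adjoint U" "B = U * real_diag n e * mat_adjoint U"
    using assms by (auto simp: eigen_dec_def)
  then show ?thesis
    using unitary_carrier[OF U(1)]
    by (simp add: eigen_dec_def mult_assoc_square[of _ n] unitary_left_cancel[OF U(1)] flip: real_diag_mult)
qed

lemma eigen_dec_add:
  assumes "eigen_dec n U d A" "eigen_dec n U e B"
  shows "eigen_dec n U (\<lambda>i. d i + e i) (A + B)"
  using assms unitary_carrier[of n U]
  by (simp add: eigen_dec_def add_mult_distrib_mat[of _ n n _ _ n] mult_add_distrib_mat[of _ n n _ n]
      flip: real_diag_add)

lemma eigen_dec_smult:
  assumes "eigen_dec n U d A"
  shows "eigen_dec n U (\<lambda>i. c * d i) (of_real c \<cdot>\<^sub>m A)"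
  using assms unitary_carrier[of n U]
  by (simp add: eigen_dec_def mult_smult_distrib[of _ n n _ n] mult_smult_assoc_mat[of _ n n _ n]
      flip: real_diag_smult)

lemma eigen_dec_one: "unitary_mat n U \<Longrightarrow> eigen_dec n U (\<lambda>_. 1) (1\<^sub>m n)"
  using unitary_carrier[of n U] unitary_mat_right[of n U]
  by (simp add: eigen_dec_def real_diag_one)

lemma eigen_dec_real_diag: "eigen_dec n (1\<^sub>m n) d (real_diag n d)"
  by (simp add: eigen_dec_def unitary_one left_mult_one_mat[OF real_diag_carrier]
      right_mult_one_mat[OF real_diag_carrier])

lemma tr_eigen_dec:
  assumes "eigen_dec n U d A"
  shows "tr A = (\<Sum>i<n. d i)"
proof -
  have U: "unitary_mat n U" "U \<in> carrier_mat n n" using assms by (auto simp: eigen_dec_def unitary_carrier)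
  have "tr A = tr (mat_adjoint U * (U * real_diag n d))"
    using assms U tr_comm[of "U * real_diag n d" n "mat_adjoint U"] by (simp add: eigen_dec_def)
  then show ?thesis using U by (simp add: unitary_left_cancel tr_real_diag)
qed

lemma herm_carrier: "herm n A \<Longrightarrow> A \<in> carrier_mat n n"
  by (simp add: herm_def)

lemma herm_add: "herm n A \<Longrightarrow> herm n B \<Longrightarrow> herm n (A + B)"
  by (auto simp: herm_def mat_adjoint_add[of _ n n])

lemma herm_minus: "herm n A \<Longrightarrow> herm n B \<Longrightarrow> herm n (A - B)"
  by (auto simp: herm_def mat_adjoint_minus[of _ n n] minus_carrier_mat)

lemma herm_smult: "herm n A \<Longrightarrow> herm n (complex_of_real c \<cdot>\<^sub>m A)"
  by (auto simp: herm_def mat_adjoint_smult)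

lemma herm_one: "herm n (1\<^sub>m n)"
  by (simp add: herm_def)

lemma herm_herm_fun:
  assumes "herm n A"
  shows "herm n (herm_fun f A)"
  using spectral_theorem[OF assms] eigen_dec_herm_fun eigen_dec_herm by blast

lemma herm_fun_compose:
  assumes "herm n A"
  shows "herm_fun f (herm_fun g A) = herm_fun (\<lambda>t. f (g t)) A"
proof -
  obtain U d where A: "eigen_dec n U d A" using spectral_theorem[OF assms] by blast
  show ?thesis
    using eigen_dec_unique[OF eigen_dec_herm_fun[OF eigen_dec_herm_fun[OF A]] eigen_dec_herm_fun[OF A]] .
qed

lemma herm_fun_mult:
  assumes "herm n A"
  shows "herm_fun f A * herm_fun g A = herm_fun (\<lambda>t. f t * g t) A"
proof -
  obtain U d where A: "eigen_dec n U d A" using spectral_theorem[OF assms] by blast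
  show ?thesis
    using eigen_dec_unique[OF eigen_dec_mult[OF eigen_dec_herm_fun[OF A] eigen_dec_herm_fun[OF A]]
        eigen_dec_herm_fun[OF A, of "\<lambda>t. f t * g t"]] .
qed

lemma herm_fun_smult:
  assumes "herm n A"
  shows "herm_fun (\<lambda>t. c * f t) A = of_real c \<cdot>\<^sub>m herm_fun f A"
proof -
  obtain U d where A: "eigen_dec n U d A" using spectral_theorem[OF assms] by blast
  show ?thesis
    using eigen_dec_unique[OF eigen_dec_herm_fun[OF A] eigen_dec_smult[OF eigen_dec_herm_fun[OF A]]] .
qed

lemma herm_fun_smult_arg:
  assumes "herm n A"
  shows "herm_fun f (of_real c \<cdot>\<^sub>m A) = herm_fun (\<lambda>t. f (c * t)) A"
proof -
  obtain U d where A: "eigen_dec n U d A" using spectral_theorem[OF assms] by blast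
  show ?thesis
    using eigen_dec_unique[OF eigen_dec_herm_fun[OF eigen_dec_smult[OF A]] eigen_dec_herm_fun[OF A]] .
qed

lemma herm_fun_id:
  assumes "herm n A"
  shows "herm_fun (\<lambda>t. t) A = A"
proof -
  obtain U d where A: "eigen_dec n U d A" using spectral_theorem[OF assms] by blast
  show ?thesis using eigen_dec_unique[OF eigen_dec_herm_fun[OF A, of "\<lambda>t. t"] A] .
qed

lemma herm_fun_const_1:
  assumes "herm n A"
  shows "herm_fun (\<lambda>_. 1) A = 1\<^sub>m n"
proof -
  obtain U d where A: "eigen_dec n U d A" using spectral_theorem[OF assms] by blast
  show ?thesis
    using eigen_dec_unique[OF eigen_dec_herm_fun[OF A, of "\<lambda>_. 1"] eigen_dec_one[OF eigen_dec_unitary[OF A]]] .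
qed

lemma herm_fun_unitary_conj:
  assumes "herm n A" and W: "unitary_mat n W"
  shows "herm_fun f (W * A * mat_adjoint W) = W * herm_fun f A * mat_adjoint W"
proof -
  obtain U d where A: "eigen_dec n U d A" using spectral_theorem[OF assms(1)] by blast
  show ?thesis
    by (rule eigen_dec_unique[OF eigen_dec_herm_fun[OF eigen_dec_unitary_conj[OF W A]]
        eigen_dec_unitary_conj[OF W eigen_dec_herm_fun[OF A]]])
qed

lemma tr_unitary_conj:
  assumes A: "A \<in> carrier_mat n n" and W: "unitary_mat n W"
  shows "tr (W * A * mat_adjoint W) = tr A"
proof -
  have "tr (W * A * mat_adjoint W) = tr (mat_adjoint W * (W * A))"
    using A unitary_carrier[OF W] by (intro tr_comm[of _ n]) auto
  then show ?thesis using unitary_left_cancel[OF W A] by simp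
qed

lemma tr_herm_fun:
  "eigen_dec n U d A \<Longrightarrow> tr (herm_fun f A) = (\<Sum>i<n. f (d i))"
  by (rule tr_eigen_dec[OF eigen_dec_herm_fun])

section \<open>Quadratic forms\<close>

definition qf :: "complex mat \<Rightarrow> complex vec \<Rightarrow> real" where
  "qf A v = Re ((A *\<^sub>v v) \<bullet>c v)"

definition loewner_le :: "nat \<Rightarrow> complex mat \<Rightarrow> complex mat \<Rightarrow> bool" where
  "loewner_le n A B \<longleftrightarrow> (\<forall>v\<in>carrier_vec n. qf A v \<le> qf B v)"

lemma cscalar_prod_sum:
  "w \<in> carrier_vec n \<Longrightarrow> v \<in> carrier_vec n \<Longrightarrow> v \<bullet>c w = (\<Sum>i<n. v $ i * cnj (w $ i))"
  by (simp add: scalar_prod_def lessThan_atLeast0)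

lemma mult_mat_vec_index:
  "A \<in> carrier_mat n n \<Longrightarrow> v \<in> carrier_vec n \<Longrightarrow> i < n \<Longrightarrow> (A *\<^sub>v v) $ i = (\<Sum>j<n. A $$ (i, j) * v $ j)"
  by (simp add: scalar_prod_def lessThan_atLeast0)

lemma mult_mat_vec_closed:
  "A \<in> carrier_mat n n \<Longrightarrow> A *\<^sub>v v \<in> carrier_vec n"
  by (simp add: carrier_vecI)

lemma mat_adjoint_scalar_prod:
  fixes A :: "complex mat"
  assumes A: "A \<in> carrier_mat n n" and v: "v \<in> carrier_vec n" and w: "w \<in> carrier_vec n"
  shows "(mat_adjoint A *\<^sub>v v) \<bullet>c w = v \<bullet>c (A *\<^sub>v w)"
proof -
  have "(mat_adjoint A *\<^sub>v v) \<bullet>c w = (\<Sum>i<n. \<Sum>j<n. cnj (A $$ (j, i)) * v $ j * cnj (w $ i))"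
    using A v w mat_adjoint_carrier[OF A]
    by (simp add: cscalar_prod_sum[of _ n] mult_mat_vec_closed mult_mat_vec_index mat_adjoint_index
        sum_distrib_right del: index_mult_mat_vec)
  also have "\<dots> = (\<Sum>j<n. \<Sum>i<n. v $ j * (cnj (A $$ (j, i)) * cnj (w $ i)))"
    by (subst sum.swap) (simp add: ac_simps)
  also have "\<dots> = v \<bullet>c (A *\<^sub>v w)"
    using A v w
    by (simp add: cscalar_prod_sum[of _ n] mult_mat_vec_closed mult_mat_vec_index
        sum_distrib_left del: index_mult_mat_vec)
  finally show ?thesis .
qed

lemma qf_conj:
  assumes S: "S \<in> carrier_mat n n" and A: "A \<in> carrier_mat n n" and v: "v \<in> carrier_vec n"
  shows "qf (mat_adjoint S * A * S) v = qf A (S *\<^sub>v v)"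
proof -
  have "(mat_adjoint S * A * S) *\<^sub>v v = mat_adjoint S *\<^sub>v (A *\<^sub>v (S *\<^sub>v v))"
    using S A v
    by (simp add: mult_assoc_square[of _ n] assoc_mult_mat_vec[of _ n n _ n] mult_mat_vec_closed)
  then show ?thesis
    using mat_adjoint_scalar_prod[OF S _ v, of "A *\<^sub>v (S *\<^sub>v v)"] A S
    by (simp add: qf_def mult_mat_vec_closed)
qed

lemma qf_add:
  assumes "A \<in> carrier_mat n n" "B \<in> carrier_mat n n" "v \<in> carrier_vec n"
  shows "qf (A + B) v = qf A v + qf B v"
  using assms
  by (simp add: qf_def add_mult_distrib_mat_vec[of _ n n] add_scalar_prod_distrib[of _ n] mult_mat_vec_closed)

lemma qf_minus:
  assumes "A \<in> carrier_mat n n" "B \<in> carrier_mat n n" "v \<in> carrier_vec n"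
  shows "qf (A - B) v = qf A v - qf B v"
  using assms
  by (simp add: qf_def minus_mult_distrib_mat_vec[of _ n n] minus_scalar_prod_distrib[of _ n] mult_mat_vec_closed)

lemma qf_smult:
  assumes "A \<in> carrier_mat n n" "v \<in> carrier_vec n"
  shows "qf (of_real c \<cdot>\<^sub>m A) v = c * qf A v"
proof -
  have "(of_real c \<cdot>\<^sub>m A) *\<^sub>v v = of_real c \<cdot>\<^sub>v (A *\<^sub>v v)"
    using assms by (auto intro!: eq_vecI simp: scalar_prod_def sum_distrib_left ac_simps)
  then show ?thesis using assms by (simp add: qf_def mult_mat_vec_closed)
qed

lemma qf_real_diag:
  assumes "v \<in> carrier_vec n"
  shows "qf (real_diag n d) v = (\<Sum>i<n. d i * (cmod (v $ i))\<^sup>2)"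
proof -
  have "(real_diag n d *\<^sub>v v) $ i = of_real (d i) * v $ i" if "i < n" for i
  proof -
    have "(real_diag n d *\<^sub>v v) $ i = (\<Sum>j<n. real_diag n d $$ (i, j) * v $ j)"
      using assms that by (intro mult_mat_vec_index) auto
    also have "\<dots> = (\<Sum>j<n. if i = j then of_real (d j) * v $ j else 0)"
      using that by (intro sum.cong) (auto simp: real_diag_index)
    finally have "(real_diag n d *\<^sub>v v) $ i = (\<Sum>j<n. if i = j then of_real (d j) * v $ j else 0)" .
    then show ?thesis using that by simp
  qed
  then show ?thesis
    using assms
    by (simp add: qf_def cscalar_prod_sum[of _ n] mult_mat_vec_closed cmod_power2 power2_eq_square[of "Re _"]
        power2_eq_square[of "Im _"] algebra_simps del: index_mult_mat_vec)
qed

lemma qf_eigen_dec: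
  assumes A: "eigen_dec n U d A" and v: "v \<in> carrier_vec n"
  shows "qf A v = (\<Sum>i<n. d i * (cmod ((mat_adjoint U *\<^sub>v v) $ i))\<^sup>2)"
proof -
  have "U \<in> carrier_mat n n" "A = U * real_diag n d * mat_adjoint U"
    using A by (auto simp: eigen_dec_def unitary_carrier)
  then show ?thesis
    using qf_conj[of "mat_adjoint U" n "real_diag n d" v] v
      qf_real_diag[of "mat_adjoint U *\<^sub>v v" n d]
    by (simp add: mult_mat_vec_closed)
qed

lemma mat_mult_unit_vec_index:
  assumes "A \<in> carrier_mat n n" "i < n" "k < n"
  shows "(A *\<^sub>v unit_vec n i) $ k = (A $$ (k, i) :: complex)"
proof -
  have "(A *\<^sub>v unit_vec n i) $ k = (\<Sum>j<n. A $$ (k, j) * unit_vec n i $ j)"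
    using assms by (intro mult_mat_vec_index) auto
  also have "\<dots> = (\<Sum>j<n. if j = i then A $$ (k, j) else 0)"
    using assms by (intro sum.cong) auto
  finally have "(A *\<^sub>v unit_vec n i) $ k = (\<Sum>j<n. if j = i then A $$ (k, j) else 0)" .
  then show ?thesis using assms by simp
qed

lemma qf_unit_vec:
  assumes "A \<in> carrier_mat n n" "i < n"
  shows "qf A (unit_vec n i) = Re (A $$ (i, i))"
proof -
  have "(A *\<^sub>v unit_vec n i) \<bullet>c unit_vec n i
      = (\<Sum>k<n. (A *\<^sub>v unit_vec n i) $ k * cnj (unit_vec n i $ k))"
    using assms by (intro cscalar_prod_sum) (auto simp: mult_mat_vec_closed)
  also have "\<dots> = (\<Sum>k<n. if k = i then A $$ (k, i) else 0)"
    using assms by (intro sum.cong) (auto simp: mat_mult_unit_vec_index simp del: index_mult_mat_vec)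
  finally have "(A *\<^sub>v unit_vec n i) \<bullet>c unit_vec n i = (\<Sum>k<n. if k = i then A $$ (k, i) else 0)" .
  then show ?thesis using assms by (simp add: qf_def)
qed

lemma diagonal_entry_mono:
  assumes "loewner_le n A B" "A \<in> carrier_mat n n" "B \<in> carrier_mat n n" "U \<in> carrier_mat n n" "i < n"
  shows "Re ((mat_adjoint U * A * U) $$ (i, i)) \<le> Re ((mat_adjoint U * B * U) $$ (i, i))"
proof -
  have "Re ((mat_adjoint U * C * U) $$ (i, i)) = qf C (U *\<^sub>v unit_vec n i)" if "C \<in> carrier_mat n n" for C
    using qf_unit_vec[of "mat_adjoint U * C * U" n i] qf_conj[of U n C "unit_vec n i"] that assms by simp
  then show ?thesis using assms by (simp add: loewner_le_def mult_mat_vec_closed)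
qed

lemma loewner_le_conj:
  assumes "loewner_le n A B" "A \<in> carrier_mat n n" "B \<in> carrier_mat n n" "S \<in> carrier_mat n n"
  shows "loewner_le n (mat_adjoint S * A * S) (mat_adjoint S * B * S)"
  using assms by (simp add: loewner_le_def qf_conj mult_mat_vec_closed)

lemma loewner_le_eigen_dec:
  assumes "eigen_dec n U d A" "eigen_dec n U e B" "\<And>i. i < n \<Longrightarrow> d i \<le> e i"
  shows "loewner_le n A B"
  unfolding loewner_le_def
  using assms by (auto simp: qf_eigen_dec intro!: sum_mono mult_right_mono)

lemma unitary_vec_nonzero:
  assumes U: "unitary_mat n U" and v: "v \<in> carrier_vec n" and "v \<noteq> 0\<^sub>v n"
  shows "\<exists>i<n. (mat_adjoint U *\<^sub>v v) $ i \<noteq> 0"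
proof (rule ccontr)
  assume "\<not> ?thesis"
  then have "mat_adjoint U *\<^sub>v v = 0\<^sub>v n"
    using unitary_carrier[OF U] by (intro eq_vecI) auto
  then have "U *\<^sub>v (mat_adjoint U *\<^sub>v v) = 0\<^sub>v n"
    using unitary_carrier[OF U] by (auto intro!: eq_vecI)
  moreover have "U *\<^sub>v (mat_adjoint U *\<^sub>v v) = v"
    using unitary_carrier[OF U] unitary_mat_right[OF U] v
    by (simp flip: assoc_mult_mat_vec[of U n n "mat_adjoint U" n])
  ultimately show False using assms(3) by simp
qed

lemma pos_def_iff_eigenvalues:
  assumes A: "eigen_dec n U d A"
  shows "A \<in> pos_def_mats n \<longleftrightarrow> (\<forall>i<n. d i > 0)"
proof
  assume pd: "A \<in> pos_def_mats n"
  show "\<forall>i<n. d i > 0"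
  proof (intro allI impI)
    fix i assume i: "i < n"
    have U: "U \<in> carrier_mat n n" "unitary_mat n U" using A by (auto simp: eigen_dec_def unitary_carrier)
    have "qf A (U *\<^sub>v unit_vec n i) = Re (real_diag n d $$ (i, i))"
      using qf_conj[of U n A "unit_vec n i"] eigen_dec_diagonalize[OF A] eigen_dec_carrier[OF A] U(1) i
        qf_unit_vec[of "real_diag n d" n i] by simp
    then have di: "qf A (U *\<^sub>v unit_vec n i) = d i" using i by (simp add: real_diag_index)
    have "mat_adjoint U *\<^sub>v (U *\<^sub>v unit_vec n i) = unit_vec n i"
      using U(1) unitary_left[OF U(2)] by (simp flip: assoc_mult_mat_vec[of "mat_adjoint U" n n U n])
    moreover have "mat_adjoint U *\<^sub>v 0\<^sub>v n = 0\<^sub>v n" using U(1) by (intro eq_vecI) auto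
    moreover have "unit_vec n i \<noteq> (0\<^sub>v n :: complex vec)" using i by simp
    ultimately have "U *\<^sub>v unit_vec n i \<noteq> 0\<^sub>v n" by metis
    then show "d i > 0" using pd U(1) unfolding di[symmetric] pos_def_mats_def qf_def
      by (auto simp: mult_mat_vec_closed)
  qed
next
  assume d: "\<forall>i<n. d i > 0"
  have "qf A v > 0" if v: "v \<in> carrier_vec n" "v \<noteq> 0\<^sub>v n" for v
  proof -
    have "unitary_mat n U" using A by (simp add: eigen_dec_def)
    then obtain i where "i < n" "(mat_adjoint U *\<^sub>v v) $ i \<noteq> 0"
      using unitary_vec_nonzero v by blast
    then show ?thesis unfolding qf_eigen_dec[OF A v(1)]
      using d by (intro sum_pos2[of _ i]) (auto intro!: mult_nonneg_nonneg simp: less_imp_le)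
  qed
  then show "A \<in> pos_def_mats n"
    using eigen_dec_herm[OF A] unfolding pos_def_mats_def qf_def herm_def hermitian_mat_def by auto
qed

section \<open>Positive definite matrices as exponentials\<close>

text \<open>Every positive definite matrix is the exponential of a Hermitian one, so powers, logarithms
  and the Schatten norm are evaluated on the one-parameter family below.\<close>

definition exp_herm :: "real \<Rightarrow> complex mat \<Rightarrow> complex mat" where
  "exp_herm r X = herm_fun (\<lambda>t. exp (r * t)) X"

lemma eigen_dec_exp_herm: "eigen_dec n U d X \<Longrightarrow> eigen_dec n U (\<lambda>i. exp (r * d i)) (exp_herm r X)"
  unfolding exp_herm_def by (rule eigen_dec_herm_fun)

lemma exp_herm_herm: "herm n X \<Longrightarrow> herm n (exp_herm r X)"
  unfolding exp_herm_def by (rule herm_herm_fun)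

lemma exp_herm_carrier [simp]: "herm n X \<Longrightarrow> exp_herm r X \<in> carrier_mat n n"
  by (rule herm_carrier[OF exp_herm_herm])

lemma exp_herm_adjoint [simp]: "herm n X \<Longrightarrow> mat_adjoint (exp_herm r X) = exp_herm r X"
  using exp_herm_herm by (auto simp: herm_def)

lemma exp_herm_mult: "herm n X \<Longrightarrow> exp_herm r X * exp_herm s X = exp_herm (r + s) X"
  unfolding exp_herm_def by (simp add: herm_fun_mult distrib_right exp_add)

lemma exp_herm_0: "herm n X \<Longrightarrow> exp_herm 0 X = 1\<^sub>m n"
  unfolding exp_herm_def by (simp add: herm_fun_const_1)

lemma exp_herm_cancel:
  assumes "herm n X" "M \<in> carrier_mat n n"
  shows "exp_herm r X * (exp_herm (- r) X * M) = M" "exp_herm (- r) X * (exp_herm r X * M) = M"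
  using assms exp_herm_mult[OF assms(1), of r "- r"] exp_herm_mult[OF assms(1), of "- r" r]
  by (simp_all add: exp_herm_0 flip: mult_assoc_square[of _ n])

lemma exp_herm_pos_def:
  assumes "herm n X"
  shows "exp_herm r X \<in> pos_def_mats n"
proof -
  obtain U d where "eigen_dec n U d X" using spectral_theorem[OF assms] by blast
  from pos_def_iff_eigenvalues[OF eigen_dec_exp_herm[OF this, of r]] show ?thesis by simp
qed

lemma mat_powr_exp_herm: "herm n X \<Longrightarrow> mat_powr (exp_herm r X) s = exp_herm (s * r) X"
  unfolding exp_herm_def mat_powr_def
  by (subst herm_fun_compose, assumption) (simp add: exp_powr_real mult.commute mult.left_commute)

lemma mat_log_exp_herm: "herm n X \<Longrightarrow> mat_log (exp_herm r X) = of_real r \<cdot>\<^sub>m X"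
  unfolding exp_herm_def mat_log_def
  by (subst herm_fun_compose, assumption) (simp add: herm_fun_smult[of n X r "\<lambda>t. t"] herm_fun_id)

lemma exp_herm_smult: "herm n X \<Longrightarrow> exp_herm r (of_real c \<cdot>\<^sub>m X) = exp_herm (r * c) X"
  unfolding exp_herm_def by (subst herm_fun_smult_arg, assumption) (simp add: mult.assoc)

lemma pos_def_herm: "A \<in> pos_def_mats n \<Longrightarrow> herm n A"
  by (simp add: pos_def_mats_def herm_def hermitian_mat_def)

lemma mat_log_herm: "A \<in> pos_def_mats n \<Longrightarrow> herm n (mat_log A)"
  unfolding mat_log_def by (simp add: herm_herm_fun pos_def_herm)

lemma exp_herm_mat_log:
  assumes "A \<in> pos_def_mats n"
  shows "exp_herm 1 (mat_log A) = A"
proof -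
  obtain U d where U: "eigen_dec n U d A" using spectral_theorem[OF pos_def_herm[OF assms]] by blast
  have "eigen_dec n U (\<lambda>i. exp (1 * ln (d i))) (exp_herm 1 (mat_log A))"
    unfolding mat_log_def by (rule eigen_dec_exp_herm[OF eigen_dec_herm_fun[OF U]])
  then have "eigen_dec n U d (exp_herm 1 (mat_log A))"
    using pos_def_iff_eigenvalues[OF U] assms by (subst eigen_dec_cong[of n d]) auto
  then show ?thesis using eigen_dec_unique U by blast
qed

lemma pos_def_congruence:
  assumes A: "A \<in> pos_def_mats n" and S: "S \<in> carrier_mat n n" and R: "R \<in> carrier_mat n n" "R * S = 1\<^sub>m n"
  shows "mat_adjoint S * A * S \<in> pos_def_mats n"
proof -
  have Ac: "A \<in> carrier_mat n n" using A by (simp add: pos_def_mats_def)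
  have "qf (mat_adjoint S * A * S) v > 0" if v: "v \<in> carrier_vec n" "v \<noteq> 0\<^sub>v n" for v
  proof -
    have "R *\<^sub>v (S *\<^sub>v v) = v"
      using S R v by (simp flip: assoc_mult_mat_vec[of _ n n _ n])
    then have "S *\<^sub>v v \<noteq> 0\<^sub>v n" using v R by (auto intro!: eq_vecI)
    then show ?thesis unfolding qf_conj[OF S Ac v(1)]
      using A S v by (simp add: pos_def_mats_def qf_def mult_mat_vec_closed)
  qed
  then show ?thesis
    using herm_conj[OF pos_def_herm[OF A], of "mat_adjoint S"] S
    unfolding pos_def_mats_def herm_def hermitian_mat_def qf_def by auto
qed

lemma herm_conj_exp:
  assumes "herm n X" "B \<in> pos_def_mats n"
  shows "exp_herm r X * B * exp_herm r X \<in> pos_def_mats n"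
  using pos_def_congruence[OF assms(2), of "exp_herm r X" "exp_herm (- r) X"] assms(1)
  by (simp add: exp_herm_mult exp_herm_0)

section \<open>The Schatten norm of Hermitian matrices and the distance\<close>

definition pow_sum :: "real \<Rightarrow> complex mat \<Rightarrow> real" where
  "pow_sum p X = tr (herm_fun (\<lambda>t. \<bar>t\<bar> powr p) X)"

lemma pow_sum_eigen: "eigen_dec n U d X \<Longrightarrow> pow_sum p X = (\<Sum>i<n. \<bar>d i\<bar> powr p)"
  unfolding pow_sum_def by (rule tr_herm_fun)

lemma pow_sum_nonneg: "herm n X \<Longrightarrow> pow_sum p X \<ge> 0"
  using spectral_theorem[of n X] pow_sum_eigen[of n _ _ X p] by (auto simp: sum_nonneg)

lemma schatten_norm_herm:
  assumes "herm n X"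
  shows "schatten_norm p X = pow_sum p X powr (1 / p)"
proof -
  obtain U d where U: "eigen_dec n U d X" using spectral_theorem[OF assms] by blast
  have X: "mat_adjoint X = X" using assms by (simp add: herm_def)
  have "eigen_dec n U (\<lambda>i. ((d i * d i) powr (1/2)) powr p) (mat_powr (mat_abs X) p)"
    unfolding mat_powr_def mat_abs_def X
    by (intro eigen_dec_herm_fun eigen_dec_mult U)
  then have "tr (mat_powr (mat_abs X) p) = (\<Sum>i<n. ((d i * d i) powr (1/2)) powr p)"
    by (rule tr_eigen_dec)
  also have "\<dots> = pow_sum p X"
    unfolding pow_sum_eigen[OF U] by (simp add: powr_half_sqrt)
  finally show ?thesis unfolding schatten_norm_def tr_def by simp
qed

lemma pow_sum_smult:
  assumes "herm n X"
  shows "pow_sum p (of_real c \<cdot>\<^sub>m X) = \<bar>c\<bar> powr p * pow_sum p X"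
proof -
  obtain U d where U: "eigen_dec n U d X" using spectral_theorem[OF assms] by blast
  show ?thesis unfolding pow_sum_eigen[OF U] pow_sum_eigen[OF eigen_dec_smult[OF U]]
    by (simp add: abs_mult powr_mult sum_distrib_left)
qed

lemma schatten_norm_smult:
  assumes "herm n X" "p > 0"
  shows "schatten_norm p (of_real c \<cdot>\<^sub>m X) = \<bar>c\<bar> * schatten_norm p X"
  using assms pow_sum_nonneg[of n X p]
  by (simp add: schatten_norm_herm[OF assms(1)] schatten_norm_herm[OF herm_smult[OF assms(1)]] pow_sum_smult[OF assms(1)]
      powr_mult powr_powr)

lemma schatten_norm_unitary_conj:
  assumes "herm n X" "unitary_mat n W"
  shows "schatten_norm p (W * X * mat_adjoint W) = schatten_norm p X"
  using assms herm_conj[OF assms(1) unitary_carrier[OF assms(2)]]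
  by (simp add: schatten_norm_herm pow_sum_def herm_fun_unitary_conj tr_unitary_conj[of _ n] herm_carrier[OF herm_herm_fun])

lemma delta_exp_herm:
  "herm n X \<Longrightarrow> delta p (exp_herm 1 X) B
    = schatten_norm p (mat_log (exp_herm (-1/2) X * B * exp_herm (-1/2) X))"
  unfolding delta_def by (simp add: mat_powr_exp_herm)

text \<open>If \<open>A' = S A S\<^sup>*\<close> and \<open>B' = S B S\<^sup>*\<close>, the two middle matrices whose logarithms enter the distance
  are conjugate under \<open>A'\<^sup>-\<^sup>1\<^sup>/\<^sup>2 S A\<^sup>1\<^sup>/\<^sup>2\<close>, which is unitary.\<close>

lemma delta_congruence:
  assumes A: "A \<in> pos_def_mats n" and B: "B \<in> pos_def_mats n"
    and S: "S \<in> carrier_mat n n" and R: "R \<in> carrier_mat n n" "S * R = 1\<^sub>m n"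
  shows "delta p (S * A * mat_adjoint S) (S * B * mat_adjoint S) = delta p A B"
proof -
  define X where "X = mat_log A"
  have X: "herm n X" and AX: "A = exp_herm 1 X"
    using mat_log_herm[OF A] exp_herm_mat_log[OF A] by (auto simp: X_def)
  have "mat_adjoint R * mat_adjoint S = 1\<^sub>m n"
    using arg_cong[OF R(2), of mat_adjoint] S R(1) by (simp add: mat_adjoint_mult[of S n n R n])
  then have "S * A * mat_adjoint S \<in> pos_def_mats n"
    using pos_def_congruence[OF A, of "mat_adjoint S" "mat_adjoint R"] S R(1) by simp
  then obtain Y where Y: "herm n Y" and AY: "S * A * mat_adjoint S = exp_herm 1 Y"
    using mat_log_herm exp_herm_mat_log by metis
  have Bc: "B \<in> carrier_mat n n" using B by (simp add: pos_def_mats_def)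
  define W where "W = exp_herm (-1/2) Y * S * exp_herm (1/2) X"
  have Wc: "W \<in> carrier_mat n n" using S X Y by (simp add: W_def)
  have half: "exp_herm (1/2) X * (exp_herm (1/2) X * M) = A * M" if "M \<in> carrier_mat n n" for M
    using X that exp_herm_mult[OF X, of "1/2" "1/2"] by (simp add: AX flip: mult_assoc_square[of _ n])
  have "W * mat_adjoint W = exp_herm (-1/2) Y * (S * A * mat_adjoint S) * exp_herm (-1/2) Y"
    unfolding W_def using S X Y herm_carrier[OF pos_def_herm[OF A]]
    by (simp add: mat_adjoint_mult[of _ n n _ n] mult_assoc_square[of _ n] half)
  also have "\<dots> = 1\<^sub>m n"
    unfolding AY using Y by (simp add: exp_herm_mult exp_herm_0)
  finally have "mat_adjoint (mat_adjoint W) * mat_adjoint W = 1\<^sub>m n" by simp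
  then have W: "unitary_mat n W" using Wc unitary_adjoint[of n "mat_adjoint W"] by (simp add: unitary_mat_def)
  define G where "G = exp_herm (-1/2) X * B * exp_herm (-1/2) X"
  have G: "G \<in> pos_def_mats n" unfolding G_def by (rule herm_conj_exp[OF X B])
  have "W * G * mat_adjoint W = exp_herm (-1/2) Y * (S * B * mat_adjoint S) * exp_herm (-1/2) Y"
    unfolding W_def G_def using S X Y Bc exp_herm_cancel(1)[OF X, of _ "1/2"] exp_herm_cancel(2)[OF X, of _ "1/2"]
    by (simp add: mat_adjoint_mult[of _ n n _ n] mult_assoc_square[of _ n])
  then have "delta p (S * A * mat_adjoint S) (S * B * mat_adjoint S) = schatten_norm p (mat_log (W * G * mat_adjoint W))"
    unfolding AY by (simp add: delta_exp_herm[OF Y])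
  also have "\<dots> = schatten_norm p (mat_log G)"
    using pos_def_herm[OF G] mat_log_herm[OF G] W
    by (simp add: mat_log_def herm_fun_unitary_conj schatten_norm_unitary_conj)
  also have "\<dots> = delta p A B" unfolding G_def AX by (simp add: delta_exp_herm[OF X])
  finally show ?thesis .
qed

section \<open>The second-order gap of the power function\<close>

lemma powr_neg_tangent:
  fixes s x t :: real
  assumes "s > 0" "x > 0" "t \<ge> 0"
  shows "x powr (- t) \<ge> s powr (- t) - t * s powr (- t - 1) * (x - s)"
proof -
  have "1 - t * (x / s - 1) \<le> 1 + (- t * ln (x / s))"
    using ln_le_minus_one[of "x / s"] assms mult_left_mono[of "ln (x / s)" "x / s - 1" t] by simp
  also have "\<dots> \<le> exp (- t * ln (x / s))" by (rule exp_ge_add_one_self)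
  also have "\<dots> = (x / s) powr (- t)" using assms by (simp add: powr_def)
  finally have "s powr (- t) * (1 - t * (x / s - 1)) \<le> s powr (- t) * (x / s) powr (- t)"
    by (intro mult_left_mono) auto
  moreover have "s powr (- t) * (x / s) powr (- t) = x powr (- t)"
    using assms by (simp flip: powr_mult)
  moreover have "s powr (- t - 1) = s powr (- t) / s"
    using assms by (simp add: powr_diff)
  moreover have "s powr (- t) * (1 - t * (x / s - 1)) = s powr (- t) - t * (s powr (- t) / s) * (x - s)"
    using assms by (simp add: field_simps)
  ultimately show ?thesis by simp
qed

text \<open>Subtracting from \<open>x\<^sup>p\<close> the double primitive of the tangent of \<open>p (p - 1) x\<^sup>p\<^sup>-\<^sup>2\<close> at \<open>s\<close> leaves a
  convex function on the half line, because \<open>x\<^sup>p\<^sup>-\<^sup>2\<close> lies above its tangent; its derivative at \<open>0\<close> is \<open>0\<close>.\<close>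

lemma powr_minus_cubic_convex:
  fixes p s :: real
  assumes p: "1 < p" "p \<le> 2" and s: "s > 0"
  defines "R \<equiv> \<lambda>x. x powr p - p * (p - 1) * (s powr (p - 2) * x\<^sup>2 / 2
      - (2 - p) * s powr (p - 3) * (x ^ 3 / 6 - s * x\<^sup>2 / 2))"
    and "R' \<equiv> \<lambda>x. p * x powr (p - 1) - p * (p - 1) * (s powr (p - 2) * x
      - (2 - p) * s powr (p - 3) * (x\<^sup>2 / 2 - s * x))"
  shows "a \<ge> 0 \<Longrightarrow> b \<ge> 0 \<Longrightarrow> R b \<ge> R a + R' a * (b - a)" and "a \<ge> 0 \<Longrightarrow> R' a \<ge> 0"
proof -
  have contR: "continuous_on {x..y} R" and contR': "continuous_on {x..y} R'" if "x \<ge> 0" for x y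
    unfolding R_def R'_def using that p
    by (auto intro!: continuous_intros continuous_on_powr')
  have derR: "(R has_real_derivative R' x) (at x)" if "x > 0" for x
    unfolding R_def R'_def using that
    by (auto intro!: derivative_eq_intros simp: power2_eq_square power3_eq_cube field_simps)
  have derR': "(R' has_real_derivative p * (p - 1) * (x powr (p - 2) - s powr (p - 2)
      + (2 - p) * s powr (p - 3) * (x - s))) (at x)" if "x > 0" for x
    unfolding R'_def using that
    by (auto intro!: derivative_eq_intros simp: field_simps)
  have mono: "R' x \<le> R' y" if "0 \<le> x" "x \<le> y" for x y
  proof (cases "x = y")
    case False
    have "\<exists>l. (R' has_real_derivative l) (at z) \<and> 0 \<le> l" if z: "x < z" "z < y" for z
    proof -
      have z0: "z > 0" using z \<open>0 \<le> x\<close> by simp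
      have "x powr (p - 2) - s powr (p - 2) + (2 - p) * s powr (p - 3) * (x - s) \<ge> 0" if "x > 0" for x
        using powr_neg_tangent[OF s that, of "2 - p"] p by (simp add: algebra_simps)
      with derR'[OF z0] z0 p show ?thesis by (auto intro!: exI mult_nonneg_nonneg)
    qed
    then show ?thesis
      using DERIV_nonneg_imp_increasing_open[of x y R'] contR'[OF \<open>0 \<le> x\<close>] that False by auto
  qed simp
  show "R' a \<ge> 0" if "a \<ge> 0" using mono[of 0 a] that p unfolding R'_def by simp
  have mvt: "\<exists>z. x < z \<and> z < y \<and> R y - R x = (y - x) * R' z" if "0 \<le> x" "x < y" for x y
  proof -
    have "R differentiable (at z)" if "x < z" for z
      using derR[of z] that \<open>0 \<le> x\<close> by (auto simp: real_differentiable_def)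
    then have "\<exists>l z. x < z \<and> z < y \<and> (R has_real_derivative l) (at z) \<and> R y - R x = (y - x) * l"
      using that by (intro MVT contR) auto
    then show ?thesis using derR DERIV_unique that by (metis order.strict_trans1)
  qed
  show "R b \<ge> R a + R' a * (b - a)" if ab: "a \<ge> 0" "b \<ge> 0"
  proof (cases a b rule: linorder_cases)
    case less
    then obtain z where z: "a < z" "R b - R a = (b - a) * R' z" using mvt[of a b] ab by auto
    have "R' a * (b - a) \<le> R' z * (b - a)" using mono[of a z] z less ab by (intro mult_right_mono) auto
    then show ?thesis using z by (simp add: algebra_simps)
  next
    case greater
    then obtain z where z: "b < z" "z < a" "R a - R b = (a - b) * R' z" using mvt[of b a] ab by auto
    have "R' z * (a - b) \<le> R' a * (a - b)" using mono[of z a] z greater ab by (intro mult_right_mono) auto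
    then show ?thesis using z by (simp add: algebra_simps)
  qed simp
qed

lemma abs_powr_gap_aux:
  fixes p a b :: real
  assumes p: "1 < p" "p \<le> 2" and a: "a \<ge> 0"
  shows "\<bar>b\<bar> powr p - a powr p - p * a powr (p - 1) * (b - a)
    \<ge> p * (p - 1) / 2 * (b - a)\<^sup>2 * ((2 * a + \<bar>b\<bar>) / 3) powr (p - 2)"
proof (cases "a = 0 \<and> b = 0")
  case False
  define s where "s = (2 * a + \<bar>b\<bar>) / 3"
  have s: "s > 0" using False a by (auto simp: s_def)
  define L where "L = s powr (p - 2)"
  define M where "M = (2 - p) * s powr (p - 3)"
  define c where "c = p * (p - 1)"
  have M: "M \<ge> 0" and c: "c \<ge> 0" using p by (auto simp: M_def c_def)
  note conv = powr_minus_cubic_convex[OF p s, folded L_def M_def c_def]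
  have apow: "a powr (p - 1) * a = a powr p"
    using a p by (cases "a = 0") (auto simp: powr_diff)
  show ?thesis
  proof (cases "b \<ge> 0")
    case True
    \<comment> \<open>For equal signs the cubic correction vanishes; this fixes the weights \<open>2/3\<close> and \<open>1/3\<close> in \<open>s\<close>.\<close>
    have sq: "b\<^sup>2 - a\<^sup>2 - 2 * a * (b - a) = (b - a)\<^sup>2"
      by (simp add: power2_eq_square algebra_simps)
    have cube: "(b ^ 3 - a ^ 3 - 3 * a\<^sup>2 * (b - a)) / 6 - s * (b - a)\<^sup>2 / 2 = 0"
      using True by (simp add: s_def power2_eq_square power3_eq_cube field_simps)
    have "c * (L * (b\<^sup>2 - a\<^sup>2 - 2 * a * (b - a)) / 2
        - M * ((b ^ 3 - a ^ 3 - 3 * a\<^sup>2 * (b - a)) / 6 - s * (b\<^sup>2 - a\<^sup>2 - 2 * a * (b - a)) / 2))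
      \<le> b powr p - a powr p - p * a powr (p - 1) * (b - a)"
      using conv(1)[OF a True] by (simp add: algebra_simps diff_divide_distrib add_divide_distrib)
    then have "c * (L * (b - a)\<^sup>2 / 2) \<le> b powr p - a powr p - p * a powr (p - 1) * (b - a)"
      unfolding sq cube by simp
    then show ?thesis
      unfolding s_def[symmetric] L_def[symmetric] c_def[symmetric] using True
      by (simp add: mult.commute mult.left_commute)
  next
    case False
    define e where "e = - b"
    have e: "e > 0" using False by (simp add: e_def)
    \<comment> \<open>For opposite signs the tangent inequalities are chained at \<open>0\<close>, and the cubic correction only helps.\<close>
    have 1: "e powr p \<ge> c * (L * e\<^sup>2 / 2 - M * (e ^ 3 / 6 - s * e\<^sup>2 / 2))"
      using conv(1)[of 0 e] e p by simp
    have 2: "- (a powr p) + p * a powr p \<ge> c * (L * a\<^sup>2 / 2 - M * (a ^ 3 / 3 - s * a\<^sup>2 / 2))"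
    proof -
      have "p * (a powr (p - 1) * a) \<ge> a powr p + c * (L * a\<^sup>2 / 2 - M * (a ^ 3 / 3 - s * a\<^sup>2 / 2))"
        using conv(1)[of a 0] a p
        by (simp add: algebra_simps power2_eq_square power3_eq_cube)
      then show ?thesis unfolding apow by simp
    qed
    have "p * a powr (p - 1) \<ge> c * (L * a - M * (a\<^sup>2 / 2 - s * a))"
      using conv(2)[OF a] by simp
    then have 3: "p * a powr (p - 1) * e \<ge> c * (L * a - M * (a\<^sup>2 / 2 - s * a)) * e"
      using e by (intro mult_right_mono) auto
    have "e ^ 3 / 6 + a ^ 3 / 3 + a\<^sup>2 * e / 2 - s * (a + e)\<^sup>2 / 2 = - (2 * a\<^sup>2 * e + 4 * a * e\<^sup>2) / 6"
      using e by (simp add: s_def e_def power2_eq_square power3_eq_cube field_simps)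
    also have "\<dots> \<le> 0"
    proof -
      have "0 \<le> a\<^sup>2 * e" "0 \<le> a * e\<^sup>2" using a e by (auto intro!: mult_nonneg_nonneg)
      then show ?thesis by argo
    qed
    finally have le0: "c * (M * (e ^ 3 / 6 + a ^ 3 / 3 + a\<^sup>2 * e / 2 - s * (a + e)\<^sup>2 / 2)) \<le> 0"
      using c M by (intro mult_nonneg_nonpos) auto
    have regroup: "c * (L * x / 2 - M * (u / 6 - s * x / 2)) + c * (L * y / 2 - M * (v / 3 - s * y / 2))
        + c * (L * a - M * (y / 2 - s * a)) * e
      = c * (L * (x + y + 2 * a * e) / 2) - c * (M * (u / 6 + v / 3 + y * e / 2 - s * (x + y + 2 * a * e) / 2))"
      for x y u v :: real
      by (simp add: algebra_simps add_divide_distrib diff_divide_distrib)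
    have sq: "e\<^sup>2 + a\<^sup>2 + 2 * a * e = (a + e)\<^sup>2" by (simp add: power2_eq_square algebra_simps)
    have "c * (L * (a + e)\<^sup>2 / 2) \<le> c * (L * e\<^sup>2 / 2 - M * (e ^ 3 / 6 - s * e\<^sup>2 / 2))
        + c * (L * a\<^sup>2 / 2 - M * (a ^ 3 / 3 - s * a\<^sup>2 / 2)) + c * (L * a - M * (a\<^sup>2 / 2 - s * a)) * e"
      using le0 unfolding regroup sq by linarith
    also have "\<dots> \<le> e powr p - a powr p + p * a powr p + p * a powr (p - 1) * e"
      using 1 2 3 by simp
    also have "\<dots> = \<bar>b\<bar> powr p - a powr p - p * a powr (p - 1) * (b - a)"
      using False by (simp add: e_def algebra_simps flip: apow)
    finally have "c * (L * (a + e)\<^sup>2 / 2) \<le> \<bar>b\<bar> powr p - a powr p - p * a powr (p - 1) * (b - a)" .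
    moreover have "(a + e)\<^sup>2 = (b - a)\<^sup>2" by (simp add: e_def power2_eq_square algebra_simps)
    ultimately have "c * (L * (b - a)\<^sup>2 / 2) \<le> \<bar>b\<bar> powr p - a powr p - p * a powr (p - 1) * (b - a)"
      by simp
    then show ?thesis
      unfolding s_def[symmetric] L_def[symmetric] c_def[symmetric]
      by (simp add: mult.commute mult.left_commute)
  qed
qed (use p in simp)

definition abs_powr_deriv :: "real \<Rightarrow> real \<Rightarrow> real" where
  "abs_powr_deriv p a = p * (sgn a * \<bar>a\<bar> powr (p - 1))"

text \<open>A quantitative tangent inequality for \<open>\<bar>x\<bar>\<^sup>p\<close>. Its error term is the square of the increment,
  weighted by a power of a linear function of \<open>\<bar>a\<bar>\<close> and \<open>\<bar>b\<bar>\<close>; linearity is what survives the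
  passage to matrices that do not commute.\<close>

lemma abs_powr_gap:
  fixes p a b :: real
  assumes p: "1 < p" "p \<le> 2"
  shows "\<bar>b\<bar> powr p - \<bar>a\<bar> powr p - abs_powr_deriv p a * (b - a)
    \<ge> p * (p - 1) / 2 * (b - a)\<^sup>2 * ((2 * \<bar>a\<bar> + \<bar>b\<bar>) / 3) powr (p - 2)"
proof (cases "a \<ge> 0")
  case True
  then show ?thesis using abs_powr_gap_aux[OF p True, of b] unfolding abs_powr_deriv_def
    by (cases "a = 0") auto
next
  case False
  then show ?thesis using abs_powr_gap_aux[OF p, of "- a" "- b"] unfolding abs_powr_deriv_def
    by (simp add: algebra_simps power2_eq_square)
qed

lemma abs_powr_tangent_strict:
  fixes p a b :: real
  assumes p: "1 < p" "p \<le> 2" and "a \<noteq> b"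
  shows "\<bar>b\<bar> powr p > \<bar>a\<bar> powr p + abs_powr_deriv p a * (b - a)"
proof -
  have "(2 * \<bar>a\<bar> + \<bar>b\<bar>) / 3 > 0" using assms by auto
  then have "p * (p - 1) / 2 * (b - a)\<^sup>2 * ((2 * \<bar>a\<bar> + \<bar>b\<bar>) / 3) powr (p - 2) > 0"
    using assms by auto
  then show ?thesis using abs_powr_gap[OF p, where a = a and b = b] by linarith
qed

section \<open>Majorization\<close>

lemma decreasing_rearrangement:
  fixes d :: "nat \<Rightarrow> real"
  obtains x where "\<And>i j. i \<le> j \<Longrightarrow> j < n \<Longrightarrow> x j \<le> x i"
    and "\<And>f :: real \<Rightarrow> real. (\<Sum>i<n. f (d i)) = (\<Sum>i<n. f (x i))"
proof -
  define xs where "xs = sort (map d [0..<n])"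
  have len: "length xs = n" by (simp add: xs_def)
  define x where "x i = rev xs ! i" for i
  have "x j \<le> x i" if "i \<le> j" "j < n" for i j
    using that len sorted_nth_mono[of xs "n - Suc j" "n - Suc i"]
    by (simp add: x_def rev_nth xs_def)
  moreover have "(\<Sum>i<n. f (d i)) = (\<Sum>i<n. f (x i))" for f :: "real \<Rightarrow> real"
  proof -
    have "(\<Sum>i<n. f (d i)) = sum_mset (image_mset f (mset (map d [0..<n])))"
      by (simp add: sum_unfold_sum_mset lessThan_atLeast0 image_mset.compositionality o_def)
    also have "mset (map d [0..<n]) = mset (rev xs)" by (simp add: xs_def)
    also have "sum_mset (image_mset f (mset (rev xs))) = sum_list (map f (rev xs))"
      by (simp only: sum_mset_sum_list flip: mset_map)
    also have "\<dots> = (\<Sum>i<n. f (x i))"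
      by (simp add: sum_list_sum_nth len x_def lessThan_atLeast0 del: rev_map)
    finally show ?thesis .
  qed
  ultimately show ?thesis using that by blast
qed

lemma abel_summation_nonneg:
  fixes k z :: "nat \<Rightarrow> real"
  assumes "\<And>i. Suc i < n \<Longrightarrow> k (Suc i) \<le> k i" and "\<And>m. m \<le> n \<Longrightarrow> (\<Sum>i<m. z i) \<ge> 0"
    and "(\<Sum>i<n. z i) = 0"
  shows "(\<Sum>i<n. k i * z i) \<ge> 0"
proof -
  have "(\<Sum>i<Suc m. k i * z i) \<ge> k m * (\<Sum>i<Suc m. z i)" if "m < n" for m
    using that
  proof (induction m)
    case (Suc m)
    have "k (Suc m) * (\<Sum>i<Suc m. z i) \<le> k m * (\<Sum>i<Suc m. z i)"
      using assms(1)[of m] assms(2)[of "Suc m"] Suc.prems by (intro mult_right_mono) auto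
    then show ?case using Suc by (simp add: distrib_left)
  qed simp
  from this[of "n - 1"] show ?thesis using assms(3) by (cases n) auto
qed

text \<open>The hinge functions \<open>max 0 (t - c)\<close> decide the comparison of \<open>\<Sum>f(d\<^sub>i)\<close> and \<open>\<Sum>f(h\<^sub>i)\<close> for every
  convex \<open>f\<close>: with \<open>c\<close> the \<open>m\<close>-th largest of the \<open>h\<^sub>i\<close> they bound the sum of the \<open>m\<close> largest \<open>d\<^sub>i\<close>, and
  summation by parts turns these bounds into the sum of the tangent inequalities of \<open>f\<close>.\<close>

lemma hinge_majorization:
  fixes f g :: "real \<Rightarrow> real" and d h :: "nat \<Rightarrow> real"
  assumes tangent: "\<And>x y. x \<noteq> y \<Longrightarrow> f y > f x + g x * (y - x)"
    and hinge: "\<And>c. (\<Sum>i<n. max 0 (d i - c)) \<le> (\<Sum>i<n. max 0 (h i - c))"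
    and total: "(\<Sum>i<n. d i) = (\<Sum>i<n. h i)"
  shows "(\<Sum>i<n. f (d i)) \<le> (\<Sum>i<n. f (h i))"
    and "(\<Sum>i<n. f (d i)) = (\<Sum>i<n. f (h i)) \<Longrightarrow> (\<Sum>i<n. F (d i)) = (\<Sum>i<n. F (h i) :: real)"
proof -
  obtain x where x: "\<And>i j. i \<le> j \<Longrightarrow> j < n \<Longrightarrow> x j \<le> x i"
    "\<And>f :: real \<Rightarrow> real. (\<Sum>i<n. f (d i)) = (\<Sum>i<n. f (x i))"
    using decreasing_rearrangement[of n d] by metis
  obtain y where y: "\<And>i j. i \<le> j \<Longrightarrow> j < n \<Longrightarrow> y j \<le> y i"
    "\<And>f :: real \<Rightarrow> real. (\<Sum>i<n. f (h i)) = (\<Sum>i<n. f (y i))"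
    using decreasing_rearrangement[of n h] by metis
  have mono: "g u \<le> g v" if "u \<le> v" for u v
  proof (cases "u = v")
    case False
    have "(g v - g u) * (v - u) > 0"
      using tangent[of u v] tangent[of v u] False by (simp add: algebra_simps)
    then show ?thesis using that False by (auto simp: zero_less_mult_iff)
  qed simp
  have partial: "(\<Sum>i<m. y i - x i) \<ge> 0" if "m \<le> n" for m
  proof (cases m)
    case (Suc k)
    \<comment> \<open>At this level the hinge sum of \<open>y\<close> consists of its \<open>m\<close> largest entries.\<close>
    define c where "c = y k"
    have "(\<Sum>i<m. x i - c) \<le> (\<Sum>i<m. max 0 (x i - c))" by (intro sum_mono) auto
    also have "\<dots> \<le> (\<Sum>i<n. max 0 (x i - c))" using that by (intro sum_mono2) auto
    also have "\<dots> \<le> (\<Sum>i<n. max 0 (y i - c))"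
      using hinge[of c] x(2)[of "\<lambda>t. max 0 (t - c)"] y(2)[of "\<lambda>t. max 0 (t - c)"] by simp
    also have "\<dots> = (\<Sum>i<m. max 0 (y i - c))"
      using that Suc y(1)[of k] by (intro sum.mono_neutral_right) (auto simp: c_def)
    also have "\<dots> = (\<Sum>i<m. y i - c)"
      using that Suc y(1) by (intro sum.cong) (auto simp: c_def max_def)
    finally show ?thesis by (simp add: sum_subtractf)
  qed simp
  have "(\<Sum>i<n. y i - x i) = 0"
    using total x(2)[of "\<lambda>t. t"] y(2)[of "\<lambda>t. t"] by (simp add: sum_subtractf)
  then have abel: "(\<Sum>i<n. g (x i) * (y i - x i)) \<ge> 0"
    using partial by (intro abel_summation_nonneg) (auto intro!: mono x(1))
  have gap: "f (y i) - f (x i) - g (x i) * (y i - x i) \<ge> 0" for i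
    using tangent[of "x i" "y i"] by (cases "x i = y i") auto
  have sum_gap: "(\<Sum>i<n. f (y i) - f (x i) - g (x i) * (y i - x i))
      = (\<Sum>i<n. f (h i)) - (\<Sum>i<n. f (d i)) - (\<Sum>i<n. g (x i) * (y i - x i))"
    unfolding x(2) y(2) by (simp add: sum_subtractf)
  have gap_sum: "(\<Sum>i<n. f (y i) - f (x i) - g (x i) * (y i - x i)) \<ge> 0"
    by (intro sum_nonneg gap)
  show "(\<Sum>i<n. f (d i)) \<le> (\<Sum>i<n. f (h i))"
    using sum_gap abel gap_sum by linarith
  show "(\<Sum>i<n. F (d i)) = (\<Sum>i<n. F (h i))" if "(\<Sum>i<n. f (d i)) = (\<Sum>i<n. f (h i))"
  proof -
    have "(\<Sum>i<n. f (y i) - f (x i) - g (x i) * (y i - x i)) = 0"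
      using sum_gap abel gap_sum that by linarith
    then have zero: "\<forall>i\<in>{..<n}. f (y i) - f (x i) - g (x i) * (y i - x i) = 0"
      by (subst (asm) sum_nonneg_eq_0_iff) (simp_all only: gap finite_lessThan)
    have "x i = y i" if "i < n" for i
    proof (rule ccontr)
      assume "x i \<noteq> y i"
      have "f (y i) - f (x i) - g (x i) * (y i - x i) = 0" using zero that by blast
      then show False using tangent[OF \<open>x i \<noteq> y i\<close>] by linarith
    qed
    then show ?thesis unfolding x(2) y(2) by (intro sum.cong) auto
  qed
qed

section \<open>Operator monotonicity of the square root and of the logarithm\<close>

lemma unitary_conj_mult:
  assumes "unitary_mat n U" "A \<in> carrier_mat n n" "B \<in> carrier_mat n n"
  shows "(mat_adjoint U * A * U) * (mat_adjoint U * B * U) = mat_adjoint U * (A * B) * U"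
  using assms unitary_carrier[OF assms(1)]
  by (simp add: mult_assoc_square[of _ n] unitary_left_cancel[OF assms(1)])

lemma unitary_conj_add:
  assumes "U \<in> carrier_mat n n" "A \<in> carrier_mat n n" "B \<in> carrier_mat n n"
  shows "mat_adjoint U * (A + B) * U = mat_adjoint U * A * U + mat_adjoint U * B * U"
  using assms
  by (simp add: mult_add_distrib_mat[of _ n n _ n] add_mult_distrib_mat[of _ n n _ _ n])

lemma loewner_leI_eigenvalues:
  assumes A: "A \<in> carrier_mat n n" and B: "B \<in> carrier_mat n n" and W: "eigen_dec n U w (B - A)"
    and w: "\<And>i. i < n \<Longrightarrow> w i \<ge> 0"
  shows "loewner_le n A B"
  unfolding loewner_le_def
proof
  fix v :: "complex vec" assume v: "v \<in> carrier_vec n"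
  have "qf (B - A) v \<ge> 0"
    unfolding qf_eigen_dec[OF W v] using w by (intro sum_nonneg mult_nonneg_nonneg) auto
  then show "qf A v \<le> qf B v" using qf_minus[OF B A v] by simp
qed

lemma pos_def_qf:
  "A \<in> pos_def_mats n \<Longrightarrow> v \<in> carrier_vec n \<Longrightarrow> v \<noteq> 0\<^sub>v n \<Longrightarrow> qf A v > 0"
  by (simp add: pos_def_mats_def qf_def)

lemma pos_def_diagonal_pos:
  assumes A: "A \<in> pos_def_mats n" and U: "unitary_mat n U" and i: "i < n"
  shows "Re ((mat_adjoint U * A * U) $$ (i, i)) > 0"
proof -
  have "mat_adjoint U * A * U \<in> pos_def_mats n"
    using pos_def_congruence[OF A unitary_carrier[OF U], of "mat_adjoint U"] U unitary_carrier[OF U]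
    by (simp add: unitary_left)
  moreover have "unit_vec n i \<noteq> (0\<^sub>v n :: complex vec)" using i by simp
  ultimately have pos: "qf (mat_adjoint U * A * U) (unit_vec n i) > 0" by (intro pos_def_qf[of _ n]) auto
  have "mat_adjoint U * A * U \<in> carrier_mat n n" using A unitary_carrier[OF U] by (simp add: pos_def_mats_def)
  from pos[unfolded qf_unit_vec[OF this i]] show ?thesis .
qed

text \<open>In an eigenbasis of \<open>W = Q - P\<close> the \<open>i\<close>-th diagonal entry of \<open>Q\<^sup>2 - P\<^sup>2\<close> is \<open>w\<^sub>i\<close> times the sum of
  the diagonal entries of \<open>P\<close> and \<open>Q\<close>, which are positive.\<close>

lemma loewner_le_sqrt:
  assumes P: "P \<in> pos_def_mats n" and Q: "Q \<in> pos_def_mats n" and le: "loewner_le n (P * P) (Q * Q)"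
  shows "loewner_le n P Q"
proof -
  have Pc: "P \<in> carrier_mat n n" and Qc: "Q \<in> carrier_mat n n" using P Q by (auto simp: pos_def_mats_def)
  obtain U w where W: "eigen_dec n U w (Q - P)"
    using spectral_theorem[OF herm_minus[OF pos_def_herm[OF Q] pos_def_herm[OF P]]] by blast
  have U: "unitary_mat n U" and Uc: "U \<in> carrier_mat n n" using W by (auto simp: eigen_dec_def unitary_carrier)
  define P' where "P' = mat_adjoint U * P * U"
  define Q' where "Q' = mat_adjoint U * Q * U"
  have P'c: "P' \<in> carrier_mat n n" and Q'c: "Q' \<in> carrier_mat n n" using Pc Qc Uc by (auto simp: P'_def Q'_def)
  have QPW: "Q = P + (Q - P)" using Pc Qc by (intro eq_matI) auto
  have Q': "Q' = P' + real_diag n w"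
    using unitary_conj_add[OF Uc Pc, of "Q - P"] Pc Qc eigen_dec_diagonalize[OF W]
    unfolding Q'_def P'_def by (simp add: minus_carrier_mat flip: QPW)
  have "w i \<ge> 0" if i: "i < n" for i
  proof -
    have "Q' * Q' = P' * P' + real_diag n w * P' + Q' * real_diag n w"
    proof -
      have "Q' * Q' = Q' * P' + Q' * real_diag n w"
        by (subst (2) Q') (use P'c Q'c in \<open>simp add: mult_add_distrib_mat[of _ n n _ n]\<close>)
      also have "Q' * P' = P' * P' + real_diag n w * P'"
        by (subst Q') (use P'c Q'c in \<open>simp add: add_mult_distrib_mat[of _ n n _ _ n]\<close>)
      finally show ?thesis .
    qed
    then have "(Q' * Q') $$ (i, i) = (P' * P') $$ (i, i) + of_real (w i) * P' $$ (i, i) + Q' $$ (i, i) * of_real (w i)"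
      using P'c Q'c i real_diag_mult_index[of P' n i i w] real_diag_mult_index[of Q' n i i w]
      by (simp del: index_mult_mat(1))
    moreover have "Re ((P' * P') $$ (i, i)) \<le> Re ((Q' * Q') $$ (i, i))"
      using diagonal_entry_mono[OF le _ _ Uc i] Pc Qc
      unfolding P'_def Q'_def unitary_conj_mult[OF U Pc Pc] unitary_conj_mult[OF U Qc Qc] by simp
    ultimately have "w i * (Re (P' $$ (i, i)) + Re (Q' $$ (i, i))) \<ge> 0"
      by (simp add: algebra_simps)
    moreover have "Re (P' $$ (i, i)) > 0" "Re (Q' $$ (i, i)) > 0"
      using pos_def_diagonal_pos[OF P U i] pos_def_diagonal_pos[OF Q U i] by (auto simp: P'_def Q'_def)
    ultimately show "w i \<ge> 0" by (simp add: zero_le_mult_iff)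
  qed
  then show ?thesis by (rule loewner_leI_eigenvalues[OF Pc Qc W])
qed

text \<open>Taking square roots repeatedly, \<open>exp X \<le> exp Y\<close> gives \<open>exp (r X) \<le> exp (r Y)\<close> for
  \<open>r = 2\<^sup>-\<^sup>k\<close>, and the derivative of \<open>exp (r X)\<close> at \<open>r = 0\<close> is \<open>X\<close>.\<close>

lemma loewner_le_log:
  assumes X: "herm n X" and Y: "herm n Y" and le: "loewner_le n (exp_herm 1 X) (exp_herm 1 Y)"
  shows "loewner_le n X Y"
  unfolding loewner_le_def
proof
  fix v :: "complex vec" assume v: "v \<in> carrier_vec n"
  have roots: "loewner_le n (exp_herm ((1/2) ^ k) X) (exp_herm ((1/2) ^ k) Y)" for k :: nat
  proof (induction k)
    case (Suc k)
    have "(1/2) ^ Suc k + (1/2) ^ Suc k = (1/2 :: real) ^ k" by simp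
    then have sq: "exp_herm ((1/2) ^ Suc k) Z * exp_herm ((1/2) ^ Suc k) Z = exp_herm ((1/2) ^ k) Z" if "herm n Z" for Z
      by (simp only: exp_herm_mult[OF that])
    show ?case
    proof (rule loewner_le_sqrt[OF exp_herm_pos_def[OF X] exp_herm_pos_def[OF Y]])
      show "loewner_le n (exp_herm ((1/2) ^ Suc k) X * exp_herm ((1/2) ^ Suc k) X)
          (exp_herm ((1/2) ^ Suc k) Y * exp_herm ((1/2) ^ Suc k) Y)"
        unfolding sq[OF X] sq[OF Y] by (rule Suc)
    qed
  qed (use le in simp)
  obtain U x where U: "eigen_dec n U x X" using spectral_theorem[OF X] by blast
  obtain V y where V: "eigen_dec n V y Y" using spectral_theorem[OF Y] by blast
  define f where "f h = qf (exp_herm h Y) v - qf (exp_herm h X) v" for h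
  have f: "f = (\<lambda>h. (\<Sum>i<n. exp (h * y i) * (cmod ((mat_adjoint V *\<^sub>v v) $ i))\<^sup>2)
      - (\<Sum>i<n. exp (h * x i) * (cmod ((mat_adjoint U *\<^sub>v v) $ i))\<^sup>2))"
    unfolding f_def qf_eigen_dec[OF eigen_dec_exp_herm[OF U] v] qf_eigen_dec[OF eigen_dec_exp_herm[OF V] v] ..
  have der: "(f has_real_derivative (qf Y v - qf X v)) (at 0)"
    unfolding f qf_eigen_dec[OF U v] qf_eigen_dec[OF V v]
    by (auto intro!: derivative_eq_intros)
  have f0: "f 0 = 0" unfolding f_def using X Y by (simp add: exp_herm_0)
  show "qf X v \<le> qf Y v"
  proof (rule ccontr)
    assume "\<not> qf X v \<le> qf Y v"
    then obtain d where d: "d > 0" "\<And>h. 0 < h \<Longrightarrow> h < d \<Longrightarrow> f (0 + h) < f 0"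
      using DERIV_neg_dec_right[OF der] by auto
    obtain k :: nat where "(1/2 :: real) ^ k < d" using real_arch_pow_inv[OF d(1), of "1/2"] by auto
    then have "f ((1/2) ^ k) < 0" using d(2)[of "(1/2) ^ k"] f0 by simp
    then show False using bspec[OF roots[of k, unfolded loewner_le_def] v] by (simp add: f_def)
  qed
qed

section \<open>The exponential metric increasing property\<close>

lemma det_eigen_dec:
  assumes "eigen_dec n U d A"
  shows "Determinant.det A = (\<Prod>i<n. of_real (d i))"
proof -
  have U: "U \<in> carrier_mat n n" "unitary_mat n U" and A: "A = U * real_diag n d * mat_adjoint U"
    using assms by (auto simp: eigen_dec_def unitary_carrier)
  have diag: "Determinant.det (real_diag n d) = (\<Prod>i<n. of_real (d i))"
  proof -
    have "upper_triangular (real_diag n d)" by (auto simp: real_diag_def mat_diag_def)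
    from det_upper_triangular[OF this real_diag_carrier]
    show ?thesis
      by (simp add: prod_list_diag_prod real_diag_index lessThan_atLeast0 carrier_matD[OF real_diag_carrier])
  qed
  have "Determinant.det U * Determinant.det (mat_adjoint U) = 1"
    using U det_mult[of U n "mat_adjoint U"] unitary_mat_right[OF U(2)] by simp
  then show ?thesis unfolding A
    using U diag by (simp add: det_mult[of _ n] ac_simps)
qed

lemma det_exp_herm:
  assumes "herm n X"
  shows "Determinant.det (exp_herm r X) = of_real (exp (r * tr X))"
proof -
  obtain U d where U: "eigen_dec n U d X" using spectral_theorem[OF assms] by blast
  show ?thesis
    unfolding det_eigen_dec[OF eigen_dec_exp_herm[OF U]] tr_eigen_dec[OF U]
    by (simp add: exp_sum sum_distrib_left)
qed

text \<open>Logarithms of products are not sums, but their traces are, because the determinant is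
  multiplicative.\<close>

lemma tr_log_product:
  assumes X: "herm n X" and Y: "herm n Y" and Z: "herm n Z"
    and eq: "exp_herm 1 Y = exp_herm (1/2) X * exp_herm 1 Z * exp_herm (1/2) X"
  shows "tr Y = tr X + tr Z"
proof -
  have "complex_of_real (exp (tr Y)) = of_real (exp (tr X / 2) * exp (tr Z) * exp (tr X / 2))"
    using arg_cong[OF eq, of Determinant.det] X Y Z
    by (simp add: det_exp_herm[of n] det_mult[of _ n])
  then have "exp (tr Y) = exp (tr X / 2 + tr Z + tr X / 2)"
    by (simp only: exp_add of_real_eq_iff)
  then show ?thesis by simp
qed

lemma exp_herm_add_const:
  assumes "herm n X"
  shows "exp_herm 1 (X + of_real c \<cdot>\<^sub>m 1\<^sub>m n) = of_real (exp c) \<cdot>\<^sub>m exp_herm 1 X"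
proof -
  obtain U d where U: "eigen_dec n U d X" using spectral_theorem[OF assms] by blast
  have "eigen_dec n U (\<lambda>i. d i + c * 1) (X + of_real c \<cdot>\<^sub>m 1\<^sub>m n)"
    by (intro eigen_dec_add U eigen_dec_smult eigen_dec_one eigen_dec_unitary[OF U])
  from eigen_dec_unique[OF eigen_dec_exp_herm[OF this, of 1]] eigen_dec_smult[OF eigen_dec_exp_herm[OF U, of 1], of "exp c"]
  show ?thesis by (simp add: exp_add mult.commute)
qed

text \<open>Write \<open>exp Y = S (exp H) S\<close> with \<open>S = exp (X/2)\<close>, and replace \<open>H\<close> by \<open>K = (H - c)\<^sub>+\<close>, which gives
  \<open>exp Y'' = S (exp K) S\<close>. Since \<open>1 \<le> exp K\<close> and \<open>exp H \<le> exp c exp K\<close>, monotonicity of the logarithm gives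
  \<open>X \<le> Y''\<close> and \<open>Y \<le> Y'' + c\<close>. So in an eigenbasis of \<open>Y - X\<close> the diagonal entries of \<open>Y'' - X\<close> dominate
  \<open>(d\<^sub>i - c)\<^sub>+\<close>, and their sum is the trace of \<open>K\<close>.\<close>

lemma hinge_log_difference:
  assumes X: "herm n X" and Y: "herm n Y" and H: "eigen_dec n V h H"
    and eq: "exp_herm 1 Y = exp_herm (1/2) X * exp_herm 1 H * exp_herm (1/2) X"
    and D: "eigen_dec n U d (Y - X)"
  shows "(\<Sum>i<n. max 0 (d i - c)) \<le> (\<Sum>i<n. max 0 (h i - c))"
proof -
  have Hh: "herm n H" by (rule eigen_dec_herm[OF H])
  have U: "unitary_mat n U" and Uc: "U \<in> carrier_mat n n" using D by (auto simp: eigen_dec_def unitary_carrier)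
  define S where "S = exp_herm (1/2) X"
  have Sc: "S \<in> carrier_mat n n" and SS: "mat_adjoint S = S" using X by (auto simp: S_def)
  define K where "K = herm_fun (\<lambda>t. max 0 (t - c)) H"
  have K: "eigen_dec n V (\<lambda>i. max 0 (h i - c)) K" unfolding K_def by (rule eigen_dec_herm_fun[OF H])
  have Kh: "herm n K" by (rule eigen_dec_herm[OF K])
  define Z where "Z = mat_log (S * exp_herm 1 K * S)"
  have pd: "S * exp_herm 1 K * S \<in> pos_def_mats n"
    unfolding S_def by (rule herm_conj_exp[OF X exp_herm_pos_def[OF Kh]])
  have Z: "herm n Z" and expZ: "exp_herm 1 Z = S * exp_herm 1 K * S"
    unfolding Z_def using mat_log_herm[OF pd] exp_herm_mat_log[OF pd] by auto
  have XZ: "loewner_le n X Z"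
  proof (rule loewner_le_log[OF X Z])
    have "loewner_le n (1\<^sub>m n) (exp_herm 1 K)"
      by (rule loewner_le_eigen_dec[OF eigen_dec_one[OF eigen_dec_unitary[OF K]] eigen_dec_exp_herm[OF K]]) simp
    from loewner_le_conj[OF this _ _ Sc] have "loewner_le n (S * 1\<^sub>m n * S) (S * exp_herm 1 K * S)"
      using Kh by (simp add: SS)
    moreover have "S * 1\<^sub>m n * S = exp_herm 1 X" using X by (simp add: S_def exp_herm_mult)
    ultimately show "loewner_le n (exp_herm 1 X) (exp_herm 1 Z)" unfolding expZ by simp
  qed
  define Zc where "Zc = Z + of_real c \<cdot>\<^sub>m 1\<^sub>m n"
  have Zch: "herm n Zc" unfolding Zc_def by (intro herm_add Z herm_smult herm_one)
  have YZ: "loewner_le n Y Zc"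
  proof (rule loewner_le_log[OF Y Zch])
    have "loewner_le n (exp_herm 1 H) (of_real (exp c) \<cdot>\<^sub>m exp_herm 1 K)"
      by (rule loewner_le_eigen_dec[OF eigen_dec_exp_herm[OF H] eigen_dec_smult[OF eigen_dec_exp_herm[OF K]]])
         (simp flip: exp_add)
    from loewner_le_conj[OF this _ _ Sc]
    have "loewner_le n (S * exp_herm 1 H * S) (S * (of_real (exp c) \<cdot>\<^sub>m exp_herm 1 K) * S)"
      using Kh Hh by (simp add: SS)
    moreover have "S * (of_real (exp c) \<cdot>\<^sub>m exp_herm 1 K) * S = exp_herm 1 Zc"
      unfolding Zc_def exp_herm_add_const[OF Z] expZ using Kh Sc
      by (simp add: mult_smult_distrib[of _ n n _ n] mult_smult_assoc_mat[of _ n n _ n])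
    ultimately show "loewner_le n (exp_herm 1 Y) (exp_herm 1 Zc)" unfolding eq S_def by simp
  qed
  define q where "q A i = Re ((mat_adjoint U * A * U) $$ (i, i))" for A i
  note carriers = herm_carrier[OF X] herm_carrier[OF Y] herm_carrier[OF Z] herm_carrier[OF Zch]
  have q_qf: "q A i = qf A (U *\<^sub>v unit_vec n i)" if "A \<in> carrier_mat n n" "i < n" for A i
    using qf_unit_vec[of "mat_adjoint U * A * U" n i] qf_conj[of U n A "unit_vec n i"] that Uc
    by (simp add: q_def)
  have qD: "q Y i - q X i = d i" if "i < n" for i
  proof -
    have "q (Y - X) i = d i" unfolding q_def eigen_dec_diagonalize[OF D] using that by (simp add: real_diag_index)
    then show ?thesis using that carriers Uc
      by (simp add: q_qf qf_minus[of _ n] mult_mat_vec_closed minus_carrier_mat)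
  qed
  have qZc: "q Zc i = q Z i + c" if "i < n" for i
  proof -
    have "mat_adjoint U * 1\<^sub>m n * U = 1\<^sub>m n" using Uc unitary_left[OF U] by simp
    then have "q (1\<^sub>m n) i = 1" using that by (simp add: q_def)
    then show ?thesis using that carriers Uc unfolding Zc_def
      by (simp add: q_qf qf_add[of _ n] qf_smult[of _ n] mult_mat_vec_closed)
  qed
  have le: "max 0 (d i - c) \<le> q Z i - q X i" if "i < n" for i
    using diagonal_entry_mono[OF XZ _ _ Uc that] diagonal_entry_mono[OF YZ _ _ Uc that] carriers
      qD[OF that] qZc[OF that] by (simp add: q_def)
  have tr_q: "(\<Sum>i<n. q A i) = tr A" if "A \<in> carrier_mat n n" for A
    using tr_unitary_conj[OF that unitary_adjoint[OF U]] that Uc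
    by (simp add: tr_sum[of "mat_adjoint U * A * U" n] q_def)
  have "(\<Sum>i<n. max 0 (d i - c)) \<le> (\<Sum>i<n. q Z i - q X i)" by (intro sum_mono) (use le in auto)
  also have "\<dots> = tr Z - tr X" using carriers by (simp add: sum_subtractf tr_q)
  also have "\<dots> = tr K" using tr_log_product[OF X Z Kh] expZ by (simp add: S_def)
  also have "\<dots> = (\<Sum>i<n. max 0 (h i - c))" by (rule tr_eigen_dec[OF K])
  finally show ?thesis .
qed

text \<open>Equality of the traces of one strictly convex function carries over to every \<open>F\<close>, since it forces the
  spectra of \<open>Y - X\<close> and \<open>H\<close> to agree.\<close>

lemma log_difference_majorization:
  assumes X: "herm n X" and Y: "herm n Y" and H: "herm n H"
    and eq: "exp_herm 1 Y = exp_herm (1/2) X * exp_herm 1 H * exp_herm (1/2) X"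
    and tangent: "\<And>x y :: real. x \<noteq> y \<Longrightarrow> f y > f x + g x * (y - x)"
  shows "tr (herm_fun f (Y - X)) \<le> tr (herm_fun f H)"
    and "tr (herm_fun f (Y - X)) = tr (herm_fun f H) \<Longrightarrow> tr (herm_fun F (Y - X)) = tr (herm_fun F H)"
proof -
  obtain V h where V: "eigen_dec n V h H" using spectral_theorem[OF H] by blast
  obtain U d where U: "eigen_dec n U d (Y - X)" using spectral_theorem[OF herm_minus[OF Y X]] by blast
  have total: "(\<Sum>i<n. d i) = (\<Sum>i<n. h i)"
    using tr_eigen_dec[OF U] tr_eigen_dec[OF V] tr_log_product[OF X Y H eq]
      tr_minus[OF herm_carrier[OF Y] herm_carrier[OF X]] by simp
  note hm = hinge_majorization[where f = f and g = g, OF tangent hinge_log_difference[OF X Y V eq U] total]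
  show "tr (herm_fun f (Y - X)) \<le> tr (herm_fun f H)"
    unfolding tr_herm_fun[OF U] tr_herm_fun[OF V] by (rule hm(1))
  show "tr (herm_fun F (Y - X)) = tr (herm_fun F H)" if "tr (herm_fun f (Y - X)) = tr (herm_fun f H)"
    using hm(2)[where F = F] that unfolding tr_herm_fun[OF U] tr_herm_fun[OF V] by simp
qed

text \<open>In an eigenbasis of \<open>B\<close>, a matrix commutes with \<open>B\<close> iff its entries vanish wherever two eigenvalues
  differ, and equal eigenvalues of \<open>B\<close> give equal eigenvalues of \<open>f(B)\<close>.\<close>

lemma herm_fun_commute:
  assumes B: "herm n B" and M: "M \<in> carrier_mat n n" and comm: "B * M = M * B"
  shows "herm_fun f B * M = M * herm_fun f B"
proof -
  obtain U d where U: "eigen_dec n U d B" using spectral_theorem[OF B] by blast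
  have Uu: "unitary_mat n U" and Uc: "U \<in> carrier_mat n n" using U by (auto simp: eigen_dec_def unitary_carrier)
  define N where "N = mat_adjoint U * M * U"
  have Nc: "N \<in> carrier_mat n n" using M Uc by (simp add: N_def)
  have "real_diag n d * N = N * real_diag n d"
    using unitary_conj_mult[OF Uu herm_carrier[OF B] M] unitary_conj_mult[OF Uu M herm_carrier[OF B]]
    unfolding eigen_dec_diagonalize[OF U, symmetric] N_def comm by simp
  then have "of_real (d i) * N $$ (i, j) = N $$ (i, j) * of_real (d j)" if "i < n" "j < n" for i j
    using real_diag_mult_index[OF Nc that, of d] by metis
  then have entry: "N $$ (i, j) = 0 \<or> d i = d j" if "i < n" "j < n" for i j
    using that by (metis mult.commute mult_cancel_left of_real_eq_iff)
  have "real_diag n (\<lambda>i. f (d i)) * N = N * real_diag n (\<lambda>i. f (d i))"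
  proof (rule eq_matI)
    fix i j assume "i < dim_row (N * real_diag n (\<lambda>i. f (d i)))" "j < dim_col (N * real_diag n (\<lambda>i. f (d i)))"
    then have ij: "i < n" "j < n" using Nc carrier_matD[OF real_diag_carrier] by auto
    show "(real_diag n (\<lambda>i. f (d i)) * N) $$ (i, j) = (N * real_diag n (\<lambda>i. f (d i))) $$ (i, j)"
      unfolding real_diag_mult_index[OF Nc ij] using entry[OF ij] by auto
  qed (use Nc carrier_matD[OF real_diag_carrier] in auto)
  then have "mat_adjoint U * (herm_fun f B * M) * U = mat_adjoint U * (M * herm_fun f B) * U"
    using unitary_conj_mult[OF Uu herm_carrier[OF herm_herm_fun[OF B]] M, of f]
      unitary_conj_mult[OF Uu M herm_carrier[OF herm_herm_fun[OF B]], of f]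
    unfolding eigen_dec_diagonalize[OF eigen_dec_herm_fun[OF U]] N_def by simp
  then show ?thesis
    using unitary_conj_cancel[OF Uu] herm_carrier[OF herm_herm_fun[OF B]] M mult_carrier_square by metis
qed

lemma exp_herm_commute_imp:
  assumes X: "herm n X" and Y: "herm n Y" and "r \<noteq> 0" "s \<noteq> 0"
    and comm: "exp_herm r X * exp_herm s Y = exp_herm s Y * exp_herm r X"
  shows "X * Y = Y * X"
proof -
  have log: "herm_fun (\<lambda>t. ln t / q) (exp_herm q Z) = Z" if "herm n Z" "q \<noteq> 0" for Z q
    unfolding exp_herm_def using herm_fun_compose[OF that(1)] herm_fun_id[OF that(1)] that(2) by simp
  have "X * exp_herm s Y = exp_herm s Y * X"
    using herm_fun_commute[OF exp_herm_herm[OF X] _ comm, of "\<lambda>t. ln t / r"] Y by (simp add: log X assms)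
  from herm_fun_commute[OF exp_herm_herm[OF Y] _ this[symmetric], of "\<lambda>t. ln t / s"] X
  show ?thesis by (simp add: log Y assms herm_carrier)
qed

text \<open>If \<open>Y - X\<close> and \<open>H\<close> have the same eigenvalues, compare both with \<open>T = exp (Y/2) exp (-X/2)\<close>: the
  majorization for \<open>X/2\<close> and \<open>Y/2\<close> gives \<open>tr (exp (Y - X)) \<le> tr (T\<^sup>2)\<close>, while
  \<open>tr (exp H) = tr (T\<^sup>* T)\<close>. Thus \<open>tr (T\<^sup>* T) \<le> tr (T\<^sup>2)\<close>, which forces \<open>T = T\<^sup>*\<close>.\<close>

lemma equal_spectra_imp_commute:
  assumes X: "herm n X" and Y: "herm n Y" and H: "herm n H"
    and eq: "exp_herm 1 Y = exp_herm (1/2) X * exp_herm 1 H * exp_herm (1/2) X"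
    and tr_eq: "tr (herm_fun exp (Y - X)) = tr (herm_fun exp H)"
  shows "X * Y = Y * X"
proof -
  define e where "e = exp_herm (-1/2) X"
  define b where "b = exp_herm (1/2) Y"
  define a where "a = exp_herm (-1/4) X"
  have c: "e \<in> carrier_mat n n" "b \<in> carrier_mat n n" "a \<in> carrier_mat n n"
    and adj: "mat_adjoint e = e" "mat_adjoint b = b" "mat_adjoint a = a"
    using X Y by (auto simp: e_def b_def a_def)
  have aa: "a * a = e" and bb: "b * b = exp_herm 1 Y" using X Y by (auto simp: a_def b_def e_def exp_herm_mult)
  define X2 where "X2 = complex_of_real (1/2) \<cdot>\<^sub>m X"
  define Y2 where "Y2 = complex_of_real (1/2) \<cdot>\<^sub>m Y"
  have X2: "herm n X2" and Y2: "herm n Y2" unfolding X2_def Y2_def by (rule herm_smult[OF X], rule herm_smult[OF Y])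
  have pd: "a * b * a \<in> pos_def_mats n"
    unfolding a_def b_def by (rule herm_conj_exp[OF X exp_herm_pos_def[OF Y]])
  define H2 where "H2 = mat_log (a * b * a)"
  have H2: "herm n H2" and expH2: "exp_herm 1 H2 = a * b * a"
    unfolding H2_def using mat_log_herm[OF pd] exp_herm_mat_log[OF pd] by auto
  have eq2: "exp_herm 1 Y2 = exp_herm (1/2) X2 * exp_herm 1 H2 * exp_herm (1/2) X2"
  proof -
    have "exp_herm (1/2) X2 = exp_herm (1/4) X" unfolding X2_def exp_herm_smult[OF X] by simp
    then have "exp_herm (1/2) X2 * exp_herm 1 H2 * exp_herm (1/2) X2
        = exp_herm (1/4) X * (exp_herm (-1/4) X * (b * (exp_herm (-1/4) X * exp_herm (1/4) X)))"
      using X c unfolding expH2 a_def by (simp add: mult_assoc_square[of _ n])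
    also have "\<dots> = b" using X c exp_herm_cancel(1)[OF X, of b "1/4"] by (simp add: exp_herm_mult exp_herm_0)
    also have "b = exp_herm 1 Y2" unfolding Y2_def b_def exp_herm_smult[OF Y] by simp
    finally show ?thesis by simp
  qed
  have D2: "Y2 - X2 = complex_of_real (1/2) \<cdot>\<^sub>m (Y - X)"
    unfolding X2_def Y2_def using herm_carrier[OF X] herm_carrier[OF Y]
    by (intro eq_matI) (auto simp: right_diff_distrib)
  define T where "T = b * e"
  have Tc: "T \<in> carrier_mat n n" and Tadj: "mat_adjoint T = e * b"
    using c by (auto simp: T_def mat_adjoint_mult[of b n n e n] adj)
  have "tr (herm_fun (\<lambda>t. exp (2 * t)) (Y2 - X2)) \<le> tr (herm_fun (\<lambda>t. exp (2 * t)) H2)"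
  proof (rule log_difference_majorization(1)[OF X2 Y2 H2 eq2, where g = "\<lambda>t. 2 * exp (2 * t)"])
    fix x y :: real assume "x \<noteq> y"
    then have "1 + (2 * y - 2 * x) \<noteq> exp (2 * y - 2 * x)"
      using ln_eq_minus_one[of "exp (2 * y - 2 * x)"] by auto
    then have "1 + (2 * y - 2 * x) < exp (2 * y - 2 * x)"
      using exp_ge_add_one_self[of "2 * y - 2 * x"] by linarith
    then have "exp (2 * x) * (1 + (2 * y - 2 * x)) < exp (2 * x) * exp (2 * y - 2 * x)" by simp
    also have "\<dots> = exp (2 * y)" by (simp flip: exp_add)
    finally show "exp (2 * x) + 2 * exp (2 * x) * (y - x) < exp (2 * y)" by (simp add: algebra_simps)
  qed
  moreover have "herm_fun (\<lambda>t. exp (2 * t)) (Y2 - X2) = herm_fun exp (Y - X)"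
    unfolding D2 by (subst herm_fun_smult_arg[OF herm_minus[OF Y X]]) simp
  moreover have "herm_fun (\<lambda>t. exp (2 * t)) H2 = exp_herm 1 H2 * exp_herm 1 H2"
    unfolding exp_herm_mult[OF H2] by (simp add: exp_herm_def)
  moreover have "tr (exp_herm 1 H2 * exp_herm 1 H2) = tr (T * T)"
  proof -
    have "tr (exp_herm 1 H2 * exp_herm 1 H2) = tr (a * (b * e * b * a))"
      unfolding expH2 aa[symmetric] using c by (simp add: mult_assoc_square[of _ n])
    also have "\<dots> = tr (b * e * b * a * a)" using c by (intro tr_comm[of _ n]) auto
    also have "\<dots> = tr (T * T)" unfolding T_def aa[symmetric] using c by (simp add: mult_assoc_square[of _ n])
    finally show ?thesis .
  qed
  moreover have "tr (herm_fun exp H) = tr (mat_adjoint T * T)"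
  proof -
    have "exp_herm 1 H = e * exp_herm 1 Y * e"
      unfolding eq e_def using X H exp_herm_cancel(2)[OF X, of _ "1/2"]
      by (simp add: mult_assoc_square[of _ n] exp_herm_mult exp_herm_0)
    also have "\<dots> = mat_adjoint T * T"
      unfolding T_def bb[symmetric] using c
      by (simp add: mat_adjoint_mult[of b n n e n] adj mult_assoc_square[of _ n])
    finally show ?thesis by (simp add: exp_herm_def)
  qed
  ultimately have "tr (mat_adjoint T * T) \<le> tr (T * T)" using tr_eq by simp
  moreover define N where "N = T - mat_adjoint T"
  have Nc: "N \<in> carrier_mat n n" using Tc by (simp add: N_def minus_carrier_mat)
  have "tr (mat_adjoint N * N) = 2 * tr (mat_adjoint T * T) - 2 * tr (T * T)"
  proof -
    have "mat_adjoint N * N = (mat_adjoint T * T - T * T) - (mat_adjoint T * mat_adjoint T - T * mat_adjoint T)"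
      unfolding N_def using Tc
      by (simp add: mat_adjoint_minus[of _ n n] minus_mult_distrib_mat[of _ n n _ _ n]
          mult_minus_distrib_mat[of _ n n _ n] minus_carrier_mat)
    then have "tr (mat_adjoint N * N) = tr (mat_adjoint T * T) - tr (T * T)
        - (tr (mat_adjoint T * mat_adjoint T) - tr (T * mat_adjoint T))"
      using Tc by (simp add: tr_minus[of _ n] minus_carrier_mat)
    moreover have "tr (mat_adjoint T * mat_adjoint T) = tr (T * T)"
      using tr_adjoint[of "T * T" n] Tc by (simp add: mat_adjoint_mult[of T n n T n])
    moreover have "tr (T * mat_adjoint T) = tr (mat_adjoint T * T)" using Tc by (intro tr_comm[of _ n]) auto
    ultimately show ?thesis by simp
  qed
  moreover have "tr (mat_adjoint N * N) \<ge> 0" unfolding tr_adjoint_mult[OF Nc] by (intro sum_nonneg) auto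
  ultimately have "tr (mat_adjoint N * N) = 0" by linarith
  from adjoint_mult_eq_0[OF Nc this] have N0: "N = 0\<^sub>m n n" .
  have "T = mat_adjoint T"
  proof (rule eq_matI)
    fix i j assume ij: "i < dim_row (mat_adjoint T)" "j < dim_col (mat_adjoint T)"
    then have "N $$ (i, j) = T $$ (i, j) - mat_adjoint T $$ (i, j)" using Tc by (simp add: N_def)
    then show "T $$ (i, j) = mat_adjoint T $$ (i, j)" using N0 ij Tc by simp
  qed (use Tc in auto)
  then have "T = e * b" using Tadj by simp
  then have "e * b = b * e" by (simp add: T_def)
  then show ?thesis unfolding e_def b_def by (intro exp_herm_commute_imp[OF X Y]) auto
qed

text \<open>The majorization for \<open>\<bar>x\<bar>\<^sup>p\<close>; in the case of equality it is transferred to \<open>exp\<close>, where the trace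
  argument above applies.\<close>

lemma exponential_metric_increasing:
  assumes p: "1 < p" "p \<le> 2" and X: "herm n X" and Y: "herm n Y"
  shows "delta p (exp_herm 1 X) (exp_herm 1 Y) \<ge> schatten_norm p (Y - X)"
    and "X * Y \<noteq> Y * X \<Longrightarrow> delta p (exp_herm 1 X) (exp_herm 1 Y) > schatten_norm p (Y - X)"
proof -
  define G where "G = exp_herm (-1/2) X * exp_herm 1 Y * exp_herm (-1/2) X"
  have pd: "G \<in> pos_def_mats n" unfolding G_def by (rule herm_conj_exp[OF X exp_herm_pos_def[OF Y]])
  define H where "H = mat_log G"
  have H: "herm n H" and expH: "exp_herm 1 H = G"
    unfolding H_def using mat_log_herm[OF pd] exp_herm_mat_log[OF pd] by auto
  have eq: "exp_herm 1 Y = exp_herm (1/2) X * exp_herm 1 H * exp_herm (1/2) X"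
    unfolding expH G_def using X Y exp_herm_cancel(1)[OF X, of _ "1/2"]
    by (simp add: mult_assoc_square[of _ n] exp_herm_mult exp_herm_0)
  have D: "delta p (exp_herm 1 X) (exp_herm 1 Y) = pow_sum p H powr (1 / p)"
    unfolding delta_exp_herm[OF X] H_def[symmetric] G_def[symmetric] by (rule schatten_norm_herm[OF H])
  have S: "schatten_norm p (Y - X) = pow_sum p (Y - X) powr (1 / p)"
    by (rule schatten_norm_herm[OF herm_minus[OF Y X]])
  note maj = log_difference_majorization[OF X Y H eq abs_powr_tangent_strict[OF p]]
  have le: "pow_sum p (Y - X) \<le> pow_sum p H" unfolding pow_sum_def by (rule maj(1))
  have nn: "pow_sum p (Y - X) \<ge> 0" by (rule pow_sum_nonneg[OF herm_minus[OF Y X]])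
  show "delta p (exp_herm 1 X) (exp_herm 1 Y) \<ge> schatten_norm p (Y - X)"
    unfolding D S using le nn p by (intro powr_mono2) auto
  show "delta p (exp_herm 1 X) (exp_herm 1 Y) > schatten_norm p (Y - X)" if "X * Y \<noteq> Y * X"
  proof -
    have "pow_sum p (Y - X) \<noteq> pow_sum p H"
      using equal_spectra_imp_commute[OF X Y H eq maj(2)] that unfolding pow_sum_def by blast
    then show ?thesis unfolding D S using le nn p by (intro powr_less_mono2) auto
  qed
qed

section \<open>Real inequalities for the convexity of the Schatten norm\<close>

text \<open>Substituting \<open>s u\<close> for \<open>u\<close> extracts the factor \<open>s\<^sup>t\<close>; the remaining integral converges at \<open>0\<close> because of
  \<open>0 < t\<close> and at infinity because of \<open>t < 1\<close>.\<close>

lemma powr_resolvent_integral: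
  fixes t :: real
  assumes t: "0 < t" "t < 1"
  defines "f \<equiv> \<lambda>s u. if u > 0 then s / (s + u) * u powr (t - 1) else 0"
  shows "\<exists>c. c \<noteq> 0 \<and> c \<noteq> Orderings.top \<and> (\<forall>s\<ge>0. (\<integral>\<^sup>+u. ennreal (f s u) \<partial>lborel) = ennreal (s powr t) * c)"
proof -
  define c where "c = (\<integral>\<^sup>+u. ennreal (f 1 u) \<partial>lborel)"
  have meas [measurable]: "f s \<in> borel_measurable borel" for s
    unfolding f_def by measurable
  have scale: "(\<integral>\<^sup>+u. ennreal (f s u) \<partial>lborel) = ennreal (s powr t) * c" if "s \<ge> 0" for s
  proof (cases "s = 0")
    case False
    then have s: "s > 0" using that by simp
    have eq: "f s (0 + s * x) = s powr (t - 1) * f 1 x" for x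
    proof -
      have "s + s * x = s * (1 + x)" by (simp add: algebra_simps)
      then have "s / (s + s * x) = 1 / (1 + x)" using s by simp
      then show ?thesis using s by (auto simp: f_def powr_mult zero_less_mult_iff)
    qed
    have "(\<integral>\<^sup>+u. ennreal (f s u) \<partial>lborel) = ennreal \<bar>s\<bar> * (\<integral>\<^sup>+x. ennreal (f s (0 + s * x)) \<partial>lborel)"
      using s by (intro nn_integral_real_affine) auto
    also have "(\<integral>\<^sup>+x. ennreal (f s (0 + s * x)) \<partial>lborel) = (\<integral>\<^sup>+x. ennreal (s powr (t - 1)) * ennreal (f 1 x) \<partial>lborel)"
      unfolding eq by (intro nn_integral_cong ennreal_mult') simp
    also have "\<dots> = ennreal (s powr (t - 1)) * c" unfolding c_def by (intro nn_integral_cmult) simp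
    also have "ennreal \<bar>s\<bar> * (ennreal (s powr (t - 1)) * c) = ennreal (s * s powr (t - 1)) * c"
      using s by (simp add: ennreal_mult' mult.assoc)
    also have "s * s powr (t - 1) = s powr t" using s by (simp add: powr_diff)
    finally show ?thesis .
  next
    case True
    then have "f s = (\<lambda>_. 0)" by (auto simp: f_def)
    then show ?thesis using True by simp
  qed
  have "c \<noteq> Orderings.top"
  proof -
    define g where "g x = (if x \<in> {0..1} then x powr (t - 1) else 0)" for x :: real
    define h where "h x = (if x \<in> {1..} then x powr (t - 2) else 0)" for x :: real
    have [measurable]: "g \<in> borel_measurable borel" "h \<in> borel_measurable borel"
      unfolding g_def h_def by measurable
    have nonneg: "0 \<le> g x" "0 \<le> h x" for x by (auto simp: g_def h_def)
    have "(g has_integral 1 powr (t - 1 + 1) / (t - 1 + 1)) UNIV"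
      unfolding g_def using has_integral_powr_from_0[of "t - 1" 1] t by (subst has_integral_restrict_UNIV) auto
    then have g: "(\<integral>\<^sup>+x. ennreal (g x) \<partial>lborel) = ennreal (1 powr (t - 1 + 1) / (t - 1 + 1))"
      by (intro nn_integral_has_integral_lborel nonneg) simp_all
    have "(h has_integral - (1 powr (t - 2 + 1)) / (t - 2 + 1)) UNIV"
      unfolding h_def using has_integral_powr_to_inf[of "t - 2" 1] t by (subst has_integral_restrict_UNIV) auto
    then have h: "(\<integral>\<^sup>+x. ennreal (h x) \<partial>lborel) = ennreal (- (1 powr (t - 2 + 1)) / (t - 2 + 1))"
      by (intro nn_integral_has_integral_lborel nonneg) simp_all
    have "f 1 x \<le> g x + h x" for x
    proof (cases "x \<le> 1")
      case True
      have "x > 0 \<Longrightarrow> 1 / (1 + x) * x powr (t - 1) \<le> 1 * x powr (t - 1)"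
        by (intro mult_right_mono) auto
      then show ?thesis using True by (auto simp: f_def g_def h_def)
    next
      case False
      then have "1 / (1 + x) * x powr (t - 1) \<le> 1 / x * x powr (t - 1)"
        by (intro mult_right_mono) (auto simp: field_simps)
      also have "\<dots> = x powr (t - 2)" using False by (simp add: powr_diff power2_eq_square)
      finally show ?thesis using False by (auto simp: f_def g_def h_def)
    qed
    then have "c \<le> (\<integral>\<^sup>+x. ennreal (g x) + ennreal (h x) \<partial>lborel)"
      unfolding c_def by (intro nn_integral_mono) (auto simp: g_def h_def simp flip: ennreal_plus intro!: ennreal_leI)
    also have "\<dots> = (\<integral>\<^sup>+x. ennreal (g x) \<partial>lborel) + (\<integral>\<^sup>+x. ennreal (h x) \<partial>lborel)"
      by (intro nn_integral_add) auto
    also have "\<dots> < Orderings.top" unfolding g h by simp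
    finally show ?thesis by simp
  qed
  moreover have "c \<noteq> 0"
  proof -
    have le: "(1 / 6) * indicator {1..2} x \<le> f 1 x" for x :: real
    proof (cases "x \<in> {1..2}")
      case True
      have "(1::real) / 2 \<le> 1 / x" using True by (auto simp: field_simps)
      also have "1 / x = x powr (- 1)" using True by (simp add: powr_minus_divide)
      also have "\<dots> \<le> x powr (t - 1)" using True t by (intro powr_mono) auto
      finally have a: "1 / 2 \<le> x powr (t - 1)" .
      have b: "1 / 3 \<le> 1 / (1 + x)" using True by (auto simp: field_simps)
      have "(1 / 3) * (1 / 2) \<le> 1 / (1 + x) * x powr (t - 1)"
        by (rule mult_mono[OF b a]) (use True in auto)
      then show ?thesis using True by (simp add: f_def)
    qed (simp add: f_def)
    have "ennreal (1/6) = ennreal (1/6) * emeasure lborel {1..2::real}" by simp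
    also have "\<dots> = (\<integral>\<^sup>+x. ennreal (1/6) * indicator {1..2::real} x \<partial>lborel)"
      by (subst nn_integral_cmult_indicator) auto
    also have "\<dots> \<le> c" unfolding c_def
    proof (rule nn_integral_mono)
      fix x :: real
      show "ennreal (1/6) * indicator {1..2} x \<le> ennreal (f 1 x)"
        using le[of x] by (cases "x \<in> {1..2}") (auto intro!: ennreal_leI)
    qed
    finally show ?thesis by (metis ennreal_eq_0_iff le_zero_eq not_le zero_less_divide_1_iff zero_less_numeral)
  qed
  ultimately show ?thesis using scale by blast
qed

lemma powr_comparison_from_resolvents:
  fixes w s :: "'a \<Rightarrow> real" and v c :: "'b \<Rightarrow> real" and t :: real
  assumes t: "0 < t" "t < 1" and fin: "finite I" "finite J"
    and nn: "\<And>i. i \<in> I \<Longrightarrow> w i \<ge> 0" "\<And>i. i \<in> I \<Longrightarrow> s i \<ge> 0" "\<And>j. j \<in> J \<Longrightarrow> v j \<ge> 0" "\<And>j. j \<in> J \<Longrightarrow> c j \<ge> 0"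
    and le: "\<And>u. u > 0 \<Longrightarrow> (\<Sum>i\<in>I. w i * (s i / (s i + u))) \<le> (\<Sum>j\<in>J. v j * (c j / (c j + u)))"
  shows "(\<Sum>i\<in>I. w i * s i powr t) \<le> (\<Sum>j\<in>J. v j * c j powr t)"
proof -
  define f where "f s u = (if u > 0 then s / (s + u) * u powr (t - 1) else 0)" for s u :: real
  obtain k where k: "k \<noteq> 0" "k \<noteq> Orderings.top" "\<And>s. s \<ge> 0 \<Longrightarrow> (\<integral>\<^sup>+u. ennreal (f s u) \<partial>lborel) = ennreal (s powr t) * k"
    using powr_resolvent_integral[OF t] unfolding f_def by metis
  have [measurable]: "f s \<in> borel_measurable borel" for s unfolding f_def by measurable
  have f0: "f s u \<ge> 0" if "s \<ge> 0" for s u using that by (auto simp: f_def)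
  have int: "(\<integral>\<^sup>+u. ennreal (\<Sum>i\<in>K. a i * f (b i) u) \<partial>lborel) = k * ennreal (\<Sum>i\<in>K. a i * b i powr t)"
    if "finite K" "\<And>i. i \<in> K \<Longrightarrow> a i \<ge> 0" "\<And>i. i \<in> K \<Longrightarrow> b i \<ge> 0" for K :: "'c set" and a b
  proof -
    have "(\<integral>\<^sup>+u. ennreal (\<Sum>i\<in>K. a i * f (b i) u) \<partial>lborel) = (\<integral>\<^sup>+u. (\<Sum>i\<in>K. ennreal (a i) * ennreal (f (b i) u)) \<partial>lborel)"
      using that f0 by (intro nn_integral_cong) (auto simp: sum_ennreal ennreal_mult' simp flip: sum_ennreal intro!: sum.cong)
    also have "\<dots> = (\<Sum>i\<in>K. ennreal (a i) * (\<integral>\<^sup>+u. ennreal (f (b i) u) \<partial>lborel))"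
      by (simp add: nn_integral_sum nn_integral_cmult)
    also have "\<dots> = (\<Sum>i\<in>K. k * ennreal (a i * b i powr t))"
      using that by (intro sum.cong) (auto simp: k(3) ennreal_mult' ac_simps)
    also have "\<dots> = k * ennreal (\<Sum>i\<in>K. a i * b i powr t)"
      using that by (simp add: sum_ennreal flip: sum_distrib_left)
    finally show ?thesis .
  qed
  have "(\<Sum>i\<in>I. w i * f (s i) u) \<le> (\<Sum>j\<in>J. v j * f (c j) u)" for u
  proof (cases "u > 0")
    case True
    have "(\<Sum>i\<in>I. w i * (s i / (s i + u))) * u powr (t - 1) \<le> (\<Sum>j\<in>J. v j * (c j / (c j + u))) * u powr (t - 1)"
      by (intro mult_right_mono le True) auto
    then show ?thesis using True by (simp add: f_def sum_distrib_right mult.assoc)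
  qed (simp add: f_def)
  then have "k * ennreal (\<Sum>i\<in>I. w i * s i powr t) \<le> k * ennreal (\<Sum>j\<in>J. v j * c j powr t)"
    using int[of I w s] int[of J v c] fin nn
    by (metis (no_types, lifting) ennreal_leI nn_integral_mono)
  then have "ennreal (\<Sum>i\<in>I. w i * s i powr t) \<le> ennreal (\<Sum>j\<in>J. v j * c j powr t)"
    using k by (simp add: ennreal_mult_le_mult_iff)
  moreover have "(\<Sum>j\<in>J. v j * c j powr t) \<ge> 0" using nn by (intro sum_nonneg) auto
  ultimately show ?thesis by (simp add: ennreal_le_iff)
qed

text \<open>Hoelder's inequality with the exponents \<open>1 / (1 - t)\<close> and \<open>1 / t\<close>.\<close>

lemma holder_sum:
  fixes a b :: "'a \<Rightarrow> real"
  assumes t: "0 < t" "t < 1" and nn: "\<And>i. i \<in> I \<Longrightarrow> a i \<ge> 0" "\<And>i. i \<in> I \<Longrightarrow> b i \<ge> 0" and fin: "finite I"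
  shows "(\<Sum>i\<in>I. a i powr (1 - t) * b i powr t) \<le> (\<Sum>i\<in>I. a i) powr (1 - t) * (\<Sum>i\<in>I. b i) powr t"
proof -
  define A where "A = (\<Sum>i\<in>I. a i)"
  define B where "B = (\<Sum>i\<in>I. b i)"
  have AB: "A \<ge> 0" "B \<ge> 0" using nn by (auto simp: A_def B_def sum_nonneg)
  show ?thesis
  proof (cases "A = 0 \<or> B = 0")
    case True
    then have "(\<forall>i\<in>I. a i = 0) \<or> (\<forall>i\<in>I. b i = 0)"
      using nn fin by (auto simp: A_def B_def sum_nonneg_eq_0_iff)
    then have "(\<Sum>i\<in>I. a i powr (1 - t) * b i powr t) = 0" by (auto intro!: sum.neutral)
    then show ?thesis by simp
  next
    case False
    then have pos: "A > 0" "B > 0" using AB by auto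
    have "(a i powr (1 - t) * b i powr t) / (A powr (1 - t) * B powr t) \<le> (1 - t) * (a i / A) + t * (b i / B)"
      if i: "i \<in> I" for i
    proof (cases "a i = 0 \<or> b i = 0")
      case True
      then show ?thesis using t pos nn[OF i] by auto
    next
      case False
      then have "(a i / A) powr (1 - t) * (b i / B) powr t \<le> (1 - t) * (a i / A) + t * (b i / B)"
        using nn[OF i] pos t by (intro Youngs_inequality_0) auto
      then show ?thesis using nn[OF i] pos by (simp add: powr_divide)
    qed
    then have "(\<Sum>i\<in>I. (a i powr (1 - t) * b i powr t) / (A powr (1 - t) * B powr t))
        \<le> (\<Sum>i\<in>I. (1 - t) * (a i / A) + t * (b i / B))"
      by (intro sum_mono)
    also have "\<dots> = (1 - t) * (A / A) + t * (B / B)"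
      by (simp add: A_def B_def sum.distrib flip: sum_divide_distrib sum_distrib_left)
    also have "\<dots> = 1" using pos by simp
    finally show ?thesis
      using pos by (simp add: pos_divide_le_eq flip: sum_divide_distrib A_def B_def)
  qed
qed

lemma powr_tangent:
  fixes x y q :: real
  assumes "1 < q" "q \<le> 2" "x > 0" "y \<ge> 0"
  shows "y powr q \<ge> x powr q + q * x powr (q - 1) * (y - x)"
  using abs_powr_tangent_strict[OF assms(1,2), of x y] assms
  by (cases "x = y") (auto simp: abs_powr_deriv_def sgn_if)

lemma powr_jensen:
  fixes a y :: "nat \<Rightarrow> real"
  assumes p: "1 < p" "p \<le> 2" and a: "\<And>i. i < n \<Longrightarrow> a i \<ge> 0" "(\<Sum>i<n. a i) = 1" and y: "\<And>i. i < n \<Longrightarrow> y i \<ge> 0"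
  shows "(\<Sum>i<n. a i * y i) powr p \<le> (\<Sum>i<n. a i * y i powr p)"
proof (cases "(\<Sum>i<n. a i * y i) = 0")
  case True
  then show ?thesis using a y by (auto intro!: sum_nonneg)
next
  case False
  define m where "m = (\<Sum>i<n. a i * y i)"
  have m: "m > 0" using False a y by (auto simp: m_def less_le intro!: sum_nonneg)
  have "(\<Sum>i<n. a i * (m powr p + p * m powr (p - 1) * (y i - m))) \<le> (\<Sum>i<n. a i * y i powr p)"
    using a y by (intro sum_mono mult_left_mono powr_tangent p m) auto
  moreover have "(\<Sum>i<n. a i * (m powr p + p * m powr (p - 1) * (y i - m)))
      = (\<Sum>i<n. a i) * m powr p + p * m powr (p - 1) * ((\<Sum>i<n. a i * y i) - (\<Sum>i<n. a i) * m)"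
    by (simp add: algebra_simps sum.distrib sum_subtractf sum_distrib_left sum_distrib_right)
  ultimately show ?thesis using a(2) by (simp add: m_def)
qed

text \<open>If the function exceeded its chord, a local line of support at the leftmost maximum of the difference
  would be parallel to the chord, so the maximum would also be attained further left.\<close>

lemma local_support_imp_midpoint_le:
  fixes G :: "real \<Rightarrow> real"
  assumes cont: "continuous_on {-1..1} G"
    and supp: "\<And>t. -1 < t \<Longrightarrow> t < 1 \<Longrightarrow> \<exists>m \<delta>. \<delta> > 0 \<and> (\<forall>h. \<bar>h\<bar> < \<delta> \<longrightarrow> G (t + h) \<ge> G t + h * m)"
  shows "G 0 \<le> (G 1 + G (-1)) / 2"
proof (rule ccontr)
  assume neg: "\<not> G 0 \<le> (G 1 + G (-1)) / 2"
  define D where "D = (G 1 - G (-1)) / 2"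
  define H where "H t = G t - ((G 1 + G (-1)) / 2 + t * D)" for t
  have contH: "continuous_on {-1..1} H" unfolding H_def using cont by (intro continuous_intros) auto
  have H0: "H 0 > 0" and H1: "H 1 = 0" "H (-1) = 0" using neg by (auto simp: H_def D_def field_simps)
  obtain M where M: "M \<in> {-1..1}" "\<And>t. t \<in> {-1..1} \<Longrightarrow> H t \<le> H M"
    using continuous_attains_sup[OF _ _ contH] by auto
  define S where "S = {t \<in> {-1..1}. H t = H M}"
  have "closed S" unfolding S_def using contH by (intro continuous_closed_preimage_constant) auto
  moreover have "S \<noteq> {}" "bdd_below S" using M(1) by (auto simp: S_def bdd_below_def)
  ultimately have inf: "Inf S \<in> S" by (intro closed_contains_Inf) auto
  define t where "t = Inf S"
  have t: "t \<in> {-1..1}" "H t = H M" using inf by (auto simp: S_def t_def)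
  have "H t > 0" using M(2)[of 0] H0 t by auto
  then have "t \<noteq> 1" "t \<noteq> -1" using H1 by auto
  then have ti: "-1 < t" "t < 1" using t(1) by auto
  obtain m \<delta> where d: "\<delta> > 0" "\<And>h. \<bar>h\<bar> < \<delta> \<Longrightarrow> G (t + h) \<ge> G t + h * m" using supp[OF ti] by metis
  define m' where "m' = m - D"
  have suppH: "H (t + h) \<ge> H t + h * m'" if "\<bar>h\<bar> < \<delta>" for h
    using d(2)[OF that] by (simp add: H_def m'_def algebra_simps)
  define h where "h = min (\<delta> / 2) (min (1 - t) (1 + t))"
  have h: "h > 0" "h < \<delta>" "t + h \<in> {-1..1}" "t - h \<in> {-1..1}" using d(1) ti by (auto simp: h_def min_def)
  have "h * m' \<le> 0" using suppH[of h] M(2)[of "t + h"] h t by auto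
  then have "m' \<le> 0" using h by (simp add: mult_le_0_iff)
  then have "- h * m' \<ge> 0" using h(1) by (simp add: mult_nonneg_nonpos)
  then have "H (t - h) = H M" using suppH[of "- h"] M(2)[of "t - h"] h t by auto
  then have "t - h \<in> S" using h by (simp add: S_def)
  then have "t \<le> t - h" unfolding t_def using \<open>bdd_below S\<close> by (intro cInf_lower)
  then show False using h(1) by simp
qed

text \<open>For \<open>N(t) = \<Sum>\<bar>\<lambda>\<^sub>i(Z + t X)\<bar>\<^sup>p\<close> and \<open>\<nu> = \<parallel>X\<parallel>\<^sup>2\<close>, the hypotheses bound \<open>N\<close> from below to second order
  around every \<open>t\<close>. As the increment tends to zero, the constant in the bound that this gives for
  \<open>N\<^sup>2\<^sup>/\<^sup>p = \<parallel>Z + t X\<parallel>\<^sup>2\<close> tends to \<open>(p - 1) \<nu>\<close>.\<close>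

lemma two_uniform_convexity_on_line:
  fixes N :: "real \<Rightarrow> real"
  assumes p: "1 < p" "p < 2" and \<nu>: "\<nu> \<ge> 0" and N0: "\<And>t. N t \<ge> 0"
    and zero: "\<And>t h. N t = 0 \<Longrightarrow> N (t + h) powr (2 / p) = h\<^sup>2 * \<nu>"
    and supp: "\<And>t. \<exists>m. \<forall>h. N (t + h) - N t - h * m \<ge> 0 \<and>
      (N (t + h) - N t - h * m) * ((2 * N t + N (t + h)) / 3) powr ((2 - p) / p) \<ge> p * (p - 1) / 2 * h\<^sup>2 * \<nu>"
  shows "(N 1 powr (2 / p) + N (-1) powr (2 / p)) / 2 \<ge> N 0 powr (2 / p) + (p - 1) * \<nu>"
proof (cases "\<nu> = 0")
  case False
  then have \<nu>: "\<nu> > 0" using \<nu> by simp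
  define q where "q = 2 / p"
  have q: "1 < q" "q \<le> 2" "q - 1 = (2 - p) / p" using p by (auto simp: q_def field_simps)
  obtain m where m: "\<And>t h. N (t + h) - N t - h * m t \<ge> 0"
    "\<And>t h. (N (t + h) - N t - h * m t) * ((2 * N t + N (t + h)) / 3) powr (q - 1) \<ge> p * (p - 1) / 2 * h\<^sup>2 * \<nu>"
    using supp unfolding q(3) by metis
  have "convex_on UNIV N"
  proof (rule pos_convex_function)
    fix x y :: real
    show "m x * (y - x) \<le> N y - N x" using m(1)[of x "y - x"] by (simp add: mult.commute)
  qed simp
  then have contN: "continuous_on UNIV N" by (intro convex_on_continuous) auto
  have "(N 1 powr q + N (-1) powr q) / 2 \<ge> N 0 powr q + k" if k: "k < (p - 1) * \<nu>" "0 \<le> k" for k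
  proof -
    define G where "G t = N t powr q - k * t\<^sup>2" for t
    have contG: "continuous_on {-1..1} G" unfolding G_def
      using q N0 by (intro continuous_intros continuous_on_powr' continuous_on_subset[OF contN]) auto
    have "\<exists>m' \<delta>. \<delta> > 0 \<and> (\<forall>h. \<bar>h\<bar> < \<delta> \<longrightarrow> G (t + h) \<ge> G t + h * m')" for t
    proof (cases "N t = 0")
      case True
      have "(p - 1) * \<nu> \<le> 1 * \<nu>" using p \<nu> by (intro mult_right_mono) auto
      then have "k \<le> \<nu>" using k by simp
      then have le: "h\<^sup>2 * k \<le> h\<^sup>2 * \<nu>" for h by (intro mult_left_mono) auto
      have "G (t + h) \<ge> G t + h * (- 2 * k * t)" for h
      proof -
        have "k * (t + h)\<^sup>2 = k * t\<^sup>2 + h\<^sup>2 * k - h * (- 2 * k * t)" by (simp add: power2_eq_square algebra_simps)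
        then show ?thesis using zero[OF True, of h] True le[of h] by (simp add: G_def q_def)
      qed
      then show ?thesis by (intro exI[of _ "- 2 * k * t"] exI[of _ 1]) auto
    next
      case False
      then have Nt: "N t > 0" using N0[of t] by simp
      define R where "R h = (2 * N t + N (t + h)) / 3" for h
      define c where "c = q * N t powr (q - 1)"
      have c: "c > 0" using Nt q by (simp add: c_def)
      have R: "R h > 0" for h using Nt N0[of "t + h"] by (simp add: R_def)
      \<comment> \<open>The second-order coefficient that the hypothesis gives for \<open>N\<^sup>q\<close> with the increment \<open>h\<close>.\<close>
      define \<phi> where "\<phi> h = (p - 1) * \<nu> * (N t powr (q - 1) / R h powr (q - 1))" for h
      have "continuous (at 0) \<phi>"
      proof -
        have N': "continuous (at 0) (\<lambda>h. N (t + h))"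
          by (rule continuous_within_compose3[where g = N and s = UNIV and f = "\<lambda>h. t + h", simplified])
             (use contN in \<open>auto simp: continuous_on_eq_continuous_at intro!: continuous_intros\<close>)
        have R0: "R 0 \<noteq> 0" "R 0 powr (q - 1) \<noteq> 0" using R[of 0] by auto
        show ?thesis unfolding \<phi>_def
          using R0 by (intro continuous_intros continuous_at_within_divide)
            (auto simp: R_def intro!: continuous_intros N')
      qed
      moreover have "\<phi> 0 = (p - 1) * \<nu>" using Nt by (simp add: \<phi>_def R_def)
      ultimately have "\<forall>\<^sub>F h in at 0. \<phi> h > k"
        using k by (intro order_tendstoD(1)[of \<phi> "\<phi> 0"]) (auto simp: continuous_at)
      then obtain \<delta> where \<delta>: "\<delta> > 0" "\<And>h. h \<noteq> 0 \<Longrightarrow> \<bar>h\<bar> < \<delta> \<Longrightarrow> \<phi> h > k"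
        unfolding eventually_at by (auto simp: dist_real_def)
      have "G (t + h) \<ge> G t + h * (c * m t - 2 * k * t)" if h: "\<bar>h\<bar> < \<delta>" for h
      proof (cases "h = 0")
        case False
        have "R h powr (q - 1) > 0" using R[of h] by simp
        then have "p * (p - 1) / 2 * h\<^sup>2 * \<nu> / R h powr (q - 1) \<le> N (t + h) - N t - h * m t"
          using m(2)[of h t] unfolding R_def by (subst pos_divide_le_eq) auto
        then have "h * m t + p * (p - 1) / 2 * h\<^sup>2 * \<nu> / R h powr (q - 1) \<le> N (t + h) - N t"
          by linarith
        then have "c * (h * m t + p * (p - 1) / 2 * h\<^sup>2 * \<nu> / R h powr (q - 1)) \<le> c * (N (t + h) - N t)"
          using c by (intro mult_left_mono) auto
        also have "\<dots> \<le> N (t + h) powr q - N t powr q"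
          using powr_tangent[OF q(1,2) Nt N0[of "t + h"]] by (simp add: c_def)
        finally have 1: "c * h * m t + c * (p * (p - 1) / 2 * h\<^sup>2 * \<nu> / R h powr (q - 1)) \<le> N (t + h) powr q - N t powr q"
          by (simp add: algebra_simps)
        have "c * (p * (p - 1) / 2 * h\<^sup>2 * \<nu> / R h powr (q - 1)) = h\<^sup>2 * \<phi> h"
          using p by (simp add: c_def \<phi>_def q_def)
        moreover have "h\<^sup>2 * k \<le> h\<^sup>2 * \<phi> h" using \<delta>(2)[OF False h] by (intro mult_left_mono) auto
        ultimately show ?thesis using 1 by (simp add: G_def power2_eq_square algebra_simps)
      qed simp
      then show ?thesis using \<delta>(1) by blast
    qed
    from local_support_imp_midpoint_le[OF contG this] show ?thesis by (simp add: G_def field_simps)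
  qed
  then have *: "k \<le> (N 1 powr q + N (-1) powr q) / 2 - N 0 powr q" if "0 \<le> k" "k < (p - 1) * \<nu>" for k
    using that by (simp add: algebra_simps)
  have "(p - 1) * \<nu> \<le> (N 1 powr q + N (-1) powr q) / 2 - N 0 powr q"
  proof (rule dense_le_bounded[of 0])
    show "0 < (p - 1) * \<nu>" using p \<nu> by simp
  qed (use * in auto)
  then show ?thesis unfolding q_def by linarith
next
  case True
  define q where "q = 2 / p"
  have q: "1 < q" "q \<le> 2" using p by (auto simp: q_def field_simps)
  obtain m where m: "\<And>h. N (0 + h) - N 0 - h * m \<ge> 0" using supp[of 0] by blast
  have "N 0 powr q \<le> (N 1 powr q + N (-1) powr q) / 2"
  proof (cases "N 0 = 0")
    case False
    then have pos: "N 0 > 0" using N0[of 0] by simp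
    have "0 \<le> q * N 0 powr (q - 1) * (N 1 + N (-1) - 2 * N 0)"
      using m[of 1] m[of "-1"] q by (intro mult_nonneg_nonneg) auto
    then show ?thesis
      using powr_tangent[OF q pos N0[of 1]] powr_tangent[OF q pos N0[of "-1"]] by (simp add: algebra_simps)
  qed simp
  then show ?thesis using True by (simp add: q_def)
qed

section \<open>Optimal 2-uniform convexity of the Schatten norm\<close>

lemma mult_adjoint_diagonal:
  assumes "A \<in> carrier_mat n n" "i < n"
  shows "Re ((A * mat_adjoint A) $$ (i, i)) = (\<Sum>j<n. (cmod (A $$ (i, j)))\<^sup>2)"
  using assms
  by (simp add: mult_mat_index[of A n n "mat_adjoint A" n] mat_adjoint_index cmod_power2
      power2_eq_square[of "Re _"] power2_eq_square[of "Im _"] del: index_mult_mat)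

lemma unitary_row_norm:
  assumes "unitary_mat n U" "i < n"
  shows "(\<Sum>j<n. (cmod (U $$ (i, j)))\<^sup>2) = 1"
  using mult_adjoint_diagonal[OF unitary_carrier[OF assms(1)] assms(2)] unitary_mat_right[OF assms(1)] assms(2)
  by simp

lemma unitary_col_norm:
  assumes "unitary_mat n U" "j < n"
  shows "(\<Sum>i<n. (cmod (U $$ (i, j)))\<^sup>2) = 1"
proof -
  have "(\<Sum>i<n. (cmod (mat_adjoint U $$ (j, i)))\<^sup>2) = 1"
    by (rule unitary_row_norm[OF unitary_adjoint[OF assms(1)] assms(2)])
  then show ?thesis using unitary_carrier[OF assms(1)] assms(2) by (simp add: mat_adjoint_index)
qed

lemma conj_real_diag_diagonal:
  assumes "E \<in> carrier_mat n n" "i < n"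
  shows "Re ((E * real_diag n d * mat_adjoint E) $$ (i, i)) = (\<Sum>l<n. (cmod (E $$ (i, l)))\<^sup>2 * d l)"
  using assms
  by (simp add: real_diag_conj_index[of E n "mat_adjoint E"] mat_adjoint_index cmod_power2
      power2_eq_square[of "Re _"] power2_eq_square[of "Im _"] algebra_simps sum.distrib del: index_mult_mat)

text \<open>Let \<open>A\<close>, \<open>B\<close> and \<open>B - A\<close> be diagonalized by \<open>U\<close>, \<open>V\<close> and \<open>W\<close>. With \<open>E = U\<^sup>* W\<close> and \<open>F = W\<^sup>* V\<close>, the matrix
  \<open>E diag(k) F\<close> consists of the coefficients of \<open>K = W diag(k) W\<^sup>*\<close> between the eigenbases of \<open>A\<close> and \<open>B\<close>.
  Weights that depend on the row only, or on the column only, act on the squared coefficients as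
  the weights averaged over the eigenbasis \<open>W\<close>.\<close>

lemma mixed_row_sum:
  assumes E: "E \<in> carrier_mat n n" and F: "unitary_mat n F" and i: "i < n"
  shows "(\<Sum>j<n. (cmod ((E * real_diag n k * F) $$ (i, j)))\<^sup>2) = (\<Sum>l<n. (cmod (E $$ (i, l)))\<^sup>2 * (k l)\<^sup>2)"
proof -
  define M where "M = E * real_diag n k * F"
  have Fc: "F \<in> carrier_mat n n" by (rule unitary_carrier[OF F])
  have M: "M \<in> carrier_mat n n" using E Fc by (simp add: M_def)
  have "M * mat_adjoint M = E * (real_diag n k * real_diag n k) * mat_adjoint E"
    unfolding M_def using E Fc unitary_left_cancel(2)[OF F]
    by (simp add: mat_adjoint_mult[of _ n n _ n] mult_assoc_square[of _ n])
  then have diag: "Re ((M * mat_adjoint M) $$ (i, i)) = (\<Sum>l<n. (cmod (E $$ (i, l)))\<^sup>2 * (k l)\<^sup>2)"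
    using conj_real_diag_diagonal[OF E i] by (simp only: real_diag_mult power2_eq_square[of "k _"])
  show ?thesis using trans[OF sym[OF mult_adjoint_diagonal[OF M i]] diag] unfolding M_def .
qed

lemma mixed_col_sum:
  assumes E: "unitary_mat n E" and F: "F \<in> carrier_mat n n" and j: "j < n"
  shows "(\<Sum>i<n. (cmod ((E * real_diag n k * F) $$ (i, j)))\<^sup>2) = (\<Sum>l<n. (cmod (F $$ (l, j)))\<^sup>2 * (k l)\<^sup>2)"
proof -
  have Ec: "E \<in> carrier_mat n n" by (rule unitary_carrier[OF E])
  have adj: "mat_adjoint (E * real_diag n k * F) = mat_adjoint F * real_diag n k * mat_adjoint E"
    using Ec F by (simp add: mat_adjoint_mult[of _ n n _ n] mult_assoc_square[of _ n])
  have "(\<Sum>i<n. (cmod ((E * real_diag n k * F) $$ (i, j)))\<^sup>2)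
      = (\<Sum>i<n. (cmod ((mat_adjoint F * real_diag n k * mat_adjoint E) $$ (j, i)))\<^sup>2)"
    unfolding adj[symmetric] using Ec F j
    by (intro sum.cong) (auto simp: mat_adjoint_index simp del: index_mult_mat(1))
  also have "\<dots> = (\<Sum>l<n. (cmod (mat_adjoint F $$ (j, l)))\<^sup>2 * (k l)\<^sup>2)"
    using F j by (intro mixed_row_sum unitary_adjoint E) auto
  also have "\<dots> = (\<Sum>l<n. (cmod (F $$ (l, j)))\<^sup>2 * (k l)\<^sup>2)"
    using F j by (simp add: mat_adjoint_index)
  finally show ?thesis .
qed

text \<open>The \<open>l\<close>-th diagonal entry, in the eigenbasis of the increment, of \<open>(2 \<bar>A\<bar> + \<bar>B\<bar>) / 3\<close> when \<open>\<alpha>\<close> and \<open>\<beta>\<close>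
  are the absolute values of the eigenvalues of \<open>A\<close> and \<open>B\<close>.\<close>

definition avg_weight :: "nat \<Rightarrow> complex mat \<Rightarrow> complex mat \<Rightarrow> (nat \<Rightarrow> real) \<Rightarrow> (nat \<Rightarrow> real) \<Rightarrow> nat \<Rightarrow> real" where
  "avg_weight n E F \<alpha> \<beta> l = (2 * (\<Sum>i<n. (cmod (E $$ (i, l)))\<^sup>2 * \<alpha> i) + (\<Sum>j<n. (cmod (F $$ (l, j)))\<^sup>2 * \<beta> j)) / 3"

lemma mixed_weighted_sum:
  assumes E: "unitary_mat n E" and F: "unitary_mat n F"
  shows "(\<Sum>i<n. \<Sum>j<n. (cmod ((E * real_diag n k * F) $$ (i, j)))\<^sup>2 * ((2 * \<alpha> i + \<beta> j) / 3))
    = (\<Sum>l<n. (k l)\<^sup>2 * avg_weight n E F \<alpha> \<beta> l)"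
proof -
  define m where "m i j = (cmod ((E * real_diag n k * F) $$ (i, j)))\<^sup>2" for i j
  have row: "(\<Sum>j<n. m i j) = (\<Sum>l<n. (cmod (E $$ (i, l)))\<^sup>2 * (k l)\<^sup>2)" if "i < n" for i
    unfolding m_def by (rule mixed_row_sum[OF unitary_carrier[OF E] F that])
  have col: "(\<Sum>i<n. m i j) = (\<Sum>l<n. (cmod (F $$ (l, j)))\<^sup>2 * (k l)\<^sup>2)" if "j < n" for j
    unfolding m_def by (rule mixed_col_sum[OF E unitary_carrier[OF F] that])
  have "(\<Sum>i<n. \<Sum>j<n. m i j * ((2 * \<alpha> i + \<beta> j) / 3))
      = (2 * (\<Sum>i<n. \<alpha> i * (\<Sum>j<n. m i j)) + (\<Sum>i<n. \<Sum>j<n. m i j * \<beta> j)) / 3"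
    by (simp add: sum_distrib_left sum_divide_distrib algebra_simps add_divide_distrib sum.distrib)
  also have "(\<Sum>i<n. \<Sum>j<n. m i j * \<beta> j) = (\<Sum>j<n. \<beta> j * (\<Sum>i<n. m i j))"
    by (subst sum.swap) (simp add: sum_distrib_left mult.commute)
  also have "(\<Sum>i<n. \<alpha> i * (\<Sum>j<n. m i j)) = (\<Sum>i<n. \<Sum>l<n. (k l)\<^sup>2 * ((cmod (E $$ (i, l)))\<^sup>2 * \<alpha> i))"
    by (simp add: row sum_distrib_left ac_simps)
  also have "\<dots> = (\<Sum>l<n. (k l)\<^sup>2 * (\<Sum>i<n. (cmod (E $$ (i, l)))\<^sup>2 * \<alpha> i))"
    by (subst sum.swap) (simp add: sum_distrib_left)
  also have "(\<Sum>j<n. \<beta> j * (\<Sum>i<n. m i j)) = (\<Sum>j<n. \<Sum>l<n. (k l)\<^sup>2 * ((cmod (F $$ (l, j)))\<^sup>2 * \<beta> j))"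
    by (simp add: col sum_distrib_left ac_simps)
  also have "\<dots> = (\<Sum>l<n. (k l)\<^sup>2 * (\<Sum>j<n. (cmod (F $$ (l, j)))\<^sup>2 * \<beta> j))"
    by (subst sum.swap) (simp add: sum_distrib_left)
  finally show ?thesis
    by (simp add: m_def avg_weight_def sum_divide_distrib sum_distrib_left algebra_simps add_divide_distrib sum.distrib)
qed

lemma mixed_total_sum:
  assumes E: "unitary_mat n E" and F: "unitary_mat n F"
  shows "(\<Sum>i<n. \<Sum>j<n. (cmod ((E * real_diag n k * F) $$ (i, j)))\<^sup>2) = (\<Sum>l<n. (k l)\<^sup>2)"
proof -
  have "(\<Sum>i<n. \<Sum>j<n. (cmod ((E * real_diag n k * F) $$ (i, j)))\<^sup>2)
      = (\<Sum>i<n. \<Sum>l<n. (cmod (E $$ (i, l)))\<^sup>2 * (k l)\<^sup>2)"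
    using mixed_row_sum[OF unitary_carrier[OF E] F] by simp
  also have "\<dots> = (\<Sum>l<n. (\<Sum>i<n. (cmod (E $$ (i, l)))\<^sup>2) * (k l)\<^sup>2)"
    by (subst sum.swap) (simp add: sum_distrib_right)
  also have "\<dots> = (\<Sum>l<n. (k l)\<^sup>2)" using unitary_col_norm[OF E] by simp
  finally show ?thesis .
qed

lemma real_diag_conj_add:
  assumes "E \<in> carrier_mat n n" "F \<in> carrier_mat n n" "i < n" "j < n"
  shows "(E * real_diag n (\<lambda>l. k l + k' l) * F) $$ (i, j)
    = (E * real_diag n k * F) $$ (i, j) + (E * real_diag n k' * F) $$ (i, j)"
  using assms by (simp add: real_diag_conj_index algebra_simps sum.distrib del: index_mult_mat)

lemma half_powr_sq: "(x powr (e / 2))\<^sup>2 = x powr (e :: real)"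
  by (simp add: power2_eq_square field_sum_of_halves flip: powr_add)

text \<open>The parallel sum of \<open>s\<close> and \<open>u\<close> is the best constant in a splitting of \<open>z + w\<close> into two parts with the
  weights \<open>s\<close> and \<open>u\<close>; both sides are divided by \<open>u\<close>.\<close>

lemma parallel_sum_le:
  fixes z w :: complex and s u :: real
  assumes "s \<ge> 0" "u > 0"
  shows "(cmod (z + w))\<^sup>2 * (s / (s + u)) \<le> (cmod z)\<^sup>2 * s / u + (cmod w)\<^sup>2"
proof -
  define a b where "a = cmod z" and "b = cmod w"
  have "(cmod (z + w))\<^sup>2 \<le> (a + b)\<^sup>2"
    unfolding a_def b_def by (intro power_mono norm_triangle_ineq) auto
  then have "(cmod (z + w))\<^sup>2 * (s / (s + u)) \<le> (a + b)\<^sup>2 * (s / (s + u))"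
    using assms by (intro mult_right_mono) auto
  also have "\<dots> \<le> a\<^sup>2 * s / u + b\<^sup>2"
  proof -
    have "0 \<le> (s * a - u * b)\<^sup>2" by simp
    then have "(a + b)\<^sup>2 * s * u \<le> (a\<^sup>2 * s + b\<^sup>2 * u) * (s + u)"
      by (simp add: power2_eq_square algebra_simps)
    moreover have "a\<^sup>2 * s / u + b\<^sup>2 = (a\<^sup>2 * s + b\<^sup>2 * u) / u" using assms by (simp add: add_divide_distrib)
    ultimately show ?thesis using assms by (simp add: divide_simps mult.commute mult.left_commute)
  qed
  finally show ?thesis by (simp add: a_def b_def)
qed

text \<open>Operator concavity of \<open>s\<^sup>t\<close> in the form needed here: in a basis that diagonalizes \<open>K\<close> the
  weights may be averaged. For the resolvent functions \<open>s / (s + u)\<close> this is the variational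
  characterization of the parallel sum, tested on a splitting of \<open>K\<close> that is diagonal in that basis.\<close>

lemma mixed_powr_weight_le:
  assumes E: "unitary_mat n E" and F: "unitary_mat n F" and t: "0 < t" "t < 1"
    and \<alpha>: "\<And>i. \<alpha> i \<ge> 0" and \<beta>: "\<And>j. \<beta> j \<ge> 0"
  shows "(\<Sum>i<n. \<Sum>j<n. (cmod ((E * real_diag n k * F) $$ (i, j)))\<^sup>2 * ((2 * \<alpha> i + \<beta> j) / 3) powr t)
    \<le> (\<Sum>l<n. (k l)\<^sup>2 * avg_weight n E F \<alpha> \<beta> l powr t)"
proof -
  define C where "C = avg_weight n E F \<alpha> \<beta>"
  define s where "s i j = (2 * \<alpha> i + \<beta> j) / 3" for i j
  have C: "C l \<ge> 0" for l unfolding C_def avg_weight_def using \<alpha> \<beta> by (auto intro!: divide_nonneg_nonneg add_nonneg_nonneg mult_nonneg_nonneg sum_nonneg)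
  have s: "s i j \<ge> 0" for i j using \<alpha> \<beta> by (simp add: s_def)
  define M where "M k i j = (E * real_diag n k * F) $$ (i, j)" for k i j
  note weighted = mixed_weighted_sum[OF E F, of _ \<alpha> \<beta>, folded C_def s_def M_def]
  have "(\<Sum>x\<in>{..<n}\<times>{..<n}. (cmod (M k (fst x) (snd x)))\<^sup>2 * s (fst x) (snd x) powr t) \<le> (\<Sum>l<n. (k l)\<^sup>2 * C l powr t)"
  proof (rule powr_comparison_from_resolvents[OF t])
    fix u :: real assume u: "u > 0"
    \<comment> \<open>The splitting that is optimal for each \<open>l\<close> separately.\<close>
    define k1 where "k1 l = k l * (u / (C l + u))" for l
    define k2 where "k2 l = k l * (C l / (C l + u))" for l
    have k: "k = (\<lambda>l. k1 l + k2 l)"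
    proof
      fix l
      have "C l + u > 0" using C[of l] u by simp
      then have "u / (C l + u) + C l / (C l + u) = 1" by (simp flip: add_divide_distrib)
      then show "k l = k1 l + k2 l" unfolding k1_def k2_def by (metis distrib_left mult.right_neutral)
    qed
    have M: "M k i j = M k1 i j + M k2 i j" if "i < n" "j < n" for i j
      unfolding M_def by (subst k) (rule real_diag_conj_add[OF unitary_carrier[OF E] unitary_carrier[OF F] that])
    have "(\<Sum>x\<in>{..<n}\<times>{..<n}. (cmod (M k (fst x) (snd x)))\<^sup>2 * (s (fst x) (snd x) / (s (fst x) (snd x) + u)))
        = (\<Sum>i<n. \<Sum>j<n. (cmod (M k i j))\<^sup>2 * (s i j / (s i j + u)))"
      by (simp add: sum.cartesian_product case_prod_unfold)
    also have "\<dots> \<le> (\<Sum>i<n. \<Sum>j<n. (cmod (M k1 i j))\<^sup>2 * s i j / u + (cmod (M k2 i j))\<^sup>2)"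
      using parallel_sum_le[OF s u] M by (intro sum_mono) simp
    also have "\<dots> = (\<Sum>i<n. \<Sum>j<n. (cmod (M k1 i j))\<^sup>2 * s i j) / u + (\<Sum>i<n. \<Sum>j<n. (cmod (M k2 i j))\<^sup>2)"
      by (simp add: sum.distrib sum_divide_distrib)
    also have "\<dots> = (\<Sum>l<n. (k1 l)\<^sup>2 * C l) / u + (\<Sum>l<n. (k2 l)\<^sup>2)"
      unfolding weighted using mixed_total_sum[OF E F, of k2] by (simp add: M_def)
    also have "\<dots> = (\<Sum>l<n. (k l)\<^sup>2 * (C l / (C l + u)))"
      unfolding sum_divide_distrib sum.distrib[symmetric]
    proof (rule sum.cong[OF refl])
      fix l
      have pos: "C l + u > 0" using C[of l] u by simp
      have "(k1 l)\<^sup>2 * C l / u + (k2 l)\<^sup>2 = (k l)\<^sup>2 * (C l * (C l + u) / (C l + u)\<^sup>2)"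
        unfolding k1_def k2_def using u
        by (simp add: power_mult_distrib power_divide power2_eq_square[of u] power2_eq_square[of "C l"]
            algebra_simps add_divide_distrib)
      also have "C l * (C l + u) / (C l + u)\<^sup>2 = C l / (C l + u)"
        using pos by (simp add: power2_eq_square)
      finally show "(k1 l)\<^sup>2 * C l / u + (k2 l)\<^sup>2 = (k l)\<^sup>2 * (C l / (C l + u))" .
    qed
    finally show "(\<Sum>x\<in>{..<n}\<times>{..<n}. (cmod (M k (fst x) (snd x)))\<^sup>2 * (s (fst x) (snd x) / (s (fst x) (snd x) + u)))
        \<le> (\<Sum>l<n. (k l)\<^sup>2 * (C l / (C l + u)))" .
  qed (use s C in auto)
  then show ?thesis by (simp add: sum.cartesian_product case_prod_unfold M_def s_def C_def)
qed

text \<open>Duality: the Hermitian matrix \<open>K\<close> with eigenvalues \<open>sgn \<delta>\<^sub>l \<bar>\<delta>\<^sub>l\<bar>\<^sup>p\<^sup>-\<^sup>1\<close> in the eigenbasis of the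
  increment attains the \<open>p\<close>-norm of the increment in the trace pairing. The Cauchy-Schwarz inequality
  with the weights and their inverses separates the two matrices, and the preceding lemma and
  Hoelder's inequality bound the factor that belongs to \<open>K\<close>.\<close>

lemma mixed_powr_weight_ge:
  assumes E: "unitary_mat n E" and F: "unitary_mat n F" and p: "1 < p" "p < 2"
    and \<alpha>: "\<And>i. \<alpha> i \<ge> 0" and \<beta>: "\<And>j. \<beta> j \<ge> 0"
    and supp: "\<And>i j. i < n \<Longrightarrow> j < n \<Longrightarrow> 2 * \<alpha> i + \<beta> j = 0 \<Longrightarrow> (E * real_diag n d * F) $$ (i, j) = 0"
  shows "(\<Sum>l<n. \<bar>d l\<bar> powr p) powr (2 / p)
    \<le> (\<Sum>i<n. \<Sum>j<n. (cmod ((E * real_diag n d * F) $$ (i, j)))\<^sup>2 * ((2 * \<alpha> i + \<beta> j) / 3) powr (p - 2))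
      * ((2 * (\<Sum>i<n. \<alpha> i powr p) + (\<Sum>j<n. \<beta> j powr p)) / 3) powr ((2 - p) / p)"
proof -
  define C where "C = avg_weight n E F \<alpha> \<beta>"
  have C: "C l \<ge> 0" for l unfolding C_def avg_weight_def using \<alpha> \<beta> by (auto intro!: divide_nonneg_nonneg add_nonneg_nonneg mult_nonneg_nonneg sum_nonneg)
  define s where "s i j = (2 * \<alpha> i + \<beta> j) / 3" for i j
  have s: "s i j \<ge> 0" for i j using \<alpha> \<beta> by (simp add: s_def)
  define R where "R = (2 * (\<Sum>i<n. \<alpha> i powr p) + (\<Sum>j<n. \<beta> j powr p)) / 3"
  define t where "t = (2 - p) / p"
  have t: "0 < t" "t < 1" "1 + t = 2 / p" using p by (auto simp: t_def field_simps)
  \<comment> \<open>The dual element of \<open>d\<close>.\<close>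
  define k where "k l = sgn (d l) * \<bar>d l\<bar> powr (p - 1)" for l
  define N where "N = (\<Sum>l<n. \<bar>d l\<bar> powr p)"
  have N0: "N \<ge> 0" unfolding N_def by (intro sum_nonneg) auto
  define M where "M k i j = (E * real_diag n k * F) $$ (i, j)" for k i j
  define Q where "Q = (\<Sum>i<n. \<Sum>j<n. (cmod (M d i j))\<^sup>2 * s i j powr (p - 2))"
  define P where "P = {..<n} \<times> {..<n}"
  define f where "f x = (case x of (i, j) \<Rightarrow> cmod (M d i j) * s i j powr (- ((2 - p) / 2)))" for x
  define g where "g x = (case x of (i, j) \<Rightarrow> cmod (M k i j) * s i j powr ((2 - p) / 2))" for x
  have total: "(\<Sum>i<n. \<Sum>j<n. (cmod (M k i j))\<^sup>2) = (\<Sum>l<n. (k l)\<^sup>2)" for k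
    unfolding M_def by (rule mixed_total_sum[OF E F])
  have kd: "k l * d l = \<bar>d l\<bar> powr p" for l
  proof -
    have "k l * d l = \<bar>d l\<bar> powr (p - 1) * \<bar>d l\<bar>" by (simp add: k_def abs_sgn mult.commute mult.left_commute)
    also have "\<dots> = \<bar>d l\<bar> powr p" using p by (cases "d l = 0") (auto simp: powr_diff)
    finally show ?thesis .
  qed
  \<comment> \<open>The change of bases preserves the inner product of \<open>d\<close> and \<open>k\<close>, by polarization of \<open>total\<close>.\<close>
  have inner: "(\<Sum>i<n. \<Sum>j<n. Re (cnj (M d i j) * M k i j)) = N"
  proof -
    have M: "M (\<lambda>l. d l + k l) i j = M d i j + M k i j" if "i < n" "j < n" for i j
      unfolding M_def by (rule real_diag_conj_add[OF unitary_carrier[OF E] unitary_carrier[OF F] that])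
    have sq: "(cmod (z + w))\<^sup>2 = (cmod z)\<^sup>2 + (cmod w)\<^sup>2 + 2 * Re (cnj z * w)" for z w :: complex
      unfolding cmod_power2 by (simp add: power2_eq_square algebra_simps)
    have "(\<Sum>l<n. (d l + k l)\<^sup>2) = (\<Sum>i<n. \<Sum>j<n. (cmod (M d i j + M k i j))\<^sup>2)"
      using total[of "\<lambda>l. d l + k l"] M by simp
    also have "\<dots> = (\<Sum>l<n. (d l)\<^sup>2) + (\<Sum>l<n. (k l)\<^sup>2) + 2 * (\<Sum>i<n. \<Sum>j<n. Re (cnj (M d i j) * M k i j))"
      unfolding sq sum.distrib total sum_distrib_left ..
    finally have "(\<Sum>l<n. (d l + k l)\<^sup>2)
      = (\<Sum>l<n. (d l)\<^sup>2) + (\<Sum>l<n. (k l)\<^sup>2) + 2 * (\<Sum>i<n. \<Sum>j<n. Re (cnj (M d i j) * M k i j))" .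
    moreover have "(\<Sum>l<n. (d l + k l)\<^sup>2) = (\<Sum>l<n. (d l)\<^sup>2) + (\<Sum>l<n. (k l)\<^sup>2) + 2 * N"
      unfolding N_def kd[symmetric] by (simp add: power2_sum sum.distrib sum_distrib_left ac_simps)
    ultimately show ?thesis by linarith
  qed
  have k2: "(k l)\<^sup>2 = (\<bar>d l\<bar> powr p) powr (1 - t)" for l
  proof -
    have "(k l)\<^sup>2 = (\<bar>d l\<bar> powr (p - 1))\<^sup>2" by (cases "d l = 0") (auto simp: k_def power_mult_distrib sgn_if)
    also have "\<dots> = \<bar>d l\<bar> powr ((p - 1) * 2)"
      by (cases "d l = 0") (auto simp: powr_powr simp flip: powr_numeral)
    also have "(p - 1) * 2 = p * (1 - t)" using p by (simp add: t_def field_simps)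
    finally show ?thesis by (simp add: powr_powr)
  qed
  have Y: "(\<Sum>x\<in>P. (g x)\<^sup>2) \<le> N powr (1 - t) * R powr t"
  proof -
    have "(s i j powr ((2 - p) / 2))\<^sup>2 = s i j powr (2 - p)" for i j by (rule half_powr_sq)
    then have "(\<Sum>x\<in>P. (g x)\<^sup>2)
        = (\<Sum>i<n. \<Sum>j<n. (cmod (M k i j))\<^sup>2 * s i j powr (2 - p))"
      by (simp add: P_def g_def sum.cartesian_product case_prod_unfold power_mult_distrib)
    also have "\<dots> \<le> (\<Sum>l<n. (k l)\<^sup>2 * C l powr (2 - p))"
      unfolding M_def s_def C_def using p by (intro mixed_powr_weight_le E F \<alpha> \<beta>) auto
    also have "\<dots> = (\<Sum>l<n. (\<bar>d l\<bar> powr p) powr (1 - t) * (C l powr p) powr t)"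
      using p by (simp add: k2 powr_powr t_def)
    also have "\<dots> \<le> N powr (1 - t) * (\<Sum>l<n. C l powr p) powr t"
      unfolding N_def by (intro holder_sum t) auto
    also have "\<dots> \<le> N powr (1 - t) * R powr t"
    proof -
      have "(\<Sum>l<n. C l powr p) \<le> (\<Sum>l<n. (2 * (\<Sum>i<n. (cmod (E $$ (i, l)))\<^sup>2 * \<alpha> i powr p)
          + (\<Sum>j<n. (cmod (F $$ (l, j)))\<^sup>2 * \<beta> j powr p)) / 3)"
      proof (rule sum_mono)
        fix l assume "l \<in> {..<n}"
        then have l: "l < n" by simp
        define x where "x = (\<Sum>i<n. (cmod (E $$ (i, l)))\<^sup>2 * \<alpha> i)"
        define y where "y = (\<Sum>j<n. (cmod (F $$ (l, j)))\<^sup>2 * \<beta> j)"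
        have xy: "x \<ge> 0" "y \<ge> 0" using \<alpha> \<beta> by (auto simp: x_def y_def intro!: sum_nonneg)
        have "C l = (\<Sum>i<2::nat. (if i = 0 then 2 / 3 else 1 / 3) * (if i = 0 then x else y))"
          by (simp add: C_def avg_weight_def x_def y_def numeral_2_eq_2)
        then have "C l powr p \<le> (\<Sum>i<2::nat. (if i = 0 then 2 / 3 else 1 / 3) * (if i = 0 then x else y) powr p)"
          using p xy powr_jensen[of p 2 "\<lambda>i. if i = 0 then 2 / 3 else 1 / 3" "\<lambda>i. if i = 0 then x else y"]
          by (simp add: numeral_2_eq_2)
        also have "\<dots> = (2 * x powr p + y powr p) / 3" by (simp add: numeral_2_eq_2)
        also have "\<dots> \<le> (2 * (\<Sum>i<n. (cmod (E $$ (i, l)))\<^sup>2 * \<alpha> i powr p) + (\<Sum>j<n. (cmod (F $$ (l, j)))\<^sup>2 * \<beta> j powr p)) / 3"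
        proof -
          have "x powr p \<le> (\<Sum>i<n. (cmod (E $$ (i, l)))\<^sup>2 * \<alpha> i powr p)"
            unfolding x_def using p \<alpha> unitary_col_norm[OF E l] by (intro powr_jensen) auto
          moreover have "y powr p \<le> (\<Sum>j<n. (cmod (F $$ (l, j)))\<^sup>2 * \<beta> j powr p)"
            unfolding y_def using p \<beta> unitary_row_norm[OF F l] by (intro powr_jensen) auto
          ultimately show ?thesis by simp
        qed
        finally show "C l powr p \<le> (2 * (\<Sum>i<n. (cmod (E $$ (i, l)))\<^sup>2 * \<alpha> i powr p)
          + (\<Sum>j<n. (cmod (F $$ (l, j)))\<^sup>2 * \<beta> j powr p)) / 3" .
      qed
      also have "\<dots> = (2 * (\<Sum>l<n. \<Sum>i<n. (cmod (E $$ (i, l)))\<^sup>2 * \<alpha> i powr p)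
          + (\<Sum>l<n. \<Sum>j<n. (cmod (F $$ (l, j)))\<^sup>2 * \<beta> j powr p)) / 3"
        by (simp add: sum_divide_distrib[symmetric] sum.distrib sum_distrib_left)
      also have "(\<Sum>l<n. \<Sum>i<n. (cmod (E $$ (i, l)))\<^sup>2 * \<alpha> i powr p) = (\<Sum>i<n. \<alpha> i powr p)"
        by (subst sum.swap) (simp add: unitary_row_norm[OF E] flip: sum_distrib_right)
      also have "(\<Sum>l<n. \<Sum>j<n. (cmod (F $$ (l, j)))\<^sup>2 * \<beta> j powr p) = (\<Sum>j<n. \<beta> j powr p)"
        by (subst sum.swap) (simp add: unitary_col_norm[OF F] flip: sum_distrib_right)
      finally have "(\<Sum>l<n. C l powr p) \<le> R" by (simp add: R_def)
      then show ?thesis using t by (intro mult_left_mono powr_mono2) (auto intro!: sum_nonneg)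
    qed
    finally show ?thesis .
  qed
  have X: "(\<Sum>x\<in>P. (f x)\<^sup>2) = Q"
  proof -
    have "- ((2 - p) / 2) = (p - 2) / 2" by (simp only: minus_divide_left minus_diff_eq)
    then have "(s i j powr (- ((2 - p) / 2)))\<^sup>2 = s i j powr (p - 2)" for i j by (simp only: half_powr_sq)
    then show ?thesis
      by (simp add: P_def Q_def f_def sum.cartesian_product case_prod_unfold power_mult_distrib)
  qed
  have "N \<le> (\<Sum>x\<in>P. f x * g x)"
  proof -
    have "N = (\<Sum>x\<in>P. Re (cnj (M d (fst x) (snd x)) * M k (fst x) (snd x)))"
      unfolding inner[symmetric] by (simp add: P_def sum.cartesian_product case_prod_unfold)
    also have "\<dots> \<le> (\<Sum>x\<in>P. f x * g x)"
    proof (rule sum_mono)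
      fix x assume "x \<in> P"
      then obtain i j where x: "x = (i, j)" "i < n" "j < n" by (auto simp: P_def)
      have re: "Re (cnj (M d i j) * M k i j) \<le> cmod (M d i j) * cmod (M k i j)"
        using complex_Re_le_cmod[of "cnj (M d i j) * M k i j"] by (simp add: norm_mult)
      show "Re (cnj (M d (fst x) (snd x)) * M k (fst x) (snd x)) \<le> f x * g x"
      \<comment> \<open>A negative power of a vanishing weight is read as \<open>0\<close>; there the coefficient vanishes as well.\<close>
      proof (cases "s i j = 0")
        case True
        then have "M d i j = 0" using supp[OF x(2,3)] by (simp add: s_def M_def)
        then show ?thesis using x by (simp add: f_def)
      next
        case False
        then have one: "s i j powr (- ((2 - p) / 2)) * s i j powr ((2 - p) / 2) = 1"
          using s[of i j] by (simp flip: powr_add)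
        have "(x * y) * (z * w) = (x * z) * (y * w)" for x y z w :: real by (simp only: ac_simps)
        then have cancel: "(cmod (M d i j) * s i j powr (- ((2 - p) / 2))) * (cmod (M k i j) * s i j powr ((2 - p) / 2))
            = cmod (M d i j) * cmod (M k i j)"
          by (simp only: one mult_1_right)
        show ?thesis unfolding f_def g_def x(1) fst_conv snd_conv prod.case cancel by (rule re)
      qed
    qed
    finally show ?thesis .
  qed
  then have "N\<^sup>2 \<le> (\<Sum>x\<in>P. f x * g x)\<^sup>2"
    using N0 by (intro power_mono)
  also have "\<dots> \<le> Q * (\<Sum>x\<in>P. (g x)\<^sup>2)"
    unfolding X[symmetric] by (rule Cauchy_Schwarz_ineq_sum)
  also have Q0: "Q \<ge> 0" unfolding Q_def by (intro sum_nonneg) auto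
  then have "Q * (\<Sum>x\<in>P. (g x)\<^sup>2)
      \<le> Q * (N powr (1 - t) * R powr t)" by (intro mult_left_mono Y)
  finally have main: "N\<^sup>2 \<le> Q * (N powr (1 - t) * R powr t)" .
  have "N powr (2 / p) \<le> Q * R powr t"
  proof (cases "N = 0")
    case False
    then have N: "N > 0" using N0 by simp
    have "N powr (2 / p) * N powr (1 - t) = N powr (1 + t + (1 - t))" unfolding t(3)[symmetric] by (simp only: powr_add)
    also have "\<dots> = N\<^sup>2" using N by (simp flip: powr_numeral)
    also have "\<dots> \<le> Q * R powr t * N powr (1 - t)" using main by (simp add: ac_simps)
    finally show ?thesis using N by simp
  qed (use Q0 in simp)
  then show ?thesis unfolding N_def Q_def R_def t_def M_def s_def .
qed

lemma abs_powr_two_div: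
  fixes h p :: real
  assumes "p > 0"
  shows "(\<bar>h\<bar> powr p) powr (2 / p) = h\<^sup>2"
  using assms by (cases "h = 0") (auto simp: powr_powr)

text \<open>Klein's identity expresses the second-order gap of the trace function \<open>A \<mapsto> \<Sum>\<bar>\<lambda>\<^sub>i(A)\<bar>\<^sup>p\<close>
  through the scalar gaps between the eigenvalues of \<open>A\<close> and of \<open>A + h X\<close>, with the weights
  \<open>\<bar>(U\<^sup>* V)\<^sub>i\<^sub>j\<bar>\<^sup>2\<close>; the increment \<open>h X\<close> has the entries \<open>(b\<^sub>j - a\<^sub>i) (U\<^sup>* V)\<^sub>i\<^sub>j\<close> in these mixed bases.\<close>

lemma pow_sum_second_order:
  assumes p: "1 < p" "p < 2" and A: "herm n A" and X: "herm n X"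
  shows "\<exists>m. \<forall>h. pow_sum p (A + of_real h \<cdot>\<^sub>m X) - pow_sum p A - h * m \<ge> 0 \<and>
    (pow_sum p (A + of_real h \<cdot>\<^sub>m X) - pow_sum p A - h * m)
      * ((2 * pow_sum p A + pow_sum p (A + of_real h \<cdot>\<^sub>m X)) / 3) powr ((2 - p) / p)
    \<ge> p * (p - 1) / 2 * h\<^sup>2 * pow_sum p X powr (2 / p)"
proof -
  obtain U a where a: "eigen_dec n U a A" using spectral_theorem[OF A] by blast
  have U: "unitary_mat n U" and Uc: "U \<in> carrier_mat n n" using a by (auto simp: eigen_dec_def unitary_carrier)
  note Ac = herm_carrier[OF A] and Xc = herm_carrier[OF X]
  define m where "m = (\<Sum>i<n. abs_powr_deriv p (a i) * Re ((mat_adjoint U * X * U) $$ (i, i)))"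
  have "pow_sum p (A + of_real h \<cdot>\<^sub>m X) - pow_sum p A - h * m \<ge> 0 \<and>
    (pow_sum p (A + of_real h \<cdot>\<^sub>m X) - pow_sum p A - h * m)
      * ((2 * pow_sum p A + pow_sum p (A + of_real h \<cdot>\<^sub>m X)) / 3) powr ((2 - p) / p)
    \<ge> p * (p - 1) / 2 * h\<^sup>2 * pow_sum p X powr (2 / p)" for h
  proof -
    define D where "D = complex_of_real h \<cdot>\<^sub>m X"
    define B where "B = A + D"
    have D: "herm n D" unfolding D_def by (rule herm_smult[OF X])
    have B: "herm n B" unfolding B_def by (rule herm_add[OF A D])
    note Dc = herm_carrier[OF D] and Bc = herm_carrier[OF B]
    obtain V b where b: "eigen_dec n V b B" using spectral_theorem[OF B] by blast
    obtain W d where d: "eigen_dec n W d D" using spectral_theorem[OF D] by blast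
    have V: "unitary_mat n V" and Vc: "V \<in> carrier_mat n n" using b by (auto simp: eigen_dec_def unitary_carrier)
    have W: "unitary_mat n W" and Wc: "W \<in> carrier_mat n n" using d by (auto simp: eigen_dec_def unitary_carrier)
    define G where "G = mat_adjoint U * V"
    define E where "E = mat_adjoint U * W"
    define F where "F = mat_adjoint W * V"
    have G: "unitary_mat n G" and E: "unitary_mat n E" and F: "unitary_mat n F"
      unfolding G_def E_def F_def by (intro unitary_mult unitary_adjoint U V W)+
    have Gc: "G \<in> carrier_mat n n" by (rule unitary_carrier[OF G])
    define c where "c i j = (cmod (G $$ (i, j)))\<^sup>2" for i j
    have c_row: "(\<Sum>j<n. c i j) = 1" if "i < n" for i unfolding c_def by (rule unitary_row_norm[OF G that])
    have c_col: "(\<Sum>i<n. c i j) = 1" if "j < n" for j unfolding c_def by (rule unitary_col_norm[OF G that])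
    have mixed: "E * real_diag n d * F = mat_adjoint U * D * V"
      unfolding E_def F_def using d Uc Vc Wc
      by (simp add: eigen_dec_def mult_assoc_square[of _ n])
    have entry: "(E * real_diag n d * F) $$ (i, j) = of_real (b j - a i) * G $$ (i, j)" if ij: "i < n" "j < n" for i j
    proof -
      have DBA: "D = B - A" unfolding B_def using Ac Dc by (intro eq_matI) auto
      have 1: "mat_adjoint U * B * V = G * real_diag n b"
        using b Uc Vc unitary_left[OF V]
        by (simp add: eigen_dec_def G_def mult_assoc_square[of _ n])
      have 2: "mat_adjoint U * A * V = real_diag n a * G"
        using a Uc Vc unitary_left_cancel(1)[OF U]
        by (simp add: eigen_dec_def G_def mult_assoc_square[of _ n])
      have "mat_adjoint U * D * V = G * real_diag n b - real_diag n a * G"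
        unfolding 1[symmetric] 2[symmetric] DBA using Ac Bc Uc Vc
        by (simp add: mult_minus_distrib_mat[of _ n n _ n] minus_mult_distrib_mat[of _ n n _ _ n])
      then show ?thesis
        unfolding mixed using ij Gc real_diag_mult_index[OF Gc ij]
        by (simp add: algebra_simps del: index_mult_mat(1))
    qed
    have lin: "h * m = (\<Sum>i<n. \<Sum>j<n. c i j * (abs_powr_deriv p (a i) * (b j - a i)))"
    proof -
      have "h * Re ((mat_adjoint U * X * U) $$ (i, i)) = (\<Sum>j<n. c i j * (b j - a i))" if i: "i < n" for i
      proof -
        have "h * Re ((mat_adjoint U * X * U) $$ (i, i)) = Re ((mat_adjoint U * D * U) $$ (i, i))"
          unfolding D_def using Uc Xc i
          by (simp add: mult_smult_distrib[of _ n n _ n] mult_smult_assoc_mat[of _ n n _ n] del: index_mult_mat(1))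
        also have "\<dots> = Re ((mat_adjoint U * B * U) $$ (i, i)) - a i"
        proof -
          have "mat_adjoint U * B * U = real_diag n a + mat_adjoint U * D * U"
            unfolding B_def unitary_conj_add[OF Uc Ac Dc] eigen_dec_diagonalize[OF a] ..
          then show ?thesis using i Uc Dc by (simp add: real_diag_index del: index_mult_mat(1))
        qed
        also have "mat_adjoint U * B * U = G * real_diag n b * mat_adjoint G"
          unfolding G_def using b Uc Vc by (simp add: eigen_dec_def mat_adjoint_mult[of _ n n _ n] mult_assoc_square[of _ n])
        also have "Re ((G * real_diag n b * mat_adjoint G) $$ (i, i)) - a i = (\<Sum>j<n. c i j * b j) - (\<Sum>j<n. c i j) * a i"
          unfolding conj_real_diag_diagonal[OF Gc i] c_row[OF i] by (simp add: c_def)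
        also have "\<dots> = (\<Sum>j<n. c i j * (b j - a i))"
          by (simp add: right_diff_distrib sum_subtractf sum_distrib_right)
        finally show ?thesis .
      qed
      note row = this
      have "h * m = (\<Sum>i<n. abs_powr_deriv p (a i) * (h * Re ((mat_adjoint U * X * U) $$ (i, i))))"
        unfolding m_def by (simp add: sum_distrib_left ac_simps del: index_mult_mat(1))
      also have "\<dots> = (\<Sum>i<n. abs_powr_deriv p (a i) * (\<Sum>j<n. c i j * (b j - a i)))"
        by (intro sum.cong refl) (simp only: row lessThan_iff)
      also have "\<dots> = (\<Sum>i<n. \<Sum>j<n. c i j * (abs_powr_deriv p (a i) * (b j - a i)))"
        by (simp add: sum_distrib_left ac_simps)
      finally show ?thesis .
    qed
    define s where "s i j = (2 * \<bar>a i\<bar> + \<bar>b j\<bar>) / 3" for i j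
    define Q where "Q = (\<Sum>i<n. \<Sum>j<n. (cmod ((E * real_diag n d * F) $$ (i, j)))\<^sup>2 * s i j powr (p - 2))"
    have Q0: "Q \<ge> 0" unfolding Q_def by (intro sum_nonneg) auto
    \<comment> \<open>Rows and columns of \<open>c\<close> sum to \<open>1\<close>, so all three terms are double sums with the weights \<open>c\<close>.\<close>
    have klein: "pow_sum p B - pow_sum p A - h * m
      = (\<Sum>i<n. \<Sum>j<n. c i j * (\<bar>b j\<bar> powr p - \<bar>a i\<bar> powr p - abs_powr_deriv p (a i) * (b j - a i)))"
    proof -
      have "pow_sum p B = (\<Sum>j<n. (\<Sum>i<n. c i j) * \<bar>b j\<bar> powr p)"
        unfolding pow_sum_eigen[OF b] by (simp add: c_col)
      also have "\<dots> = (\<Sum>i<n. \<Sum>j<n. c i j * \<bar>b j\<bar> powr p)"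
        by (subst sum.swap) (simp add: sum_distrib_right)
      finally have 1: "pow_sum p B = (\<Sum>i<n. \<Sum>j<n. c i j * \<bar>b j\<bar> powr p)" .
      have "pow_sum p A = (\<Sum>i<n. (\<Sum>j<n. c i j) * \<bar>a i\<bar> powr p)"
        unfolding pow_sum_eigen[OF a] by (simp add: c_row)
      then have 2: "pow_sum p A = (\<Sum>i<n. \<Sum>j<n. c i j * \<bar>a i\<bar> powr p)"
        by (simp add: sum_distrib_right)
      show ?thesis unfolding 1 2 lin by (simp add: sum_subtractf right_diff_distrib)
    qed
    also have "\<dots> \<ge> (\<Sum>i<n. \<Sum>j<n. p * (p - 1) / 2 * ((cmod ((E * real_diag n d * F) $$ (i, j)))\<^sup>2 * s i j powr (p - 2)))"
    proof (intro sum_mono)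
      fix i j assume "i \<in> {..<n}" "j \<in> {..<n}"
      then have ij: "i < n" "j < n" by auto
      have sq: "(cmod ((E * real_diag n d * F) $$ (i, j)))\<^sup>2 = c i j * (b j - a i)\<^sup>2"
        unfolding entry[OF ij] c_def norm_mult power_mult_distrib norm_of_real by (simp add: mult.commute)
      have "c i j * (p * (p - 1) / 2 * (b j - a i)\<^sup>2 * s i j powr (p - 2))
          \<le> c i j * (\<bar>b j\<bar> powr p - \<bar>a i\<bar> powr p - abs_powr_deriv p (a i) * (b j - a i))"
        unfolding s_def using p by (intro mult_left_mono abs_powr_gap) (auto simp: c_def)
      then show "p * (p - 1) / 2 * ((cmod ((E * real_diag n d * F) $$ (i, j)))\<^sup>2 * s i j powr (p - 2))
          \<le> c i j * (\<bar>b j\<bar> powr p - \<bar>a i\<bar> powr p - abs_powr_deriv p (a i) * (b j - a i))"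
        unfolding sq by (simp only: ac_simps)
    qed
    finally have gap: "pow_sum p B - pow_sum p A - h * m \<ge> p * (p - 1) / 2 * Q"
      unfolding Q_def by (simp only: sum_distrib_left)
    define R where "R = ((2 * pow_sum p A + pow_sum p B) / 3) powr ((2 - p) / p)"
    have R0: "R \<ge> 0" by (simp add: R_def)
    have "pow_sum p D powr (2 / p) \<le> Q * R"
      unfolding pow_sum_eigen[OF d] Q_def s_def R_def pow_sum_eigen[OF a] pow_sum_eigen[OF b]
    proof (rule mixed_powr_weight_ge[OF E F p])
      fix i j assume ij: "i < n" "j < n" and "2 * \<bar>a i\<bar> + \<bar>b j\<bar> = 0"
      then have "a i = 0" "b j = 0" by auto
      then show "(E * real_diag n d * F) $$ (i, j) = 0" unfolding entry[OF ij] by simp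
    qed auto
    moreover have "pow_sum p D powr (2 / p) = h\<^sup>2 * pow_sum p X powr (2 / p)"
    proof -
      have "(\<bar>h\<bar> powr p) powr (2 / p) = h\<^sup>2" using p by (intro abs_powr_two_div) auto
      then show ?thesis unfolding D_def pow_sum_smult[OF X] using pow_sum_nonneg[OF X] by (simp add: powr_mult)
    qed
    ultimately have "p * (p - 1) / 2 * (h\<^sup>2 * pow_sum p X powr (2 / p)) \<le> p * (p - 1) / 2 * (Q * R)"
      using p by (intro mult_left_mono) auto
    also have "\<dots> \<le> (pow_sum p B - pow_sum p A - h * m) * R"
      using mult_right_mono[OF gap R0] by (simp add: mult.assoc)
    finally have "p * (p - 1) / 2 * h\<^sup>2 * pow_sum p X powr (2 / p) \<le> (pow_sum p B - pow_sum p A - h * m) * R"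
      by (simp add: mult.assoc)
    moreover have "pow_sum p B - pow_sum p A - h * m \<ge> 0"
    proof -
      have "0 \<le> p * (p - 1) / 2 * Q" using p Q0 by (intro mult_nonneg_nonneg) auto
      then show ?thesis using gap by (rule order_trans)
    qed
    ultimately show ?thesis unfolding B_def D_def R_def by blast
  qed
  then show ?thesis by blast
qed

lemma pow_sum_eq_0:
  assumes "herm n A" "pow_sum p A = 0"
  shows "A = 0\<^sub>m n n"
proof -
  obtain U d where U: "eigen_dec n U d A" using spectral_theorem[OF assms(1)] by blast
  have "\<forall>i<n. \<bar>d i\<bar> powr p = 0"
    using assms(2) unfolding pow_sum_eigen[OF U] by (simp add: sum_nonneg_eq_0_iff)
  then have "\<And>i. i < n \<Longrightarrow> d i = 0 * 1" by auto
  then have "eigen_dec n U (\<lambda>_. 0 * 1) A" using U eigen_dec_cong[of n d "\<lambda>_. 0 * 1" U A] by blast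
  moreover have "eigen_dec n U (\<lambda>_. 0 * 1) (of_real 0 \<cdot>\<^sub>m 1\<^sub>m n)"
    by (intro eigen_dec_smult eigen_dec_one eigen_dec_unitary[OF U])
  ultimately have "A = of_real 0 \<cdot>\<^sub>m 1\<^sub>m n" by (rule eigen_dec_unique)
  then show ?thesis by (auto intro!: eq_matI)
qed

lemma schatten_norm_sq:
  assumes "herm n X"
  shows "(schatten_norm p X)\<^sup>2 = pow_sum p X powr (2 / p)"
proof -
  have "(schatten_norm p X)\<^sup>2 = (pow_sum p X powr (1 / p)) powr 2"
    unfolding schatten_norm_herm[OF assms] by (cases "pow_sum p X = 0") auto
  then show ?thesis by (simp add: powr_powr)
qed

lemma schatten_norm_nonneg: "schatten_norm p X \<ge> 0"
  by (simp add: schatten_norm_def)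

lemma schatten_norm_pos:
  assumes "herm n X" "X \<noteq> 0\<^sub>m n n"
  shows "schatten_norm p X > 0"
  using pow_sum_eq_0[OF assms(1)] pow_sum_nonneg[OF assms(1), of p] assms
  by (auto simp: schatten_norm_herm less_le)

lemma pow_sum_2:
  assumes "herm n X"
  shows "pow_sum 2 X = tr (X * X)"
proof -
  obtain U d where U: "eigen_dec n U d X" using spectral_theorem[OF assms] by blast
  show ?thesis unfolding pow_sum_eigen[OF U] tr_eigen_dec[OF eigen_dec_mult[OF U U]]
    by (simp add: power2_eq_square)
qed

text \<open>For \<open>p = 2\<close> this is the parallelogram identity; for \<open>p < 2\<close> the bound to second order around every
  point of the line \<open>Z + t X\<close> is enough.\<close>

lemma schatten_two_uniform_convexity:
  assumes p: "1 < p" "p \<le> 2" and Z: "herm n Z" and X: "herm n X"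
  shows "((schatten_norm p (Z + X))\<^sup>2 + (schatten_norm p (Z - X))\<^sup>2) / 2
    \<ge> (schatten_norm p Z)\<^sup>2 + (p - 1) * (schatten_norm p X)\<^sup>2"
proof (cases "p = 2")
  case True
  note c = herm_carrier[OF Z] herm_carrier[OF X]
  have "pow_sum 2 (Z + X) + pow_sum 2 (Z - X) = 2 * pow_sum 2 Z + 2 * pow_sum 2 X"
    unfolding pow_sum_2[OF herm_add[OF Z X]] pow_sum_2[OF herm_minus[OF Z X]] pow_sum_2[OF Z] pow_sum_2[OF X]
    using c
    by (simp add: add_mult_distrib_mat[of _ n n _ _ n] mult_add_distrib_mat[of _ n n _ n]
        minus_mult_distrib_mat[of _ n n _ _ n] mult_minus_distrib_mat[of _ n n _ n] tr_add[of _ n] tr_minus[of _ n]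
        minus_carrier_mat)
  then show ?thesis
    unfolding schatten_norm_sq[OF herm_add[OF Z X]] schatten_norm_sq[OF herm_minus[OF Z X]]
      schatten_norm_sq[OF Z] schatten_norm_sq[OF X] True
    using pow_sum_nonneg[OF herm_add[OF Z X], of 2] pow_sum_nonneg[OF herm_minus[OF Z X], of 2]
      pow_sum_nonneg[OF Z, of 2] pow_sum_nonneg[OF X, of 2] by simp
next
  case False
  then have p': "p < 2" using p by simp
  define L where "L t = Z + complex_of_real t \<cdot>\<^sub>m X" for t
  have L: "herm n (L t)" for t unfolding L_def by (intro herm_add herm_smult Z X)
  have shift: "L (t + h) = L t + complex_of_real h \<cdot>\<^sub>m X" for t h
    unfolding L_def using herm_carrier[OF Z] herm_carrier[OF X] by (intro eq_matI) (auto simp: algebra_simps)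
  define N where "N t = pow_sum p (L t)" for t
  have "(N 1 powr (2 / p) + N (-1) powr (2 / p)) / 2 \<ge> N 0 powr (2 / p) + (p - 1) * pow_sum p X powr (2 / p)"
  proof (rule two_uniform_convexity_on_line[OF p(1) p'])
    fix t h assume "N t = 0"
    then have "L t = 0\<^sub>m n n" unfolding N_def using pow_sum_eq_0[OF L] by blast
    then have "L (t + h) = complex_of_real h \<cdot>\<^sub>m X" unfolding shift using herm_carrier[OF X] by simp
    then have "N (t + h) = \<bar>h\<bar> powr p * pow_sum p X" unfolding N_def by (simp add: pow_sum_smult[OF X])
    moreover have "(\<bar>h\<bar> powr p) powr (2 / p) = h\<^sup>2" using p by (intro abs_powr_two_div) auto
    ultimately show "N (t + h) powr (2 / p) = h\<^sup>2 * pow_sum p X powr (2 / p)"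
      using pow_sum_nonneg[OF X] by (simp add: powr_mult)
  next
    fix t
    show "\<exists>m. \<forall>h. N (t + h) - N t - h * m \<ge> 0 \<and> (N (t + h) - N t - h * m)
      * ((2 * N t + N (t + h)) / 3) powr ((2 - p) / p) \<ge> p * (p - 1) / 2 * h\<^sup>2 * pow_sum p X powr (2 / p)"
      unfolding N_def shift by (rule pow_sum_second_order[OF p(1) p' L X])
  qed (auto simp: N_def intro: pow_sum_nonneg[OF L])
  moreover have "L 1 = Z + X" "L (-1) = Z - X" "L 0 = Z"
    unfolding L_def using herm_carrier[OF Z] herm_carrier[OF X] by (auto intro!: eq_matI)
  ultimately show ?thesis
    unfolding N_def schatten_norm_sq[OF herm_add[OF Z X]] schatten_norm_sq[OF herm_minus[OF Z X]]
      schatten_norm_sq[OF Z] schatten_norm_sq[OF X] by simp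
qed

lemma pow_sum_dsum:
  assumes "herm n A" "herm n B"
  shows "pow_sum p (dsum n n A B) = pow_sum p A + pow_sum p B"
proof -
  obtain U d where U: "eigen_dec n U d A" using spectral_theorem[OF assms(1)] by blast
  obtain V e where V: "eigen_dec n V e B" using spectral_theorem[OF assms(2)] by blast
  have split: "(\<Sum>i<n + n. f i) = (\<Sum>i<n. f i) + (\<Sum>i<n. f (n + i))" for f :: "nat \<Rightarrow> real"
    using sum.nat_group[of f n 2] sum.atLeastLessThan_concat[of 0 n "n + n" f] sum.shift_bounds_nat_ivl[of f 0 n n]
    by (simp add: lessThan_atLeast0 add.commute)
  show ?thesis
    unfolding pow_sum_eigen[OF eigen_dec_dsum[OF U V]] pow_sum_eigen[OF U] pow_sum_eigen[OF V] split
    by simp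
qed

text \<open>Applied to \<open>Z \<oplus> Z\<close> and \<open>X \<oplus> -X\<close>, the inequality compares with the \<open>p\<close>-th power mean of
  \<open>\<parallel>Z + X\<parallel>\<close> and \<open>\<parallel>Z - X\<parallel>\<close>, which is smaller than their quadratic mean unless they agree.\<close>

lemma schatten_two_uniform_convexity_equality:
  assumes p: "1 < p" "p < 2" and Z: "herm n Z" and X: "herm n X"
    and eq: "((schatten_norm p (Z + X))\<^sup>2 + (schatten_norm p (Z - X))\<^sup>2) / 2
      = (schatten_norm p Z)\<^sup>2 + (p - 1) * (schatten_norm p X)\<^sup>2"
  shows "schatten_norm p (Z + X) = schatten_norm p (Z - X)"
proof -
  note c = herm_carrier[OF Z] herm_carrier[OF X]
  define X' where "X' = complex_of_real (-1) \<cdot>\<^sub>m X"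
  have X': "herm n X'" unfolding X'_def by (rule herm_smult[OF X])
  have c': "X' \<in> carrier_mat n n" by (rule herm_carrier[OF X'])
  have hd: "herm (n + n) (dsum n n A B)" if "herm n A" "herm n B" for A B
    using that unfolding herm_def by (simp add: dsum_carrier dsum_adjoint)
  define q where "q = 2 / p"
  have q: "1 < q" "q \<le> 2" using p by (auto simp: q_def field_simps)
  define x where "x = pow_sum p (Z + X)"
  define y where "y = pow_sum p (Z - X)"
  have xy: "x \<ge> 0" "y \<ge> 0" unfolding x_def y_def
    by (rule pow_sum_nonneg[OF herm_add[OF Z X]], rule pow_sum_nonneg[OF herm_minus[OF Z X]])
  have plus: "dsum n n Z Z + dsum n n X X' = dsum n n (Z + X) (Z - X)"
    using c c' by (subst dsum_add) (auto simp: X'_def intro!: arg_cong2[of _ _ _ _ "dsum n n"] eq_matI)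
  have minus: "dsum n n Z Z - dsum n n X X' = dsum n n (Z - X) (Z + X)"
    unfolding dsum_def X'_def using c by (intro eq_matI) auto
  have "pow_sum p X' = pow_sum p X" unfolding X'_def pow_sum_smult[OF X] by simp
  then have block: "(x + y) powr q \<ge> (2 * pow_sum p Z) powr q + (p - 1) * (2 * pow_sum p X) powr q"
    using schatten_two_uniform_convexity[OF p(1) _ hd[OF Z Z] hd[OF X X']] p
    unfolding plus minus schatten_norm_sq[OF hd[OF herm_add[OF Z X] herm_minus[OF Z X]]]
      schatten_norm_sq[OF hd[OF herm_minus[OF Z X] herm_add[OF Z X]]] schatten_norm_sq[OF hd[OF Z Z]]
      schatten_norm_sq[OF hd[OF X X']]
    by (simp add: pow_sum_dsum[OF herm_add[OF Z X] herm_minus[OF Z X]] pow_sum_dsum[OF herm_minus[OF Z X] herm_add[OF Z X]]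
        pow_sum_dsum[OF Z Z] pow_sum_dsum[OF X X'] x_def y_def q_def add.commute)
  have eq': "(x powr q + y powr q) / 2 = pow_sum p Z powr q + (p - 1) * pow_sum p X powr q"
    using eq unfolding schatten_norm_sq[OF herm_add[OF Z X]] schatten_norm_sq[OF herm_minus[OF Z X]]
      schatten_norm_sq[OF Z] schatten_norm_sq[OF X] x_def y_def q_def .
  have "x = y"
  proof (rule ccontr)
    assume ne: "x \<noteq> y"
    define w where "w = (x + y) / 2"
    have w: "w > 0" using ne xy by (auto simp: w_def)
    have "w \<noteq> x" "w \<noteq> y" using ne by (auto simp: w_def field_simps)
    then have "x powr q > w powr q + abs_powr_deriv q w * (x - w)" "y powr q > w powr q + abs_powr_deriv q w * (y - w)"
      using abs_powr_tangent_strict[OF q, of w x] abs_powr_tangent_strict[OF q, of w y] xy w by auto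
    moreover have "abs_powr_deriv q w * (x - w) + abs_powr_deriv q w * (y - w) = 0"
      by (simp add: w_def field_simps)
    ultimately have "2 powr q * w powr q < 2 powr q * ((x powr q + y powr q) / 2)" by simp
    moreover have "2 powr q * w powr q = (2 * w) powr q" using w by (simp add: powr_mult)
    moreover have "2 * w = x + y" by (simp add: w_def)
    moreover have "(2 * pow_sum p Z) powr q + (p - 1) * (2 * pow_sum p X) powr q
        = 2 powr q * (pow_sum p Z powr q + (p - 1) * pow_sum p X powr q)"
      using pow_sum_nonneg[OF Z, of p] pow_sum_nonneg[OF X, of p] by (simp add: powr_mult algebra_simps)
    ultimately show False using block eq' by simp
  qed
  then show ?thesis
    unfolding schatten_norm_herm[OF herm_add[OF Z X]] schatten_norm_herm[OF herm_minus[OF Z X]] x_def y_def by simp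
qed

text \<open>Equality at \<open>(Z, X)\<close> forces equality at \<open>(Z \<plusminus> X/2, X/2)\<close>, because the three inequalities for half
  the increment add up to the one for \<open>X\<close>. By the preceding lemma \<open>Z\<close>, \<open>Z + X\<close> and \<open>Z - X\<close> then have
  the same norm, and equality leaves no room for \<open>\<parallel>X\<parallel>\<close>.\<close>

lemma schatten_two_uniform_convexity_strict:
  assumes p: "1 < p" "p < 2" and Z: "herm n Z" and X: "herm n X" and X0: "X \<noteq> 0\<^sub>m n n"
  shows "((schatten_norm p (Z + X))\<^sup>2 + (schatten_norm p (Z - X))\<^sup>2) / 2
    > (schatten_norm p Z)\<^sup>2 + (p - 1) * (schatten_norm p X)\<^sup>2"
proof (rule ccontr)
  assume "\<not> ?thesis"
  then have eq: "((schatten_norm p (Z + X))\<^sup>2 + (schatten_norm p (Z - X))\<^sup>2) / 2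
    = (schatten_norm p Z)\<^sup>2 + (p - 1) * (schatten_norm p X)\<^sup>2"
    using schatten_two_uniform_convexity[OF p(1) _ Z X] p by simp
  note c = herm_carrier[OF Z] herm_carrier[OF X]
  define Y where "Y = complex_of_real (1/2) \<cdot>\<^sub>m X"
  have Y: "herm n Y" unfolding Y_def by (rule herm_smult[OF X])
  have sY: "(schatten_norm p Y)\<^sup>2 = (schatten_norm p X)\<^sup>2 / 4"
    unfolding Y_def using p by (subst schatten_norm_smult[OF X]) (simp_all add: power_divide)
  have cY: "Y \<in> carrier_mat n n" by (rule herm_carrier[OF Y])
  have m: "Z + Y + Y = Z + X" "Z + Y - Y = Z" "Z - Y + Y = Z" "Z - Y - Y = Z - X"
    using c cY unfolding Y_def by (auto intro!: eq_matI)
  note i1 = schatten_two_uniform_convexity[OF p(1) _ herm_add[OF Z Y] Y, unfolded m sY]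
  note i2 = schatten_two_uniform_convexity[OF p(1) _ herm_minus[OF Z Y] Y, unfolded m sY]
  note i3 = schatten_two_uniform_convexity[OF p(1) _ Z Y, unfolded sY]
  have e1: "((schatten_norm p (Z + X))\<^sup>2 + (schatten_norm p Z)\<^sup>2) / 2
      = (schatten_norm p (Z + Y))\<^sup>2 + (p - 1) * ((schatten_norm p X)\<^sup>2 / 4)"
    and e2: "((schatten_norm p Z)\<^sup>2 + (schatten_norm p (Z - X))\<^sup>2) / 2
      = (schatten_norm p (Z - Y))\<^sup>2 + (p - 1) * ((schatten_norm p X)\<^sup>2 / 4)"
    using i1 i2 i3 eq p by (simp_all add: field_simps)
  have "schatten_norm p (Z + X) = schatten_norm p Z"
    using schatten_two_uniform_convexity_equality[OF p herm_add[OF Z Y] Y] e1 unfolding m sY by blast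
  moreover have "schatten_norm p Z = schatten_norm p (Z - X)"
    using schatten_two_uniform_convexity_equality[OF p herm_minus[OF Z Y] Y] e2 unfolding m sY by blast
  ultimately have "(p - 1) * (schatten_norm p X)\<^sup>2 = 0" using eq by simp
  then show False using schatten_norm_pos[OF X X0, of p] p by simp
qed

section \<open>Uniform convexity of the distance\<close>

lemma geom_mean_exp_herm:
  assumes X: "herm n X" and H: "herm n H" and G: "exp_herm (-1/2) X * B * exp_herm (-1/2) X = exp_herm 1 H"
  shows "exp_herm 1 X #\<^sub>m B = exp_herm (1/2) X * exp_herm (1/2) H * exp_herm (1/2) X"
  unfolding geom_mean_def mat_powr_exp_herm[OF X] using G mat_powr_exp_herm[OF H, of 1 "1/2"] by simp

lemma exp_herm_commute:
  assumes X: "herm n X" and Y: "herm n Y" and comm: "X * Y = Y * X"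
  shows "exp_herm r X * exp_herm s Y = exp_herm s Y * exp_herm r X"
proof -
  have "exp_herm r X * Y = Y * exp_herm r X"
    unfolding exp_herm_def by (rule herm_fun_commute[OF X herm_carrier[OF Y] comm])
  from herm_fun_commute[OF Y exp_herm_carrier[OF X] this[symmetric]] show ?thesis
    unfolding exp_herm_def[of s] by (rule sym)
qed

text \<open>A congruence takes \<open>A\<close>, \<open>B\<close> and their mean to \<open>exp (-H/2)\<close>, \<open>exp (H/2)\<close> and the identity, and \<open>C\<close> to
  some \<open>exp Z\<close>. There the distances to the mean and between \<open>A\<close> and \<open>B\<close> are norms, and the exponential
  metric increasing property bounds the other two.\<close>

lemma geodesic_normal_form:
  assumes p: "1 < p" "p \<le> 2"
    and A: "A \<in> pos_def_mats n" and B: "B \<in> pos_def_mats n" and C: "C \<in> pos_def_mats n"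
  obtains H Z where "herm n H" "herm n Z"
    "delta p A B = schatten_norm p H" "delta p (A #\<^sub>m B) C = schatten_norm p Z"
    "delta p A C \<ge> schatten_norm p (Z + of_real (1/2) \<cdot>\<^sub>m H)"
    "delta p B C \<ge> schatten_norm p (Z - of_real (1/2) \<cdot>\<^sub>m H)"
    "H * Z \<noteq> Z * H \<Longrightarrow> delta p B C > schatten_norm p (Z - of_real (1/2) \<cdot>\<^sub>m H)"
    "H * Z = Z * H \<Longrightarrow> gamma_commute n A B C"
    "H = 0\<^sub>m n n \<Longrightarrow> A = B"
proof -
  define X where "X = mat_log A"
  have X: "herm n X" and AX: "A = exp_herm 1 X"
    using mat_log_herm[OF A] exp_herm_mat_log[OF A] by (auto simp: X_def)
  have Bc: "B \<in> carrier_mat n n" and Cc: "C \<in> carrier_mat n n" and Ac: "A \<in> carrier_mat n n"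
    using A B C by (auto simp: pos_def_mats_def)
  define G where "G = exp_herm (-1/2) X * B * exp_herm (-1/2) X"
  have G: "G \<in> pos_def_mats n" unfolding G_def by (rule herm_conj_exp[OF X B])
  define H where "H = mat_log G"
  have H: "herm n H" and GH: "exp_herm 1 H = G"
    using mat_log_herm[OF G] exp_herm_mat_log[OF G] by (auto simp: H_def)
  \<comment> \<open>\<open>A\<^sup>-\<^sup>1\<^sup>/\<^sup>2\<close> moves \<open>A\<close> to the identity and \<open>B\<close> to \<open>exp H\<close>, and \<open>exp (-H/4)\<close> centres the pair.\<close>
  define T where "T = exp_herm (-1/4) H * exp_herm (-1/2) X"
  define R where "R = exp_herm (1/2) X * exp_herm (1/4) H"
  have Tc: "T \<in> carrier_mat n n" and Rc: "R \<in> carrier_mat n n" using X H by (auto simp: T_def R_def)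
  have TR: "T * R = 1\<^sub>m n" and RT: "R * T = 1\<^sub>m n"
    unfolding T_def R_def using X H exp_herm_cancel[OF X, of _ "1/2"] exp_herm_cancel[OF H, of _ "1/4"]
    by (simp_all add: mult_assoc_square[of _ n] exp_herm_mult exp_herm_0)
  have Tadj: "mat_adjoint T = exp_herm (-1/2) X * exp_herm (-1/4) H"
    unfolding T_def using X H by (simp add: mat_adjoint_mult[of _ n n _ n])
  have TA: "T * A * mat_adjoint T = exp_herm (-1/2) H"
  proof -
    have "T * A * mat_adjoint T = exp_herm (-1/4) H * (exp_herm (-1/2) X * exp_herm 1 X * exp_herm (-1/2) X) * exp_herm (-1/4) H"
      unfolding T_def Tadj[unfolded T_def] AX using X H by (simp add: mult_assoc_square[of _ n])
    also have "exp_herm (-1/2) X * exp_herm 1 X * exp_herm (-1/2) X = 1\<^sub>m n"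
      using X by (simp add: exp_herm_mult exp_herm_0)
    finally show ?thesis using H by (simp add: exp_herm_mult)
  qed
  have TB: "T * B * mat_adjoint T = exp_herm (1/2) H"
  proof -
    have "T * B * mat_adjoint T = exp_herm (-1/4) H * G * exp_herm (-1/4) H"
      unfolding T_def Tadj[unfolded T_def] G_def using X H Bc by (simp add: mult_assoc_square[of _ n])
    then show ?thesis unfolding GH[symmetric] using H by (simp add: exp_herm_mult)
  qed
  have M: "A #\<^sub>m B = exp_herm (1/2) X * exp_herm (1/2) H * exp_herm (1/2) X"
    unfolding AX by (rule geom_mean_exp_herm[OF X H]) (simp add: GH G_def)
  have TM: "T * (A #\<^sub>m B) * mat_adjoint T = 1\<^sub>m n"
  proof -
    have "T * (A #\<^sub>m B) * mat_adjoint T = exp_herm (-1/4) H * (exp_herm (1/2) H * exp_herm (-1/4) H)"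
      unfolding M T_def Tadj[unfolded T_def]
      using X H exp_herm_cancel(1)[OF X, of _ "1/2"] exp_herm_cancel(2)[OF X, of _ "1/2"]
      by (simp add: mult_assoc_square[of _ n])
    then show ?thesis using H by (simp add: exp_herm_mult exp_herm_0)
  qed
  have Mpd: "A #\<^sub>m B \<in> pos_def_mats n" unfolding M by (rule herm_conj_exp[OF X exp_herm_pos_def[OF H]])
  have TCpd: "T * C * mat_adjoint T \<in> pos_def_mats n"
  proof -
    have "mat_adjoint R * mat_adjoint T = 1\<^sub>m n"
      using arg_cong[OF TR, of mat_adjoint] Tc Rc by (simp add: mat_adjoint_mult[of T n n R n])
    then show ?thesis using pos_def_congruence[OF C, of "mat_adjoint T" "mat_adjoint R"] Tc Rc by simp
  qed
  define Z where "Z = mat_log (T * C * mat_adjoint T)"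
  have Z: "herm n Z" and TC: "T * C * mat_adjoint T = exp_herm 1 Z"
    using mat_log_herm[OF TCpd] exp_herm_mat_log[OF TCpd] by (auto simp: Z_def)
  note cong = delta_congruence[OF _ _ Tc Rc TR]
  define Y where "Y = complex_of_real (1/2) \<cdot>\<^sub>m H"
  define Y' where "Y' = complex_of_real (-1/2) \<cdot>\<^sub>m H"
  have Y: "herm n Y" and Y': "herm n Y'" unfolding Y_def Y'_def by (rule herm_smult[OF H])+
  have expY: "exp_herm (1/2) H = exp_herm 1 Y" "exp_herm (-1/2) H = exp_herm 1 Y'"
    unfolding Y_def Y'_def exp_herm_smult[OF H] by simp_all
  have ZY': "Z - Y' = Z + Y"
    unfolding Y_def Y'_def using herm_carrier[OF Z] herm_carrier[OF H] by (intro eq_matI) auto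
  have AB: "delta p A B = schatten_norm p H"
    unfolding AX delta_exp_herm[OF X] H_def G_def ..
  have MC: "delta p (A #\<^sub>m B) C = schatten_norm p Z"
  proof -
    have zero: "exp_herm r (complex_of_real 0 \<cdot>\<^sub>m H) = 1\<^sub>m n" for r
      unfolding exp_herm_smult[OF H] using H by (simp add: exp_herm_0)
    have "delta p (A #\<^sub>m B) C = delta p (1\<^sub>m n) (exp_herm 1 Z)"
      unfolding cong[OF Mpd C, of p, symmetric] TM TC ..
    also have "\<dots> = schatten_norm p (mat_log (exp_herm 1 Z))"
      using delta_exp_herm[OF herm_smult[OF H, of 0], of p "exp_herm 1 Z"] Z unfolding zero by simp
    also have "mat_log (exp_herm 1 Z) = Z"
      unfolding mat_log_exp_herm[OF Z] by (auto intro!: eq_matI)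
    finally show ?thesis .
  qed
  have AC: "delta p A C \<ge> schatten_norm p (Z + Y)"
    unfolding cong[OF A C, of p, symmetric] TA TC expY
    using exponential_metric_increasing(1)[OF p Y' Z] by (simp add: ZY')
  have BC: "delta p B C \<ge> schatten_norm p (Z - Y)"
    unfolding cong[OF B C, of p, symmetric] TB TC expY
    by (rule exponential_metric_increasing(1)[OF p Y Z])
  have BC_strict: "delta p B C > schatten_norm p (Z - Y)" if "H * Z \<noteq> Z * H"
  proof -
    have "Y * Z \<noteq> Z * Y"
    proof
      assume YZ: "Y * Z = Z * Y"
      have "exp_herm (1/2) H * exp_herm 1 Z = exp_herm 1 Z * exp_herm (1/2) H"
        unfolding expY by (rule exp_herm_commute[OF Y Z YZ])
      then show False using exp_herm_commute_imp[OF H Z, of "1/2" 1] that by simp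
    qed
    then show ?thesis
      unfolding cong[OF B C, of p, symmetric] TB TC expY
      by (rule exponential_metric_increasing(2)[OF p Y Z])
  qed
  have gamma: "gamma_commute n A B C" if comm: "H * Z = Z * H"
    unfolding gamma_commute_def
  proof (intro bexI[of _ T] conjI)
    show "T \<in> carrier_mat n n" by (rule Tc)
    show "invertible_mat T"
      unfolding invertible_mat_def inverts_mat_def using Tc Rc TR RT by auto
    show "let A' = T * A * mat_adjoint T; B' = T * B * mat_adjoint T; C' = T * C * mat_adjoint T
      in A' * B' = B' * A' \<and> A' * C' = C' * A' \<and> B' * C' = C' * B'"
      unfolding Let_def TA TB TC
      using exp_herm_commute[OF H Z comm] H by (simp add: exp_herm_mult)
  qed
  have eq: "A = B" if "H = 0\<^sub>m n n"
  proof -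
    have "H = complex_of_real 0 \<cdot>\<^sub>m H" unfolding that by (auto intro!: eq_matI)
    then have "exp_herm r H = 1\<^sub>m n" for r using exp_herm_smult[OF H, of r 0] exp_herm_0[OF H] by simp
    then have TATB: "T * A * mat_adjoint T = T * B * mat_adjoint T" unfolding TA TB by simp
    have inverse_congruence: "R * (T * M * mat_adjoint T) * mat_adjoint R = M" if "M \<in> carrier_mat n n" for M
    proof -
      have "mat_adjoint T * mat_adjoint R = 1\<^sub>m n"
        using arg_cong[OF RT, of mat_adjoint] Tc Rc by (simp add: mat_adjoint_mult[of R n n T n])
      moreover have "R * (T * M * mat_adjoint T) * mat_adjoint R = (R * T) * M * (mat_adjoint T * mat_adjoint R)"
        using Tc Rc that by (simp add: mult_assoc_square[of _ n])
      ultimately show ?thesis using that by (simp add: RT)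
    qed
    show ?thesis
      by (rule trans[OF sym[OF inverse_congruence[OF Ac, unfolded TATB]] inverse_congruence[OF Bc]])
  qed
  show ?thesis
    by (rule that[OF H Z AB MC]) (use AC BC BC_strict gamma eq in \<open>unfold Y_def, auto\<close>)
qed

text \<open>The uniform convexity of the norm for \<open>Z\<close> and \<open>H/2\<close>, after the lower bounds for \<open>\<delta>(A, C)\<close> and \<open>\<delta>(B, C)\<close>.
  It is strict if one of these bounds is strict, or if the norm inequality is.\<close>

lemma delta_two_uniform_convexity:
  assumes p: "1 < p" "p \<le> 2"
    and A: "A \<in> pos_def_mats n" and B: "B \<in> pos_def_mats n" and C: "C \<in> pos_def_mats n"
  shows "((delta p A C)\<^sup>2 + (delta p B C)\<^sup>2) / 2 \<ge> (delta p (A #\<^sub>m B) C)\<^sup>2 + (p - 1) / 4 * (delta p A B)\<^sup>2"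
    and "\<not> gamma_commute n A B C \<or> p < 2 \<and> A \<noteq> B \<Longrightarrow>
      ((delta p A C)\<^sup>2 + (delta p B C)\<^sup>2) / 2 > (delta p (A #\<^sub>m B) C)\<^sup>2 + (p - 1) / 4 * (delta p A B)\<^sup>2"
proof -
  obtain H Z where H: "herm n H" and Z: "herm n Z"
    and AB: "delta p A B = schatten_norm p H" and MC: "delta p (A #\<^sub>m B) C = schatten_norm p Z"
    and AC: "delta p A C \<ge> schatten_norm p (Z + of_real (1/2) \<cdot>\<^sub>m H)"
    and BC: "delta p B C \<ge> schatten_norm p (Z - of_real (1/2) \<cdot>\<^sub>m H)"
    and strict: "H * Z \<noteq> Z * H \<Longrightarrow> delta p B C > schatten_norm p (Z - of_real (1/2) \<cdot>\<^sub>m H)"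
    and gamma: "H * Z = Z * H \<Longrightarrow> gamma_commute n A B C"
    and zero: "H = 0\<^sub>m n n \<Longrightarrow> A = B"
    using geodesic_normal_form[OF p A B C] by blast
  define Y where "Y = complex_of_real (1/2) \<cdot>\<^sub>m H"
  have Y: "herm n Y" unfolding Y_def by (rule herm_smult[OF H])
  have sY: "(p - 1) * (schatten_norm p Y)\<^sup>2 = (p - 1) / 4 * (schatten_norm p H)\<^sup>2"
    unfolding Y_def using p by (subst schatten_norm_smult[OF H]) (simp_all add: power_divide)
  note convex = schatten_two_uniform_convexity[OF p Z Y, unfolded sY]
  have AC2: "(delta p A C)\<^sup>2 \<ge> (schatten_norm p (Z + Y))\<^sup>2" and BC2: "(delta p B C)\<^sup>2 \<ge> (schatten_norm p (Z - Y))\<^sup>2"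
    using AC BC unfolding Y_def by (auto intro!: power_mono schatten_norm_nonneg)
  show "((delta p A C)\<^sup>2 + (delta p B C)\<^sup>2) / 2 \<ge> (delta p (A #\<^sub>m B) C)\<^sup>2 + (p - 1) / 4 * (delta p A B)\<^sup>2"
    unfolding AB MC using convex AC2 BC2 by argo
  show "((delta p A C)\<^sup>2 + (delta p B C)\<^sup>2) / 2 > (delta p (A #\<^sub>m B) C)\<^sup>2 + (p - 1) / 4 * (delta p A B)\<^sup>2"
    if "\<not> gamma_commute n A B C \<or> p < 2 \<and> A \<noteq> B"
    using that
  proof
    assume "\<not> gamma_commute n A B C"
    then have "delta p B C > schatten_norm p (Z - Y)" using gamma strict unfolding Y_def by blast
    then have "(delta p B C)\<^sup>2 > (schatten_norm p (Z - Y))\<^sup>2"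
      by (intro power_strict_mono schatten_norm_nonneg) auto
    then show ?thesis unfolding AB MC using convex AC2 by argo
  next
    assume pAB: "p < 2 \<and> A \<noteq> B"
    have "Y \<noteq> 0\<^sub>m n n"
    proof
      assume Y0: "Y = 0\<^sub>m n n"
      have "H = 0\<^sub>m n n"
      proof (rule eq_matI)
        fix i j assume "i < dim_row (0\<^sub>m n n :: complex mat)" "j < dim_col (0\<^sub>m n n :: complex mat)"
        then have ij: "i < n" "j < n" by auto
        have "of_real (1/2) * H $$ (i, j) = Y $$ (i, j)" unfolding Y_def using herm_carrier[OF H] ij by simp
        also have "\<dots> = 0" unfolding Y0 using ij by simp
        finally show "H $$ (i, j) = 0\<^sub>m n n $$ (i, j)" using ij by simp
      qed (use herm_carrier[OF H] in auto)
      then show False using zero pAB by blast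
    qed
    from schatten_two_uniform_convexity_strict[OF p(1) _ Z Y this, unfolded sY] pAB
    show ?thesis unfolding AB MC using AC2 BC2 by argo
  qed
qed

lemma one_pos_def: "1\<^sub>m n \<in> pos_def_mats n"
  using pos_def_iff_eigenvalues[OF eigen_dec_one[OF unitary_one[of n]]] by simp

text \<open>Cancelling the outer factors \<open>X\<close> and \<open>X\<^sup>*\<close> in the three relations shows that \<open>P = X\<^sup>* X\<close> commutes with
  \<open>A\<close> and \<open>B\<close> and that \<open>A P B = B P A\<close>, hence \<open>P A B = P B A\<close>.\<close>

lemma gamma_commute_one_imp:
  assumes A: "A \<in> carrier_mat n n" and B: "B \<in> carrier_mat n n" and g: "gamma_commute n A B (1\<^sub>m n)"
  shows "commutator A B = 0\<^sub>m n n"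
proof -
  obtain X where X: "X \<in> carrier_mat n n" and inv: "invertible_mat X"
    and c: "(X * A * mat_adjoint X) * (X * B * mat_adjoint X) = (X * B * mat_adjoint X) * (X * A * mat_adjoint X)"
      "(X * A * mat_adjoint X) * (X * mat_adjoint X) = (X * mat_adjoint X) * (X * A * mat_adjoint X)"
      "(X * B * mat_adjoint X) * (X * mat_adjoint X) = (X * mat_adjoint X) * (X * B * mat_adjoint X)"
    using g unfolding gamma_commute_def Let_def by auto
  obtain Y where XY: "X * Y = 1\<^sub>m n" and YX': "Y * X = 1\<^sub>m (dim_row Y)"
    using inv X unfolding invertible_mat_def inverts_mat_def by auto
  have "dim_row Y = n" using arg_cong[OF YX', of dim_col] X by simp
  with YX' have YX: "Y * X = 1\<^sub>m n" by simp
  have Y: "Y \<in> carrier_mat n n"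
    using arg_cong[OF XY, of dim_col] \<open>dim_row Y = n\<close> by (intro carrier_matI) auto
  define P where "P = mat_adjoint X * X"
  have P: "P \<in> carrier_mat n n" using X by (simp add: P_def)
  note as = mult_assoc_square[of _ n]
  have Xa: "mat_adjoint X * mat_adjoint Y = 1\<^sub>m n"
    using arg_cong[OF YX, of mat_adjoint] X Y by (simp add: mat_adjoint_mult[of Y n n X n])
  have strip: "M = N" if "X * M * mat_adjoint X = X * N * mat_adjoint X" "M \<in> carrier_mat n n" "N \<in> carrier_mat n n" for M N
  proof -
    have "Y * (X * K * mat_adjoint X) * mat_adjoint Y = K" if K: "K \<in> carrier_mat n n" for K
    proof -
      have "Y * (X * K * mat_adjoint X) * mat_adjoint Y = (Y * X) * K * (mat_adjoint X * mat_adjoint Y)"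
        using X Y K by (simp add: as)
      then show ?thesis using K by (simp add: YX Xa)
    qed
    note recover = this
    show ?thesis by (rule trans[OF sym[OF recover[OF that(2), unfolded that(1)]] recover[OF that(3)]])
  qed
  have AB: "A * P * B = B * P * A"
    by (rule strip) (use X A B P c(1) in \<open>simp_all add: P_def as\<close>)
  have AP: "A * P = P * A"
    by (rule strip) (use X A B P c(2) in \<open>simp_all add: P_def as\<close>)
  have BP: "B * P = P * B"
    by (rule strip) (use X A B P c(3) in \<open>simp_all add: P_def as\<close>)
  have "P * (A * B) = P * A * B" using A B P by (simp add: as)
  also have "\<dots> = A * P * B" by (simp only: AP)
  also have "\<dots> = P * B * A" by (simp only: AB BP)
  also have "\<dots> = P * (B * A)" using A B P by (simp add: as)
  finally have "P * (A * B) = P * (B * A)" .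
  moreover define Q where "Q = Y * mat_adjoint Y"
  moreover have "Q * P = 1\<^sub>m n"
  proof -
    have "mat_adjoint Y * mat_adjoint X = 1\<^sub>m n"
      using arg_cong[OF XY, of mat_adjoint] X Y by (simp add: mat_adjoint_mult[of X n n Y n])
    then have "mat_adjoint Y * (mat_adjoint X * X) = X" using X Y by (simp flip: as)
    then show ?thesis unfolding Q_def P_def using X Y YX by (simp add: as)
  qed
  moreover have "Q \<in> carrier_mat n n" using Y by (simp add: Q_def)
  ultimately have "A * B = B * A"
    using as[of Q P "A * B"] as[of Q P "B * A"] A B P by simp
  then show ?thesis unfolding commutator_def using A B by (simp add: minus_r_inv_mat[of _ n n])
qed

section \<open>Optimality of the constants and the equality cases\<close>

lemma herm_fun_real_diag: "herm_fun f (real_diag n d) = real_diag n (\<lambda>i. f (d i))"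
  by (rule eigen_dec_unique[OF eigen_dec_herm_fun[OF eigen_dec_real_diag] eigen_dec_real_diag])

lemma real_diag_pos_def: "(\<And>i. i < n \<Longrightarrow> d i > 0) \<Longrightarrow> real_diag n d \<in> pos_def_mats n"
  using pos_def_iff_eigenvalues[OF eigen_dec_real_diag] by blast

lemma delta_real_diag:
  "delta p (real_diag n (\<lambda>i. exp (a i))) (real_diag n (\<lambda>i. exp (b i))) = (\<Sum>i<n. \<bar>b i - a i\<bar> powr p) powr (1 / p)"
proof -
  have e: "exp (a i) powr (-1/2) * exp (b i) * exp (a i) powr (-1/2) = exp (b i - a i)" for i
    unfolding exp_powr_real by (simp flip: exp_add)
  have "mat_log (mat_powr (real_diag n (\<lambda>i. exp (a i))) (-1/2) * real_diag n (\<lambda>i. exp (b i))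
      * mat_powr (real_diag n (\<lambda>i. exp (a i))) (-1/2)) = real_diag n (\<lambda>i. b i - a i)"
    unfolding mat_powr_def mat_log_def herm_fun_real_diag real_diag_mult e by simp
  then show ?thesis
    unfolding delta_def schatten_norm_herm[OF eigen_dec_herm[OF eigen_dec_real_diag]] pow_sum_eigen[OF eigen_dec_real_diag]
    by (simp only: schatten_norm_herm[OF eigen_dec_herm[OF eigen_dec_real_diag]] pow_sum_eigen[OF eigen_dec_real_diag])
qed

lemma geom_mean_real_diag:
  "real_diag n (\<lambda>i. exp (a i)) #\<^sub>m real_diag n (\<lambda>i. exp (b i)) = real_diag n (\<lambda>i. exp ((a i + b i) / 2))"
proof -
  have e: "exp (a i) powr (1/2) * (exp (a i) powr (-1/2) * exp (b i) * exp (a i) powr (-1/2)) powr (1/2) * exp (a i) powr (1/2)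
      = exp ((a i + b i) / 2)" for i
  proof -
    have "a i * (1/2) + (a i * (-1/2) + b i + a i * (-1/2)) * (1/2) + a i * (1/2) = (a i + b i) / 2"
      by (simp add: field_simps)
    then show ?thesis unfolding exp_powr_real exp_add[symmetric] by simp
  qed
  show ?thesis
    unfolding geom_mean_def mat_powr_def herm_fun_real_diag real_diag_mult e ..
qed

text \<open>The two diagonal matrices with the logarithms \<open>u, v\<close> and \<open>v, u\<close> have a multiple of the identity as
  their mean, and all distances are explicit.\<close>

lemma swapped_diagonal_example:
  assumes p: "p > 0" and uv: "0 < u" "0 < v"
  obtains A B where "A \<in> pos_def_mats 2" "B \<in> pos_def_mats 2"
    "delta p A (1\<^sub>m 2) = (u powr p + v powr p) powr (1 / p)" "delta p B (1\<^sub>m 2) = (u powr p + v powr p) powr (1 / p)"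
    "delta p (A #\<^sub>m B) (1\<^sub>m 2) = 2 powr (1 / p) * ((u + v) / 2)" "delta p A B = 2 powr (1 / p) * \<bar>u - v\<bar>"
proof -
  define a where "a i = (if i = 0 then u else v)" for i :: nat
  define b where "b i = (if i = 0 then v else u)" for i :: nat
  define A where "A = real_diag 2 (\<lambda>i. exp (a i))"
  define B where "B = real_diag 2 (\<lambda>i. exp (b i))"
  have one: "1\<^sub>m 2 = real_diag 2 (\<lambda>i. exp 0)" by (simp add: real_diag_one)
  have two: "(\<Sum>i<2. f i) = f 0 + f 1" for f :: "nat \<Rightarrow> real" by (simp add: numeral_2_eq_2)
  have root: "(x powr p + x powr p) powr (1 / p) = 2 powr (1 / p) * x" if "x \<ge> 0" for x
  proof -
    have "(x powr p + x powr p) powr (1 / p) = (2 * x powr p) powr (1 / p)" by simp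
    then show ?thesis using p that by (simp add: powr_mult powr_powr)
  qed
  show ?thesis
  proof (rule that[of A B])
    show "A \<in> pos_def_mats 2" "B \<in> pos_def_mats 2" unfolding A_def B_def by (intro real_diag_pos_def exp_gt_zero)+
    show "delta p A (1\<^sub>m 2) = (u powr p + v powr p) powr (1 / p)"
      unfolding A_def one delta_real_diag two using uv by (simp add: a_def)
    show "delta p B (1\<^sub>m 2) = (u powr p + v powr p) powr (1 / p)"
      unfolding B_def one delta_real_diag two using uv by (simp add: b_def add.commute)
    have "(\<lambda>i. exp ((a i + b i) / 2)) = (\<lambda>i. exp ((u + v) / 2))" by (auto simp: a_def b_def add.commute)
    then show "delta p (A #\<^sub>m B) (1\<^sub>m 2) = 2 powr (1 / p) * ((u + v) / 2)"
      unfolding A_def B_def geom_mean_real_diag one using uv root[of "(u + v) / 2"] delta_real_diag[of p 2 "\<lambda>_. (u + v) / 2" "\<lambda>_. 0"]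
      by (simp add: two)
    show "delta p A B = 2 powr (1 / p) * \<bar>u - v\<bar>"
      unfolding A_def B_def delta_real_diag two using root[of "\<bar>u - v\<bar>"] by (simp add: a_def b_def abs_minus_commute)
  qed
qed

text \<open>With the logarithms \<open>1 + t\<close> and \<open>1 - t\<close> the quadratic inequality with a constant \<open>c\<close> reads
  \<open>m\<^sup>2\<^sup>/\<^sup>p \<ge> 1 + 4 c t\<^sup>2\<close> for the mean \<open>m\<close> of \<open>(1 + t)\<^sup>p\<close> and \<open>(1 - t)\<^sup>p\<close>, while \<open>m\<^sup>2\<^sup>/\<^sup>p = 1 + (p - 1) t\<^sup>2 + o(t\<^sup>2)\<close>.\<close>

lemma constant_optimal:
  assumes p: "1 < p" "p \<le> 2" and c: "c > (p - 1) / 4"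
  shows "\<exists>A\<in>pos_def_mats 2. \<exists>B\<in>pos_def_mats 2.
    ((delta p A (1\<^sub>m 2))\<^sup>2 + (delta p B (1\<^sub>m 2))\<^sup>2) / 2
      < (delta p (A #\<^sub>m B) (1\<^sub>m 2))\<^sup>2 + c * (delta p A B)\<^sup>2"
proof -
  define S where "S t = (1 + t) powr p + (1 - t) powr p" for t
  have "((\<lambda>t. ((S t / 2) powr (2 / p) - 1) / t\<^sup>2) \<longlongrightarrow> p - 1) (at_right 0)"
    unfolding S_def using p by real_asymp
  moreover have "p - 1 < 4 * c" using c by simp
  ultimately have "\<forall>\<^sub>F t in at_right 0. ((S t / 2) powr (2 / p) - 1) / t\<^sup>2 < 4 * c"
    by (rule order_tendstoD(2))
  moreover have "\<forall>\<^sub>F t in at_right (0::real). t \<in> {0<..<1}" by (rule eventually_at_right_real) simp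
  ultimately have "\<forall>\<^sub>F t in at_right 0. t \<in> {0<..<1} \<and> ((S t / 2) powr (2 / p) - 1) / t\<^sup>2 < 4 * c"
    by eventually_elim auto
  then obtain t where t: "0 < t" "t < 1" and less: "((S t / 2) powr (2 / p) - 1) / t\<^sup>2 < 4 * c"
    using eventually_happens'[of "at_right (0::real)"] by auto
  have S: "S t \<ge> 0" by (simp add: S_def)
  have "(S t / 2) powr (2 / p) < 1 + 4 * c * t\<^sup>2" using less t by (simp add: pos_divide_less_eq)
  then have "2 powr (2 / p) * (S t / 2) powr (2 / p) < 2 powr (2 / p) * (1 + 4 * c * t\<^sup>2)" by simp
  then have ineq: "S t powr (2 / p) < 2 powr (2 / p) * (1 + 4 * c * t\<^sup>2)" using S by (simp add: powr_divide)
  obtain A B where AB: "A \<in> pos_def_mats 2" "B \<in> pos_def_mats 2"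
    "delta p A (1\<^sub>m 2) = S t powr (1 / p)" "delta p B (1\<^sub>m 2) = S t powr (1 / p)"
    "delta p (A #\<^sub>m B) (1\<^sub>m 2) = 2 powr (1 / p) * (((1 + t) + (1 - t)) / 2)"
    "delta p A B = 2 powr (1 / p) * \<bar>(1 + t) - (1 - t)\<bar>"
    using swapped_diagonal_example[of p "1 + t" "1 - t"] p t unfolding S_def by auto
  have sq: "(x powr (1 / p))\<^sup>2 = x powr (2 / p)" for x using half_powr_sq[of x "2 / p"] by simp
  have "((1 + t) + (1 - t)) / 2 = 1" "\<bar>(1 + t) - (1 - t)\<bar> = 2 * t" using t by auto
  then have "((delta p A (1\<^sub>m 2))\<^sup>2 + (delta p B (1\<^sub>m 2))\<^sup>2) / 2
      < (delta p (A #\<^sub>m B) (1\<^sub>m 2))\<^sup>2 + c * (delta p A B)\<^sup>2"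
    unfolding AB(3-6) using ineq by (simp add: sq power_mult_distrib algebra_simps)
  with AB(1,2) show ?thesis by blast
qed

text \<open>The same matrices, with the logarithms rescaled so that both lie on the exponential unit sphere;
  \<open>\<sigma>\<close> becomes the distance of their mean from the identity.\<close>

lemma sphere_constant_optimal:
  assumes p: "1 < p" "p \<le> 2" and c: "c > (p - 1) / 8"
  shows "\<exists>A\<in>exp_unit_sphere p 2. \<exists>B\<in>exp_unit_sphere p 2.
    1 - delta p (A #\<^sub>m B) (1\<^sub>m 2) < c * (delta p A B)\<^sup>2"
proof -
  define S where "S t = (1 + t) powr p + (1 - t) powr p" for t
  define \<sigma> where "\<sigma> t = (S t / 2) powr (- 1 / p)" for t
  have "((\<lambda>t. (1 - \<sigma> t) / ((\<sigma> t)\<^sup>2 * t\<^sup>2)) \<longlongrightarrow> (p - 1) / 2) (at_right 0)"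
    unfolding \<sigma>_def S_def using p by real_asymp
  moreover have "(p - 1) / 2 < 4 * c" using c by simp
  ultimately have "\<forall>\<^sub>F t in at_right 0. (1 - \<sigma> t) / ((\<sigma> t)\<^sup>2 * t\<^sup>2) < 4 * c"
    by (rule order_tendstoD(2))
  moreover have "\<forall>\<^sub>F t in at_right (0::real). t \<in> {0<..<1}" by (rule eventually_at_right_real) simp
  ultimately have "\<forall>\<^sub>F t in at_right 0. t \<in> {0<..<1} \<and> (1 - \<sigma> t) / ((\<sigma> t)\<^sup>2 * t\<^sup>2) < 4 * c"
    by eventually_elim auto
  then obtain t where t: "0 < t" "t < 1" and less: "(1 - \<sigma> t) / ((\<sigma> t)\<^sup>2 * t\<^sup>2) < 4 * c"
    using eventually_happens'[of "at_right (0::real)"] by auto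
  have S: "S t > 0" using t by (simp add: S_def add_pos_pos)
  have \<sigma>: "\<sigma> t > 0" using S by (simp add: \<sigma>_def)
  have ineq: "1 - \<sigma> t < 4 * c * ((\<sigma> t)\<^sup>2 * t\<^sup>2)" using less \<sigma> t by (simp add: pos_divide_less_eq)
  define r where "r = S t powr (- 1 / p)"
  have r: "r > 0" using S by (simp add: r_def)
  have r2: "2 powr (1 / p) * r = \<sigma> t"
    using S by (simp add: r_def \<sigma>_def powr_divide powr_minus_divide field_simps)
  have norm: "((r * (1 + t)) powr p + (r * (1 - t)) powr p) powr (1 / p) = 1"
  proof -
    have "(r * (1 + t)) powr p = r powr p * (1 + t) powr p" "(r * (1 - t)) powr p = r powr p * (1 - t) powr p"
      using r t by (auto intro!: powr_mult)
    then have "(r * (1 + t)) powr p + (r * (1 - t)) powr p = r powr p * S t"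
      by (simp only: S_def distrib_left)
    also have "r powr p = S t powr (- 1)" using p by (simp add: r_def powr_powr)
    also have "S t powr (- 1) * S t = 1" using S by (simp add: powr_minus_divide)
    finally show ?thesis by simp
  qed
  obtain A B where AB: "A \<in> pos_def_mats 2" "B \<in> pos_def_mats 2"
    "delta p A (1\<^sub>m 2) = 1" "delta p B (1\<^sub>m 2) = 1"
    "delta p (A #\<^sub>m B) (1\<^sub>m 2) = 2 powr (1 / p) * ((r * (1 + t) + r * (1 - t)) / 2)"
    "delta p A B = 2 powr (1 / p) * \<bar>r * (1 + t) - r * (1 - t)\<bar>"
    using swapped_diagonal_example[of p "r * (1 + t)" "r * (1 - t)"] p t r unfolding norm by auto
  have "(r * (1 + t) + r * (1 - t)) / 2 = r" by (simp add: algebra_simps)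
  moreover have "\<bar>r * (1 + t) - r * (1 - t)\<bar> = r * (2 * t)" using r t by (simp add: algebra_simps)
  ultimately have "delta p (A #\<^sub>m B) (1\<^sub>m 2) = \<sigma> t" "delta p A B = \<sigma> t * (2 * t)"
    using AB(5,6) r2 by (simp_all flip: mult.assoc)
  then have "1 - delta p (A #\<^sub>m B) (1\<^sub>m 2) < c * (delta p A B)\<^sup>2"
    using ineq by (simp add: power_mult_distrib ac_simps)
  with AB(1-4) show ?thesis unfolding exp_unit_sphere_def by blast
qed

text \<open>On the sphere the quadratic inequality bounds \<open>1 - d\<^sup>2\<close>, and \<open>1 - d\<^sup>2 \<le> 2 (1 - d)\<close>.\<close>

lemma sphere_from_quadratic:
  fixes d e p :: real
  shows "1 \<ge> d\<^sup>2 + (p - 1) / 4 * e\<^sup>2 \<Longrightarrow> 1 - d \<ge> (p - 1) / 8 * e\<^sup>2"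
    and "1 > d\<^sup>2 + (p - 1) / 4 * e\<^sup>2 \<Longrightarrow> 1 - d > (p - 1) / 8 * e\<^sup>2"
proof -
  define x where "x = (p - 1) * e\<^sup>2"
  have x: "(p - 1) / 4 * e\<^sup>2 = x / 4" "(p - 1) / 8 * e\<^sup>2 = x / 8" by (simp_all add: x_def)
  have "0 \<le> (1 - d)\<^sup>2" by simp
  then have "2 * (1 - d) \<ge> 1 - d\<^sup>2" by (simp add: power2_eq_square algebra_simps)
  then show "1 \<ge> d\<^sup>2 + (p - 1) / 4 * e\<^sup>2 \<Longrightarrow> 1 - d \<ge> (p - 1) / 8 * e\<^sup>2"
    and "1 > d\<^sup>2 + (p - 1) / 4 * e\<^sup>2 \<Longrightarrow> 1 - d > (p - 1) / 8 * e\<^sup>2"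
    unfolding x by argo+
qed

theorem theorem3p3:
  fixes p :: real
  assumes "1 < p" and "p \<le> 2"
  shows
    \<comment> \<open>(i)\<close>
    "(\<forall>n>0. \<forall>A\<in>pos_def_mats n. \<forall>B\<in>pos_def_mats n. \<forall>C\<in>pos_def_mats n.
        ((delta p A C)^2 + (delta p B C)^2) / 2
          \<ge> (delta p (A #\<^sub>m B) C)^2 + (p - 1) / 4 * (delta p A B)^2)
    \<and> \<comment> \<open>(ii)\<close>
     (\<forall>n>0. \<forall>A\<in>pos_def_mats n. \<forall>B\<in>pos_def_mats n.
        ((delta p A (1\<^sub>m n))^2 + (delta p B (1\<^sub>m n))^2) / 2
          \<ge> (delta p (A #\<^sub>m B) (1\<^sub>m n))^2 + (p - 1) / 4 * (delta p A B)^2)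
    \<and> \<comment> \<open>(iii)\<close>
     (\<forall>n>0. \<forall>A\<in>exp_unit_sphere p n. \<forall>B\<in>exp_unit_sphere p n.
        1 - delta p (A #\<^sub>m B) (1\<^sub>m n) \<ge> (p - 1) / 8 * (delta p A B)^2)
    \<and> \<comment> \<open>(iv), the constant in (ii) is best possible\<close>
     (\<forall>c > (p - 1) / 4. \<not> (\<forall>n>0. \<forall>A\<in>pos_def_mats n. \<forall>B\<in>pos_def_mats n.
        ((delta p A (1\<^sub>m n))^2 + (delta p B (1\<^sub>m n))^2) / 2
          \<ge> (delta p (A #\<^sub>m B) (1\<^sub>m n))^2 + c * (delta p A B)^2))
    \<and> \<comment> \<open>(iv), the constant in (iii) is best possible\<close>
     (\<forall>c > (p - 1) / 8. \<not> (\<forall>n>0. \<forall>A\<in>exp_unit_sphere p n. \<forall>B\<in>exp_unit_sphere p n.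
        1 - delta p (A #\<^sub>m B) (1\<^sub>m n) \<ge> c * (delta p A B)^2))
    \<and> \<comment> \<open>(iv), equality in (ii) for distinct matrices\<close>
     (\<forall>n>0. \<forall>A\<in>pos_def_mats n. \<forall>B\<in>pos_def_mats n. A \<noteq> B \<longrightarrow>
        ((delta p A (1\<^sub>m n))^2 + (delta p B (1\<^sub>m n))^2) / 2
          = (delta p (A #\<^sub>m B) (1\<^sub>m n))^2 + (p - 1) / 4 * (delta p A B)^2 \<longrightarrow>
        p = 2 \<and> commutator A B = 0\<^sub>m n n)
    \<and> \<comment> \<open>(iv), equality in (iii) for distinct matrices\<close>
     (\<forall>n>0. \<forall>A\<in>exp_unit_sphere p n. \<forall>B\<in>exp_unit_sphere p n. A \<noteq> B \<longrightarrow>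
        1 - delta p (A #\<^sub>m B) (1\<^sub>m n) = (p - 1) / 8 * (delta p A B)^2 \<longrightarrow>
        p = 2 \<and> commutator A B = 0\<^sub>m n n)
    \<and> \<comment> \<open>(v), strictness in (i)\<close>
     (\<forall>n>0. \<forall>A\<in>pos_def_mats n. \<forall>B\<in>pos_def_mats n. \<forall>C\<in>pos_def_mats n.
        \<not> gamma_commute n A B C \<longrightarrow>
        ((delta p A C)^2 + (delta p B C)^2) / 2
          > (delta p (A #\<^sub>m B) C)^2 + (p - 1) / 4 * (delta p A B)^2)
    \<and> \<comment> \<open>(v), strictness in (ii)\<close>
     (\<forall>n>0. \<forall>A\<in>pos_def_mats n. \<forall>B\<in>pos_def_mats n.
        commutator A B \<noteq> 0\<^sub>m n n \<longrightarrow>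
        ((delta p A (1\<^sub>m n))^2 + (delta p B (1\<^sub>m n))^2) / 2
          > (delta p (A #\<^sub>m B) (1\<^sub>m n))^2 + (p - 1) / 4 * (delta p A B)^2)
    \<and> \<comment> \<open>(v), strictness in (iii)\<close>
     (\<forall>n>0. \<forall>A\<in>exp_unit_sphere p n. \<forall>B\<in>exp_unit_sphere p n.
        commutator A B \<noteq> 0\<^sub>m n n \<longrightarrow>
        1 - delta p (A #\<^sub>m B) (1\<^sub>m n) > (p - 1) / 8 * (delta p A B)^2)"
proof -
  note p = assms
  have i: "((delta p A C)^2 + (delta p B C)^2) / 2 \<ge> (delta p (A #\<^sub>m B) C)^2 + (p - 1) / 4 * (delta p A B)^2"
    if "A \<in> pos_def_mats n" "B \<in> pos_def_mats n" "C \<in> pos_def_mats n" for n A B C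
    by (rule delta_two_uniform_convexity(1)[OF p that])
  have v: "((delta p A C)^2 + (delta p B C)^2) / 2 > (delta p (A #\<^sub>m B) C)^2 + (p - 1) / 4 * (delta p A B)^2"
    if "A \<in> pos_def_mats n" "B \<in> pos_def_mats n" "C \<in> pos_def_mats n" "\<not> gamma_commute n A B C \<or> p < 2 \<and> A \<noteq> B" for n A B C
    by (rule delta_two_uniform_convexity(2)[OF p that])
  have strict: "((delta p A (1\<^sub>m n))^2 + (delta p B (1\<^sub>m n))^2) / 2
      > (delta p (A #\<^sub>m B) (1\<^sub>m n))^2 + (p - 1) / 4 * (delta p A B)^2"
    if AB: "A \<in> pos_def_mats n" "B \<in> pos_def_mats n" and "commutator A B \<noteq> 0\<^sub>m n n \<or> p < 2 \<and> A \<noteq> B" for n A B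
  proof -
    have "A \<in> carrier_mat n n" "B \<in> carrier_mat n n" using AB by (auto simp: pos_def_mats_def)
    then have "\<not> gamma_commute n A B (1\<^sub>m n) \<or> p < 2 \<and> A \<noteq> B"
      using gamma_commute_one_imp that(3) by blast
    then show ?thesis by (rule v[OF AB one_pos_def])
  qed
  have sphere: "A \<in> pos_def_mats n \<and> delta p A (1\<^sub>m n) = 1" if "A \<in> exp_unit_sphere p n" for A n
    using that by (simp add: exp_unit_sphere_def)
  have iii: "1 - delta p (A #\<^sub>m B) (1\<^sub>m n) \<ge> (p - 1) / 8 * (delta p A B)^2"
    if "A \<in> exp_unit_sphere p n" "B \<in> exp_unit_sphere p n" for n A B
    using i[of A n B "1\<^sub>m n"] one_pos_def sphere[OF that(1)] sphere[OF that(2)]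
    by (intro sphere_from_quadratic(1)) auto
  have iii_strict: "1 - delta p (A #\<^sub>m B) (1\<^sub>m n) > (p - 1) / 8 * (delta p A B)^2"
    if "A \<in> exp_unit_sphere p n" "B \<in> exp_unit_sphere p n" "commutator A B \<noteq> 0\<^sub>m n n \<or> p < 2 \<and> A \<noteq> B" for n A B
    using strict[of A n B] that(3) sphere[OF that(1)] sphere[OF that(2)]
    by (intro sphere_from_quadratic(2)) auto
  have two: "(2::nat) > 0" by simp
  show ?thesis
  proof (intro conjI allI ballI impI)
    fix c assume "c > (p - 1) / 4"
    from constant_optimal[OF p this] obtain A B where AB: "A \<in> pos_def_mats 2" "B \<in> pos_def_mats 2"
      and less: "((delta p A (1\<^sub>m 2))\<^sup>2 + (delta p B (1\<^sub>m 2))\<^sup>2) / 2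
        < (delta p (A #\<^sub>m B) (1\<^sub>m 2))\<^sup>2 + c * (delta p A B)\<^sup>2" by blast
    show "\<not> (\<forall>n>0. \<forall>A\<in>pos_def_mats n. \<forall>B\<in>pos_def_mats n.
        ((delta p A (1\<^sub>m n))^2 + (delta p B (1\<^sub>m n))^2) / 2
          \<ge> (delta p (A #\<^sub>m B) (1\<^sub>m n))^2 + c * (delta p A B)^2)"
    proof
      assume all: "\<forall>n>0. \<forall>A\<in>pos_def_mats n. \<forall>B\<in>pos_def_mats n.
        ((delta p A (1\<^sub>m n))^2 + (delta p B (1\<^sub>m n))^2) / 2
          \<ge> (delta p (A #\<^sub>m B) (1\<^sub>m n))^2 + c * (delta p A B)^2"
      show False by (rule notE[OF leD[OF all[rule_format, OF two AB]] less])
    qed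
  next
    fix c assume "c > (p - 1) / 8"
    from sphere_constant_optimal[OF p this] obtain A B where AB: "A \<in> exp_unit_sphere p 2" "B \<in> exp_unit_sphere p 2"
      and less: "1 - delta p (A #\<^sub>m B) (1\<^sub>m 2) < c * (delta p A B)\<^sup>2" by blast
    show "\<not> (\<forall>n>0. \<forall>A\<in>exp_unit_sphere p n. \<forall>B\<in>exp_unit_sphere p n.
        1 - delta p (A #\<^sub>m B) (1\<^sub>m n) \<ge> c * (delta p A B)^2)"
    proof
      assume all: "\<forall>n>0. \<forall>A\<in>exp_unit_sphere p n. \<forall>B\<in>exp_unit_sphere p n.
        1 - delta p (A #\<^sub>m B) (1\<^sub>m n) \<ge> c * (delta p A B)^2"
      show False by (rule notE[OF leD[OF all[rule_format, OF two AB]] less])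
    qed
  next
    fix n :: nat and A B assume AB: "A \<in> pos_def_mats n" "B \<in> pos_def_mats n" "A \<noteq> B"
      and eq: "((delta p A (1\<^sub>m n))^2 + (delta p B (1\<^sub>m n))^2) / 2
          = (delta p (A #\<^sub>m B) (1\<^sub>m n))^2 + (p - 1) / 4 * (delta p A B)^2"
    show "p = 2" using strict[OF AB(1,2)] AB(3) eq p by linarith
    show "commutator A B = 0\<^sub>m n n" using strict[OF AB(1,2)] eq by linarith
  next
    fix n :: nat and A B assume AB: "A \<in> exp_unit_sphere p n" "B \<in> exp_unit_sphere p n" "A \<noteq> B"
      and eq: "1 - delta p (A #\<^sub>m B) (1\<^sub>m n) = (p - 1) / 8 * (delta p A B)^2"
    show "p = 2" using iii_strict[OF AB(1,2)] AB(3) eq p by linarith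
    show "commutator A B = 0\<^sub>m n n" using iii_strict[OF AB(1,2)] eq by linarith
  qed (use i one_pos_def iii v strict iii_strict in blast)+
qed

end
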